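(* Let $X$ be a Banach space and $(T_1,\ldots,T_d)$ a $d$-tuple of commuting operators acting on $X$ such that every $T_k$ is an $R$-Ritt operator, $k=1,\ldots,d$. Suppose that $(T_1,\ldots,T_d)$ is polynomially bounded, that is, there exists a constant $C\ge1$ such that for any polynomial function $h$ of $d$ variables we have $$\|h(T_1,\ldots,T_d)\|\le C\sup\{|h(z_1,\ldots,z_d)|:(z_1,\ldots,z_d)\in\mathbb{T}^d\}.$$ Then there exist $\gamma_1,\ldots,\gamma_d$ in $(0,\frac{\pi}{2})$ such that $(T_1,\ldots,T_d)$ admits an $H^\infty(B_{\gamma_1}\times\cdots\times B_{\gamma_d})$ joint functional calculus.
   Context: Banach spaces are complex, $d\ge 1$ is an integer, $B(X)$ is the algebra of bounded operators on $X$, $R(\lambda,T)=(\lambda I_X-T)^{-1}$, $\mathbb{T}$ is the unit circle, $\mathbb{N}=\{0,1,2,\ldots\}$. Ritt operators. $T\in B(X)$ is a Ritt operator if there is $C>0$ with $\|T^n\|\le C$ and $\|n(T^n-T^{n-1})\|\le C$ for all $n\ge 1$. For $a\in(0,\frac{\pi}{2})$, the Stolz domain $B_a$ is the interior of the convex hull of $1$ and the disc $D(0,\sin a)$. A Ritt operator $T$ is of type $a\in(0,\frac\pi2)$ if $\sigma(T)\subset\overline{B_a}$ and for every $b\in(a,\frac{\pi}{2})$ there is $K_b>0$ with $\|(\lambda-1)R(\lambda,T)\|\le K_b$ for all $\lambda\in\mathbb{C}\setminus\overline{B_b}$. Every Ritt operator is of type $a$ for some $a\in(0,\frac\pi2)$.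 $R$-Ritt operators. Let $(r_k)_{k\ge1}$ be independent Rademacher variables on a probability space $\Omega_0$. A set $E\subset B(X)$ is $R$-bounded if there is $C\ge0$ such that $\|\sum_{k=1}^n r_k\otimes S_kx_k\|_{L_2(\Omega_0;X)}\le C\|\sum_{k=1}^n r_k\otimes x_k\|_{L_2(\Omega_0;X)}$ for all $n\ge1$, $S_1,\ldots,S_n\in E$, $x_1,\ldots,x_n\in X$. A Ritt operator $T$ is $R$-Ritt if the sets $\{T^n:n\in\mathbb{N}\}$ and $\{n(T^n-T^{n-1}):n\ge1\}$ are $R$-bounded. Joint functional calculus. Let $\gamma_1,\ldots,\gamma_d\in(0,\frac{\pi}{2})$. For $\Lambda\subset\{1,\ldots,d\}$, $H_0^\infty(\prod_{i\in\Lambda}B_{\gamma_i})$ is the algebra of bounded holomorphic functions $f$ on $B_{\gamma_1}\times\cdots\times B_{\gamma_d}$ depending only on the variables $(\lambda_i)_{i\in\Lambda}$ and for which there are positive constants $c,(s_i)_{i\in\Lambda}$ with $|f(\lambda_1,\ldots,\lambda_d)|\le c\prod_{i\in\Lambda}|1-\lambda_i|^{s_i}$ (constant functions if $\Lambda=\emptyset$). Let $(T_1,\ldots,T_d)$ be commuting Ritt operators, $T_k$ of type $a_k\in(0,\gamma_k)$, and let $b_k\in(a_k,\gamma_k)$. For $\Lambda\neq\emptyset$ and $f\in H_0^\infty(\prod_{i\in\Lambda}B_{\gamma_i})$, set $$f(T_1,\ldots,T_d)=\Big(\frac{1}{2\pi i}\Big)^{|\Lambda|}\int_{\prod_{i\in\Lambda}\partial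 B_{b_i}}f(\lambda_1,\ldots,\lambda_d)\prod_{i\in\Lambda}R(\lambda_i,T_i)\prod_{i\in\Lambda}d\lambda_i$$ (counterclockwise orientation; absolutely convergent and independent of the $b_i$), and $f(T_1,\ldots,T_d)=cI_X$ if $f\equiv c$. Extend linearly to the direct sum $H_{0,1}^\infty(B_{\gamma_1}\times\cdots\times B_{\gamma_d})=\bigoplus_{\Lambda\subset\{1,\ldots,d\}}H_0^\infty(\prod_{i\in\Lambda}B_{\gamma_i})$. The tuple $(T_1,\ldots,T_d)$ (with $T_k$ of some type $a_k<\gamma_k$) admits an $H^\infty(B_{\gamma_1}\times\cdots\times B_{\gamma_d})$ joint functional calculus if there is $K>0$ with $\|f(T_1,\ldots,T_d)\|\le K\sup_{B_{\gamma_1}\times\cdots\times B_{\gamma_d}}|f|$ for all $f\in H_{0,1}^\infty(B_{\gamma_1}\times\cdots\times B_{\gamma_d})$. *)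

theory Defs
  imports
    "HOL-Complex_Analysis.Complex_Analysis"
    "HOL-Probability.Probability"
    "HOL-Library.Poly_Mapping"
begin

section \<open>Complex Banach spaces and bounded operators\<close>

class scaleC =
  fixes scaleC :: "complex \<Rightarrow> 'a \<Rightarrow> 'a"  (infixr "*\<^sub>C" 75)

class complex_normed_vector = real_normed_vector + scaleC +
  assumes scaleC_add_right: "c *\<^sub>C (x + y) = c *\<^sub>C x + c *\<^sub>C y"
    and scaleC_add_left: "(c + d) *\<^sub>C x = c *\<^sub>C x + d *\<^sub>C x"
    and scaleC_scaleC: "c *\<^sub>C d *\<^sub>C x = (c * d) *\<^sub>C x"
    and scaleC_of_real: "complex_of_real r *\<^sub>C x = r *\<^sub>R x"
    and norm_scaleC: "norm (c *\<^sub>C x) = cmod c * norm x"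

class complex_banach = complex_normed_vector + complete_space

subclass (in complex_banach) banach ..

lemma bounded_linear_scaleC:
  "bounded_linear (\<lambda>x::'a::complex_normed_vector. c *\<^sub>C x)"
proof
  fix x y :: 'a and r :: real
  show "c *\<^sub>C (x + y) = c *\<^sub>C x + c *\<^sub>C y"
    by (rule scaleC_add_right)
  show "c *\<^sub>C r *\<^sub>R x = r *\<^sub>R c *\<^sub>C x"
    by (simp add: scaleC_of_real [symmetric] scaleC_scaleC mult.commute)
  show "\<exists>K. \<forall>x::'a. norm (c *\<^sub>C x) \<le> norm x * K"
    by (rule exI [of _ "cmod c"]) (simp add: norm_scaleC mult.commute)
qed

instantiation blinfun :: (real_normed_vector, complex_normed_vector) complex_normed_vector
begin

definition scaleC_blinfun :: "complex \<Rightarrow> 'a \<Rightarrow>\<^sub>L 'b \<Rightarrow> 'a \<Rightarrow>\<^sub>L 'b"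
  where "c *\<^sub>C S = Blinfun (\<lambda>x. c *\<^sub>C blinfun_apply S x)"

lemma blinfun_apply_scaleC: "blinfun_apply (c *\<^sub>C S) x = c *\<^sub>C blinfun_apply S x"
  for S :: "'a \<Rightarrow>\<^sub>L 'b"
  unfolding scaleC_blinfun_def
  by (simp add: bounded_linear_Blinfun_apply
      bounded_linear_compose [OF bounded_linear_scaleC blinfun.bounded_linear_right])

instance
proof
  fix c d :: complex and r :: real and S U :: "'a \<Rightarrow>\<^sub>L 'b"
  show "c *\<^sub>C (S + U) = c *\<^sub>C S + c *\<^sub>C U"
    by (rule blinfun_eqI) (simp add: blinfun_apply_scaleC blinfun.add_left scaleC_add_right)
  show "(c + d) *\<^sub>C S = c *\<^sub>C S + d *\<^sub>C S"
    by (rule blinfun_eqI) (simp add: blinfun_apply_scaleC blinfun.add_left scaleC_add_left)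
  show "c *\<^sub>C d *\<^sub>C S = (c * d) *\<^sub>C S"
    by (rule blinfun_eqI) (simp add: blinfun_apply_scaleC scaleC_scaleC)
  show "complex_of_real r *\<^sub>C S = r *\<^sub>R S"
    by (rule blinfun_eqI) (simp add: blinfun_apply_scaleC scaleC_of_real blinfun.scaleR_left)
  have le: "norm (a *\<^sub>C V) \<le> cmod a * norm V" for a and V :: "'a \<Rightarrow>\<^sub>L 'b"
  proof (rule norm_blinfun_bound)
    show "norm (blinfun_apply (a *\<^sub>C V) x) \<le> cmod a * norm V * norm x" for x
      using mult_left_mono [OF norm_blinfun [of V x], of "cmod a"]
      by (simp add: blinfun_apply_scaleC norm_scaleC mult.assoc)
  qed simp
  show "norm (c *\<^sub>C S) = cmod c * norm S"
  proof (cases "c = 0")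
    case True
    then show ?thesis using le [of c S] by simp
  next
    case False
    have one: "1 *\<^sub>C S = S"
      by (rule blinfun_eqI) (metis blinfun_apply_scaleC of_real_1 scaleC_of_real scaleR_one)
    have "inverse c *\<^sub>C c *\<^sub>C S = (inverse c * c) *\<^sub>C S"
      by (rule blinfun_eqI) (simp add: blinfun_apply_scaleC scaleC_scaleC)
    then have "norm S \<le> cmod (inverse c) * norm (c *\<^sub>C S)"
      using le [of "inverse c" "c *\<^sub>C S"] False one by simp
    then have "cmod c * norm S \<le> norm (c *\<^sub>C S)"
      using False by (simp add: norm_inverse pos_le_divide_eq divide_inverse_commute [symmetric] mult.commute)
    with le [of c S] show ?thesis by simp
  qed
qed

end

text \<open>The type \<^typ>\<open>'x \<Rightarrow>\<^sub>L 'x\<close> consists of the bounded \<^emph>\<open>real\<close>-linear operators; $B(X)$ is its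
  closed subalgebra \<open>bounded_ops\<close> of complex-linear ones.\<close>

definition bounded_ops :: "('x::complex_normed_vector \<Rightarrow>\<^sub>L 'x) set"
  where "bounded_ops = {S. \<forall>c x. blinfun_apply S (c *\<^sub>C x) = c *\<^sub>C blinfun_apply S x}"

definition op_power :: "'x::real_normed_vector \<Rightarrow>\<^sub>L 'x \<Rightarrow> nat \<Rightarrow> 'x \<Rightarrow>\<^sub>L 'x"
  where "op_power S n = ((\<lambda>U. S o\<^sub>L U) ^^ n) id_blinfun"

text \<open>Product of a finite family of pairwise commuting operators.\<close>

definition op_prod :: "('n \<Rightarrow> 'x::real_normed_vector \<Rightarrow>\<^sub>L 'x) \<Rightarrow> 'n set \<Rightarrow> 'x \<Rightarrow>\<^sub>L 'x"
  where "op_prod S \<Lambda> = Finite_Set.fold (\<lambda>i U. S i o\<^sub>L U) id_blinfun \<Lambda>"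

text \<open>A two-sided real-linear inverse of a complex-linear operator is complex-linear, so for
  \<^term>\<open>S \<in> bounded_ops\<close> invertibility here is invertibility in $B(X)$.\<close>

definition is_op_inverse :: "'x::real_normed_vector \<Rightarrow>\<^sub>L 'x \<Rightarrow> 'x \<Rightarrow>\<^sub>L 'x \<Rightarrow> bool"
  where "is_op_inverse S U \<longleftrightarrow> S o\<^sub>L U = id_blinfun \<and> U o\<^sub>L S = id_blinfun"

definition spectrum :: "'x::complex_normed_vector \<Rightarrow>\<^sub>L 'x \<Rightarrow> complex set"
  where "spectrum S = {\<mu>. \<nexists>U. is_op_inverse (\<mu> *\<^sub>C id_blinfun - S) U}"

definition resolvent :: "complex \<Rightarrow> 'x::complex_normed_vector \<Rightarrow>\<^sub>L 'x \<Rightarrow> 'x \<Rightarrow>\<^sub>L 'x"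
  where "resolvent \<mu> S = (THE U. is_op_inverse (\<mu> *\<^sub>C id_blinfun - S) U)"


section \<open>Ritt and R-Ritt operators\<close>

definition Ritt :: "'x::complex_normed_vector \<Rightarrow>\<^sub>L 'x \<Rightarrow> bool"
  where "Ritt S \<longleftrightarrow> S \<in> bounded_ops \<and>
    (\<exists>C>0. \<forall>n\<ge>1. norm (op_power S n) \<le> C \<and>
                  norm (real n *\<^sub>R (op_power S n - op_power S (n - 1))) \<le> C)"

definition stolz :: "real \<Rightarrow> complex set"
  where "stolz a = interior (convex hull (insert 1 (ball 0 (sin a))))"

definition Ritt_of_type :: "real \<Rightarrow> 'x::complex_normed_vector \<Rightarrow>\<^sub>L 'x \<Rightarrow> bool"
  where "Ritt_of_type a S \<longleftrightarrow> Ritt S \<and> 0 < a \<and> a < pi / 2 \<and>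
    spectrum S \<subseteq> closure (stolz a) \<and>
    (\<forall>b. a < b \<and> b < pi / 2 \<longrightarrow>
      (\<exists>K>0. \<forall>\<mu>. \<mu> \<notin> closure (stolz b) \<longrightarrow> norm ((\<mu> - 1) *\<^sub>C resolvent \<mu> S) \<le> K))"

definition Rademacher_sequence :: "'w measure \<Rightarrow> (nat \<Rightarrow> 'w \<Rightarrow> real) \<Rightarrow> bool"
  where "Rademacher_sequence \<Omega> r \<longleftrightarrow> prob_space \<Omega> \<and>
    prob_space.indep_vars \<Omega> (\<lambda>_. borel) r {1..} \<and>
    (\<forall>k\<ge>1. measure \<Omega> {\<omega> \<in> space \<Omega>. r k \<omega> = 1} = 1 / 2 \<and>
            measure \<Omega> {\<omega> \<in> space \<Omega>. r k \<omega> = -1} = 1 / 2)"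

text \<open>The norm of $\sum_{k=1}^n r_k \otimes x_k$ in $L_2(\Omega; X)$.\<close>

definition Rademacher_norm ::
    "'w measure \<Rightarrow> (nat \<Rightarrow> 'w \<Rightarrow> real) \<Rightarrow> nat \<Rightarrow> (nat \<Rightarrow> 'x::real_normed_vector) \<Rightarrow> real"
  where "Rademacher_norm \<Omega> r n x = sqrt (LINT \<omega>|\<Omega>. (norm (\<Sum>k=1..n. r k \<omega> *\<^sub>R x k))\<^sup>2)"

definition R_bounded ::
    "'w measure \<Rightarrow> (nat \<Rightarrow> 'w \<Rightarrow> real) \<Rightarrow> ('x::real_normed_vector \<Rightarrow>\<^sub>L 'x) set \<Rightarrow> bool"
  where "R_bounded \<Omega> r E \<longleftrightarrow>
    (\<exists>C\<ge>0. \<forall>n\<ge>1. \<forall>S x. (\<forall>k\<in>{1..n}. S k \<in> E) \<longrightarrow>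
      Rademacher_norm \<Omega> r n (\<lambda>k. blinfun_apply (S k) (x k)) \<le> C * Rademacher_norm \<Omega> r n x)"

definition R_Ritt ::
    "'w measure \<Rightarrow> (nat \<Rightarrow> 'w \<Rightarrow> real) \<Rightarrow> 'x::complex_normed_vector \<Rightarrow>\<^sub>L 'x \<Rightarrow> bool"
  where "R_Ritt \<Omega> r S \<longleftrightarrow> Ritt S \<and>
    R_bounded \<Omega> r {op_power S n |n. True} \<and>
    R_bounded \<Omega> r {real n *\<^sub>R (op_power S n - op_power S (n - 1)) |n. n \<ge> 1}"


section \<open>Polynomials in several variables\<close>

text \<open>The index set $\{1,\ldots,d\}$ is rendered by a finite type \<open>'n\<close>. A polynomial is a finitely
  supported family of coefficients indexed by exponents \<open>'n \<Rightarrow>\<^sub>0 nat\<close>.\<close>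

definition poly_eval :: "(('n::finite \<Rightarrow>\<^sub>0 nat) \<Rightarrow>\<^sub>0 complex) \<Rightarrow> complex ^ 'n \<Rightarrow> complex"
  where "poly_eval h z =
    (\<Sum>m\<in>Poly_Mapping.keys h.
      Poly_Mapping.lookup h m * (\<Prod>i\<in>UNIV. (z $ i) ^ Poly_Mapping.lookup m i))"

definition poly_op ::
    "(('n::finite \<Rightarrow>\<^sub>0 nat) \<Rightarrow>\<^sub>0 complex) \<Rightarrow> ('n \<Rightarrow> 'x::complex_normed_vector \<Rightarrow>\<^sub>L 'x) \<Rightarrow> 'x \<Rightarrow>\<^sub>L 'x"
  where "poly_op h T =
    (\<Sum>m\<in>Poly_Mapping.keys h.
      Poly_Mapping.lookup h m *\<^sub>C op_prod (\<lambda>i. op_power (T i) (Poly_Mapping.lookup m i)) UNIV)"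

definition polynomially_bounded ::
    "('n::finite \<Rightarrow> 'x::complex_normed_vector \<Rightarrow>\<^sub>L 'x) \<Rightarrow> bool"
  where "polynomially_bounded T \<longleftrightarrow>
    (\<exists>C\<ge>1. \<forall>h. norm (poly_op h T) \<le> C * (SUP z\<in>{z. \<forall>i. cmod (z $ i) = 1}. cmod (poly_eval h z)))"


section \<open>Joint functional calculus\<close>

definition stolz_prod :: "('n::finite \<Rightarrow> real) \<Rightarrow> (complex ^ 'n) set"
  where "stolz_prod \<gamma> = {z. \<forall>i. z $ i \<in> stolz (\<gamma> i)}"

text \<open>Holomorphy on an open subset of $\mathbb{C}^d$: Frechet differentiability with a complex-linear
  derivative.\<close>

definition holomorphic_several :: "(complex ^ 'n::finite \<Rightarrow> complex) \<Rightarrow> (complex ^ 'n) set \<Rightarrow> bool"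
  where "holomorphic_several f U \<longleftrightarrow>
    (\<forall>z\<in>U. \<exists>D. (f has_derivative D) (at z) \<and> (\<forall>c v. D (c *s v) = c * D v))"

text \<open>For \<open>\<Lambda> = {}\<close> the dependence condition leaves exactly the functions that are constant on the
  domain. The values of \<open>f\<close> outside the domain are unconstrained and never relevant.\<close>

definition H0_inf :: "('n::finite \<Rightarrow> real) \<Rightarrow> 'n set \<Rightarrow> (complex ^ 'n \<Rightarrow> complex) set"
  where "H0_inf \<gamma> \<Lambda> = {f.
    holomorphic_several f (stolz_prod \<gamma>) \<and>
    bounded (f ` stolz_prod \<gamma>) \<and>
    (\<forall>z\<in>stolz_prod \<gamma>. \<forall>w\<in>stolz_prod \<gamma>. (\<forall>i\<in>\<Lambda>. z $ i = w $ i) \<longrightarrow> f z = f w) \<and>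
    (\<exists>c>0. \<exists>s. (\<forall>i\<in>\<Lambda>. 0 < s i) \<and>
      (\<forall>z\<in>stolz_prod \<gamma>. cmod (f z) \<le> c * (\<Prod>i\<in>\<Lambda>. cmod (1 - z $ i) powr s i)))}"

text \<open>The boundary of \<^term>\<open>stolz b\<close>, run counterclockwise from \<open>1\<close>: the tangents from \<open>1\<close> to the
  circle of radius \<open>sin b\<close> around \<open>0\<close> touch it at the arguments \<open>\<plusminus>(pi / 2 - b)\<close>.\<close>

definition stolz_path :: "real \<Rightarrow> real \<Rightarrow> complex"
  where "stolz_path b =
    linepath 1 (of_real (sin b) * cis (pi / 2 - b)) +++
    part_circlepath 0 (sin b) (pi / 2 - b) (3 * pi / 2 + b) +++
    linepath (of_real (sin b) * cis (3 * pi / 2 + b)) 1"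

text \<open>The integral over $\prod_{i\in\Lambda}\partial B_{b_i}$ is pulled back along \<open>stolz_path\<close> to a
  cube. The cube has one coordinate for every element of \<open>'n\<close>; the integrand does not depend on the
  coordinates outside \<open>\<Lambda>\<close>, each of which contributes a factor \<open>1\<close>. There \<open>f\<close>, which does not
  depend on these variables, is evaluated at \<open>0\<close>, a point of every Stolz domain. The integrand is
  singular on the null set where some $\lambda_i = 1$, on which its value is immaterial.\<close>

definition H0_op ::
    "('n::finite \<Rightarrow> real) \<Rightarrow> ('n \<Rightarrow> 'x::complex_banach \<Rightarrow>\<^sub>L 'x) \<Rightarrow> 'n set \<Rightarrow>
     (complex ^ 'n \<Rightarrow> complex) \<Rightarrow> 'x \<Rightarrow>\<^sub>L 'x"
  where "H0_op b T \<Lambda> f =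
    (if \<Lambda> = {} then f 0 *\<^sub>C id_blinfun
     else (1 / (2 * of_real pi * \<i>)) ^ card \<Lambda> *\<^sub>C
       integral {t :: real ^ 'n. \<forall>i. t $ i \<in> {0..1}} (\<lambda>t.
         (f (\<chi> i. if i \<in> \<Lambda> then stolz_path (b i) (t $ i) else 0) *
          (\<Prod>i\<in>\<Lambda>. vector_derivative (stolz_path (b i)) (at (t $ i) within {0..1}))) *\<^sub>C
         op_prod (\<lambda>i. resolvent (stolz_path (b i) (t $ i)) (T i)) \<Lambda>))"

text \<open>An element of the direct sum $H_{0,1}^\infty$ is given by its family of components
  $(f_\Lambda)_\Lambda$; as a function it is their sum, and the functional calculus is extended
  linearly.\<close>

definition H01_inf :: "('n::finite \<Rightarrow> real) \<Rightarrow> ('n set \<Rightarrow> complex ^ 'n \<Rightarrow> complex) set"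
  where "H01_inf \<gamma> = {F. \<forall>\<Lambda>. F \<Lambda> \<in> H0_inf \<gamma> \<Lambda>}"

definition H01_fun :: "('n::finite set \<Rightarrow> complex ^ 'n \<Rightarrow> complex) \<Rightarrow> complex ^ 'n \<Rightarrow> complex"
  where "H01_fun F z = (\<Sum>\<Lambda>\<in>UNIV. F \<Lambda> z)"

definition H01_op ::
    "('n::finite \<Rightarrow> real) \<Rightarrow> ('n \<Rightarrow> 'x::complex_banach \<Rightarrow>\<^sub>L 'x) \<Rightarrow>
     ('n set \<Rightarrow> complex ^ 'n \<Rightarrow> complex) \<Rightarrow> 'x \<Rightarrow>\<^sub>L 'x"
  where "H01_op b T F = (\<Sum>\<Lambda>\<in>UNIV. H0_op b T \<Lambda> (F \<Lambda>))"

text \<open>The operator \<open>H01_op b T F\<close> does not depend on the admissible choice of the contours \<open>b\<close>;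
  the estimate is required for all of them.\<close>

definition joint_Hinf_calculus ::
    "('n::finite \<Rightarrow> real) \<Rightarrow> ('n \<Rightarrow> 'x::complex_banach \<Rightarrow>\<^sub>L 'x) \<Rightarrow> bool"
  where "joint_Hinf_calculus \<gamma> T \<longleftrightarrow>
    (\<exists>a. (\<forall>k. a k < \<gamma> k \<and> Ritt_of_type (a k) (T k)) \<and>
      (\<exists>K>0. \<forall>b. (\<forall>k. a k < b k \<and> b k < \<gamma> k) \<longrightarrow>
        (\<forall>F\<in>H01_inf \<gamma>.
          norm (H01_op b T F) \<le> K * (SUP z\<in>stolz_prod \<gamma>. cmod (H01_fun F z)))))"

end

theory Submission
  imports Defs "HOL-Real_Asymp.Real_Asymp"
begin

text \<open>Polynomial boundedness controls the functions that are uniform limits of polynomials on the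
  closed polydisc, but a function on a product of Stolz domains lives on a smaller set, so it
  cannot be approximated this way with control of the norms. The extra information is the
  R-boundedness of the resolvents, and the proof combines the two in the style of Kalton and Weis:
  a Cauchy integral is cut into dyadic pieces, and the pieces are recombined with random signs.

  For a point \<open>l\<close> of the contour put \<open>\<mu> = 1 - l\<close> and \<open>\<sigma> = 1 - T\<close>. The operator
  \<open>\<phi> = 4\<mu>\<sigma> / (\<sigma> + \<mu>)\<^sup>2\<close> is a limit of polynomials in \<open>T\<close>, because \<open>1 / (\<sigma> + \<mu>)\<close> is the resolvent at
  the reflected point \<open>2 - l\<close> outside the closed disc. It equals \<open>1\<close> to second order at the pole
  of the resolvent, so that \<open>R(l,T) = \<phi>\<^sup>2 R(l,T) + H\<close> with \<open>H\<close> holomorphic in \<open>l\<close> across the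
  contour (\<open>resolvent_decomposition\<close>). By Cauchy's theorem \<open>H\<close> contributes nothing to the integral
  of an \<open>f\<close> that decays at \<open>1\<close> (\<open>cauchy_stolz\<close>, \<open>G_insertion\<close>), and \<open>R(l,T)\<close> may be replaced by
  \<open>\<phi> R(l,T) \<phi>\<close> in every variable.

  The contour is cut into pieces on which \<open>\<bar>1 - l\<bar>\<close> is comparable to a power of \<open>1/2\<close>, all of them
  parametrized by the same interval. For fixed parameters the integral becomes a sum over
  multi-indices of terms \<open>a \<Phi> S \<Phi>\<close>, where \<open>a\<close> is bounded by \<open>sup \<bar>f\<bar>\<close>, \<open>S\<close> is a product of
  operators \<open>(l - 1)R(l,T)\<close>, and \<open>\<Phi>\<close> is a product of operators \<open>\<phi>\<close>. Averaging over signs reduces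
  its norm to three facts (\<open>norm_sum_randomized\<close>, \<open>discrete_estimate\<close>): the \<open>S\<close> lie in an
  R-bounded set, and all signed sums of the \<open>a \<Phi>\<close> and of the \<open>\<Phi>\<close> are bounded. The last two follow
  from polynomial boundedness, since the sum of \<open>\<bar>\<phi>\<bar>\<close> over the pieces is bounded on the torus, by
  a telescoping estimate (\<open>dyadic_sum_le\<close>, \<open>sum_\<phi>s_le\<close>).

  That \<open>(l - 1)R(l,T)\<close> ranges over an R-bounded set, also for \<open>l\<close> slightly inside the disc,
  follows from the R-Ritt condition (\<open>rad_bounded_resolvent_region\<close>). The angles \<open>\<gamma>\<close> are chosen so
  close to \<open>\<pi>/2\<close> that all contours lie in that region. Finally, a sum of functions \<open>f\<^sub>\<Lambda>\<close> that
  depend on different sets of variables and decay at \<open>1\<close> controls each of them: letting variables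
  tend to \<open>1\<close> removes the components that contain them (\<open>H01_component_bound\<close>).\<close>

section \<open>Operators on complex Banach spaces\<close>

lemma scaleC_one [simp]: "1 *\<^sub>C x = (x::'a::complex_normed_vector)"
  by (metis of_real_1 scaleC_of_real scaleR_one)

lemma bounded_bilinear_scaleC:
  "bounded_bilinear (scaleC :: complex \<Rightarrow> 'a::complex_normed_vector \<Rightarrow> 'a)"
proof
  fix a a' :: complex and b b' :: 'a and r :: real
  show "(a + a') *\<^sub>C b = a *\<^sub>C b + a' *\<^sub>C b" by (rule scaleC_add_left)
  show "a *\<^sub>C (b + b') = a *\<^sub>C b + a *\<^sub>C b'" by (rule scaleC_add_right)
  show "(r *\<^sub>R a) *\<^sub>C b = r *\<^sub>R a *\<^sub>C b"
    by (simp add: scaleC_of_real [symmetric] scaleC_scaleC scaleR_conv_of_real)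
  show "a *\<^sub>C r *\<^sub>R b = r *\<^sub>R a *\<^sub>C b"
    by (simp add: scaleC_of_real [symmetric] scaleC_scaleC mult.commute)
  show "\<exists>K. \<forall>a (b::'a). norm (a *\<^sub>C b) \<le> norm a * norm b * K"
    by (rule exI [of _ 1]) (simp add: norm_scaleC)
qed

interpretation scaleC: bounded_bilinear "scaleC :: complex \<Rightarrow> 'a::complex_normed_vector \<Rightarrow> 'a"
  by (rule bounded_bilinear_scaleC)

interpretation opcomp: bounded_bilinear "blinfun_compose :: 'b::real_normed_vector \<Rightarrow>\<^sub>L 'c::real_normed_vector \<Rightarrow> 'a::real_normed_vector \<Rightarrow>\<^sub>L 'b \<Rightarrow> 'a \<Rightarrow>\<^sub>L 'c"
  by (rule bounded_bilinear_blinfun_compose)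

lemma opcomp_assoc: "(A o\<^sub>L B) o\<^sub>L C = A o\<^sub>L (B o\<^sub>L C)"
  by (rule blinfun_eqI) simp

lemma opcomp_id [simp]: "id_blinfun o\<^sub>L A = A" "A o\<^sub>L id_blinfun = A"
  by (rule blinfun_eqI, simp)+

lemma scaleC_opcomp: "(c *\<^sub>C A) o\<^sub>L B = c *\<^sub>C (A o\<^sub>L B)"
  by (rule blinfun_eqI) (simp add: blinfun_apply_scaleC)

lemma opcomp_scaleC: "A \<in> bounded_ops \<Longrightarrow> A o\<^sub>L (c *\<^sub>C B) = c *\<^sub>C (A o\<^sub>L B)"
  by (rule blinfun_eqI) (simp add: blinfun_apply_scaleC bounded_ops_def)

lemma norm_opcomp_le: "norm A \<le> a \<Longrightarrow> norm B \<le> b \<Longrightarrow> norm (A o\<^sub>L B) \<le> a * b"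
  by (rule order_trans [OF norm_blinfun_compose]) (auto intro!: mult_mono order_trans [OF norm_ge_zero])

lemma op_power_0 [simp]: "op_power S 0 = id_blinfun"
  by (simp add: op_power_def)

lemma op_power_Suc: "op_power S (Suc n) = S o\<^sub>L op_power S n"
  by (simp add: op_power_def)

lemma op_power_1 [simp]: "op_power S (Suc 0) = S"
  by (simp add: op_power_Suc)

lemma op_power_add: "op_power S (m + n) = op_power S m o\<^sub>L op_power S n"
  by (induction m) (simp_all add: op_power_Suc opcomp_assoc)

lemma op_power_Suc': "op_power S (Suc n) = op_power S n o\<^sub>L S"
  using op_power_add [of S n 1] by (simp add: op_power_Suc)

section \<open>The bicommutant of a commuting family\<close>

lemma bounded_ops_id [simp, intro]: "id_blinfun \<in> bounded_ops"
  by (simp add: bounded_ops_def)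

lemma bounded_ops_comp: "A \<in> bounded_ops \<Longrightarrow> B \<in> bounded_ops \<Longrightarrow> A o\<^sub>L B \<in> bounded_ops"
  by (simp add: bounded_ops_def)

lemma bounded_ops_inverse:
  assumes "A \<in> bounded_ops" "is_op_inverse A U" shows "U \<in> bounded_ops"
proof -
  have 1: "A (U x) = x" "U (A x) = x" for x
    using assms(2) by (metis is_op_inverse_def blinfun_apply_blinfun_compose blinfun_apply_id_blinfun)+
  have "U (c *\<^sub>C x) = c *\<^sub>C U x" for c x
    using assms(1) 1 unfolding bounded_ops_def by (metis (mono_tags, lifting) mem_Collect_eq)
  then show ?thesis by (simp add: bounded_ops_def)
qed

lemma is_op_inverse_unique:
  assumes "is_op_inverse A U" "is_op_inverse A V" shows "U = V"
  using assms by (metis is_op_inverse_def opcomp_assoc opcomp_id)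

lemma resolvent_eqI: "is_op_inverse (\<mu> *\<^sub>C id_blinfun - S) U \<Longrightarrow> resolvent \<mu> S = U"
  unfolding resolvent_def by (blast intro: the_equality is_op_inverse_unique)

text \<open>A commutative algebra that contains the \<open>T\<^sub>k\<close> and is closed under inverses. All operators of
  the functional calculus lie in it, so that they commute and products over finite index sets make
  sense.\<close>

definition bicommutant :: "('n \<Rightarrow> 'x::complex_normed_vector \<Rightarrow>\<^sub>L 'x) \<Rightarrow> ('x \<Rightarrow>\<^sub>L 'x) set"
  where "bicommutant T = {A \<in> bounded_ops.
    \<forall>V\<in>bounded_ops. (\<forall>k. V o\<^sub>L T k = T k o\<^sub>L V) \<longrightarrow> A o\<^sub>L V = V o\<^sub>L A}"

lemma bicommutant_bounded_ops: "A \<in> bicommutant T \<Longrightarrow> A \<in> bounded_ops"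
  by (simp add: bicommutant_def)

lemma bicommutant_gen: "T k \<in> bounded_ops \<Longrightarrow> T k \<in> bicommutant T"
  by (simp add: bicommutant_def)

lemma bicommutant_id [simp, intro]: "id_blinfun \<in> bicommutant T"
  by (simp add: bicommutant_def)

lemma bicommutant_comp: "A \<in> bicommutant T \<Longrightarrow> B \<in> bicommutant T \<Longrightarrow> A o\<^sub>L B \<in> bicommutant T"
  unfolding bicommutant_def by (auto simp: bounded_ops_comp) (metis opcomp_assoc)

lemma bicommutant_add: "A \<in> bicommutant T \<Longrightarrow> B \<in> bicommutant T \<Longrightarrow> A + B \<in> bicommutant T"
  unfolding bicommutant_def bounded_ops_def
  by (auto simp: blinfun.add_left scaleC_add_right opcomp.add_left opcomp.add_right)

lemma bicommutant_scaleC: "A \<in> bicommutant T \<Longrightarrow> c *\<^sub>C A \<in> bicommutant T"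
  unfolding bicommutant_def
  by (auto simp: scaleC_opcomp opcomp_scaleC)
     (auto simp: bounded_ops_def blinfun_apply_scaleC scaleC_scaleC mult.commute)

lemma scaleC_minus_one: "(-1) *\<^sub>C A = - (A::'a::complex_normed_vector)"
  by (metis scaleC.minus_left scaleC_one)

lemma bicommutant_diff: "A \<in> bicommutant T \<Longrightarrow> B \<in> bicommutant T \<Longrightarrow> A - B \<in> bicommutant T"
  using bicommutant_add [of A T "(-1) *\<^sub>C B"] bicommutant_scaleC [of B T "-1"]
  by (simp add: scaleC_minus_one)

lemma bicommutant_scaleR: "A \<in> bicommutant T \<Longrightarrow> r *\<^sub>R A \<in> bicommutant T"
  by (metis bicommutant_scaleC scaleC_of_real)

lemma bicommutant_zero [simp, intro]: "0 \<in> bicommutant T"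
  using bicommutant_scaleR [OF bicommutant_id, of 0 T] by simp

lemma bicommutant_sum: "(\<And>i. i \<in> I \<Longrightarrow> A i \<in> bicommutant T) \<Longrightarrow> sum A I \<in> bicommutant T"
  by (induction I rule: infinite_finite_induct) (auto intro: bicommutant_add)

lemma bicommutant_power: "A \<in> bicommutant T \<Longrightarrow> op_power A n \<in> bicommutant T"
  by (induction n) (auto simp: op_power_Suc intro: bicommutant_comp)

lemma bicommutant_inverse:
  assumes "A \<in> bicommutant T" "is_op_inverse A U" shows "U \<in> bicommutant T"
proof -
  have "U o\<^sub>L V = V o\<^sub>L U" if "A o\<^sub>L V = V o\<^sub>L A" for V
    using that assms(2) unfolding is_op_inverse_def by (metis opcomp_assoc opcomp_id)
  then show ?thesis
    using assms bounded_ops_inverse [of A U] by (auto simp: bicommutant_def)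
qed

locale commuting_family =
  fixes T :: "'n::finite \<Rightarrow> 'x::complex_banach \<Rightarrow>\<^sub>L 'x"
  assumes T_ops: "T k \<in> bounded_ops"
    and T_commute: "T j o\<^sub>L T k = T k o\<^sub>L T j"
begin

abbreviation "\<A> \<equiv> bicommutant T"

lemma gen_A [simp, intro]: "T k \<in> \<A>"
  by (simp add: T_ops bicommutant_gen)

lemma commute_A: assumes "A \<in> \<A>" "B \<in> \<A>" shows "A o\<^sub>L B = B o\<^sub>L A"
proof -
  have "A o\<^sub>L T k = T k o\<^sub>L A" for k
    using assms(1) T_ops T_commute by (auto simp: bicommutant_def)
  then show ?thesis using assms by (simp add: bicommutant_def)
qed

lemmas A_intros = gen_A bicommutant_id bicommutant_zero bicommutant_comp bicommutant_add bicommutant_diff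
  bicommutant_scaleC bicommutant_scaleR bicommutant_sum bicommutant_power

lemma op_prod_empty [simp]: "op_prod S {} = id_blinfun"
  by (simp add: op_prod_def)

lemma op_prod_insert:
  assumes "\<And>i. i \<in> insert j \<Lambda> \<Longrightarrow> S i \<in> \<A>" and "j \<notin> (\<Lambda>::'n set)"
  shows "op_prod S (insert j \<Lambda>) = S j o\<^sub>L op_prod S \<Lambda>"
proof -
  interpret comp_fun_commute_on "insert j \<Lambda>" "\<lambda>i U. S i o\<^sub>L U"
    by standard (use assms(1) in \<open>auto simp: fun_eq_iff opcomp_assoc [symmetric] commute_A\<close>)
  show ?thesis
    unfolding op_prod_def using assms(2) by (subst fold_insert) auto
qed

lemma op_prod_A:
  fixes \<Lambda> :: "'n set"
  assumes "\<And>i. i \<in> \<Lambda> \<Longrightarrow> S i \<in> \<A>" shows "op_prod S \<Lambda> \<in> \<A>"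
  using finite [of \<Lambda>] assms
proof (induction \<Lambda> rule: finite_induct)
  case (insert j F)
  then show ?case by (subst op_prod_insert) (auto intro!: A_intros)
qed auto

lemma op_prod_cong:
  fixes \<Lambda> :: "'n set"
  assumes "\<And>i. i \<in> \<Lambda> \<Longrightarrow> S i \<in> \<A>" "\<And>i. i \<in> \<Lambda> \<Longrightarrow> S i = S' i"
  shows "op_prod S \<Lambda> = op_prod S' \<Lambda>"
  using finite [of \<Lambda>] assms
proof (induction \<Lambda> rule: finite_induct)
  case (insert j F)
  have "op_prod S (insert j F) = S j o\<^sub>L op_prod S F"
    by (rule op_prod_insert) (use insert in auto)
  moreover have "op_prod S' (insert j F) = S' j o\<^sub>L op_prod S' F"
  proof (rule op_prod_insert)
    show "S' i \<in> \<A>" if "i \<in> insert j F" for i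
      using insert.prems(1) [OF that] insert.prems(2) [OF that] by simp
  qed (use insert in simp)
  ultimately show ?case using insert by auto
qed auto

lemma op_prod_comp:
  fixes \<Lambda> :: "'n set"
  assumes "\<And>i. i \<in> \<Lambda> \<Longrightarrow> S i \<in> \<A>" "\<And>i. i \<in> \<Lambda> \<Longrightarrow> S' i \<in> \<A>"
  shows "op_prod (\<lambda>i. S i o\<^sub>L S' i) \<Lambda> = op_prod S \<Lambda> o\<^sub>L op_prod S' \<Lambda>"
  using finite [of \<Lambda>] assms
proof (induction \<Lambda> rule: finite_induct)
  case (insert j F)
  have "op_prod (\<lambda>i. S i o\<^sub>L S' i) (insert j F) = (S j o\<^sub>L S' j) o\<^sub>L (op_prod S F o\<^sub>L op_prod S' F)"
    using insert by (subst op_prod_insert) (auto intro!: A_intros)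
  also have "\<dots> = S j o\<^sub>L ((S' j o\<^sub>L op_prod S F) o\<^sub>L op_prod S' F)"
    by (simp add: opcomp_assoc)
  also have "S' j o\<^sub>L op_prod S F = op_prod S F o\<^sub>L S' j"
    using insert by (intro commute_A op_prod_A) auto
  also have "S j o\<^sub>L ((op_prod S F o\<^sub>L S' j) o\<^sub>L op_prod S' F) = (S j o\<^sub>L op_prod S F) o\<^sub>L (S' j o\<^sub>L op_prod S' F)"
    by (simp add: opcomp_assoc)
  also have "\<dots> = op_prod S (insert j F) o\<^sub>L op_prod S' (insert j F)"
    using insert by (subst (1 2) op_prod_insert) auto
  finally show ?case .
qed auto

lemma op_prod_scaleC:
  fixes \<Lambda> :: "'n set"
  assumes "\<And>i. i \<in> \<Lambda> \<Longrightarrow> S i \<in> \<A>"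
  shows "op_prod (\<lambda>i. c i *\<^sub>C S i) \<Lambda> = (\<Prod>i\<in>\<Lambda>. c i) *\<^sub>C op_prod S \<Lambda>"
  using finite [of \<Lambda>] assms
proof (induction \<Lambda> rule: finite_induct)
  case (insert j F)
  have "op_prod (\<lambda>i. c i *\<^sub>C S i) (insert j F) = (c j *\<^sub>C S j) o\<^sub>L op_prod (\<lambda>i. c i *\<^sub>C S i) F"
    by (rule op_prod_insert) (use insert in \<open>auto intro!: A_intros\<close>)
  also have "\<dots> = (c j *\<^sub>C S j) o\<^sub>L ((\<Prod>i\<in>F. c i) *\<^sub>C op_prod S F)"
    using insert by simp
  also have "\<dots> = (\<Prod>i\<in>insert j F. c i) *\<^sub>C (S j o\<^sub>L op_prod S F)"
    using insert by (simp add: scaleC_opcomp opcomp_scaleC bicommutant_bounded_ops [of _ T] scaleC_scaleC)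
  also have "S j o\<^sub>L op_prod S F = op_prod S (insert j F)"
    by (rule op_prod_insert [symmetric]) (use insert in auto)
  finally show ?case .
qed auto

lemma norm_op_prod_le:
  fixes \<Lambda> :: "'n set"
  assumes "\<And>i. i \<in> \<Lambda> \<Longrightarrow> S i \<in> \<A>" "\<And>i. i \<in> \<Lambda> \<Longrightarrow> norm (S i) \<le> c i"
  shows "norm (op_prod S \<Lambda>) \<le> (\<Prod>i\<in>\<Lambda>. c i)"
  using finite [of \<Lambda>] assms
proof (induction \<Lambda> rule: finite_induct)
  case empty
  then show ?case by (simp add: norm_blinfun_id_le)
next
  case (insert j F)
  have "norm (S j o\<^sub>L op_prod S F) \<le> c j * (\<Prod>i\<in>F. c i)"
    by (rule norm_opcomp_le) (use insert in auto)
  then show ?case using insert by (subst op_prod_insert) auto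
qed

end

section \<open>Neumann series\<close>

lemma geometric_inverse:
  fixes A :: "'x::complex_banach \<Rightarrow>\<^sub>L 'x"
  assumes "summable (\<lambda>n. norm (op_power A n))"
  shows "is_op_inverse (id_blinfun - A) (suminf (op_power A))"
proof -
  define s where "s n = (\<Sum>k<n. op_power A k)" for n
  have sm: "summable (op_power A)" using assms by (rule summable_norm_cancel)
  have s: "s \<longlonglongrightarrow> (suminf (op_power A))" unfolding s_def by (rule summable_LIMSEQ [OF sm])
  have z: "(\<lambda>n. id_blinfun - op_power A n) \<longlonglongrightarrow> id_blinfun - 0"
    by (intro tendsto_intros summable_LIMSEQ_zero [OF sm])
  have 1: "(id_blinfun - A) o\<^sub>L s n = id_blinfun - op_power A n" for n
  proof (induction n)
    case (Suc n)
    have "(id_blinfun - A) o\<^sub>L s (Suc n) = ((id_blinfun - A) o\<^sub>L s n) + ((id_blinfun - A) o\<^sub>L op_power A n)"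
      by (simp add: s_def opcomp.add_right)
    then show ?case unfolding Suc by (simp add: opcomp.diff_left op_power_Suc)
  qed (simp add: s_def)
  have 2: "s n o\<^sub>L (id_blinfun - A) = id_blinfun - op_power A n" for n
  proof (induction n)
    case (Suc n)
    have "s (Suc n) o\<^sub>L (id_blinfun - A) = (s n o\<^sub>L (id_blinfun - A)) + (op_power A n o\<^sub>L (id_blinfun - A))"
      by (simp add: s_def opcomp.add_left)
    then show ?case unfolding Suc by (simp add: opcomp.diff_right op_power_Suc')
  qed (simp add: s_def)
  have "(\<lambda>n. (id_blinfun - A) o\<^sub>L s n) \<longlonglongrightarrow> ((id_blinfun - A) o\<^sub>L suminf (op_power A))"
    by (intro opcomp.tendsto tendsto_const s)
  moreover have "(\<lambda>n. s n o\<^sub>L (id_blinfun - A)) \<longlonglongrightarrow> (suminf (op_power A) o\<^sub>L (id_blinfun - A))"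
    by (intro opcomp.tendsto tendsto_const s)
  ultimately show ?thesis
    using z LIMSEQ_unique unfolding is_op_inverse_def 1 2 by fastforce
qed

lemma norm_op_power_le: "norm (op_power A n) \<le> norm A ^ n"
  by (induction n) (auto simp: op_power_Suc norm_blinfun_id_le intro: norm_opcomp_le)

lemma neumann_inverse:
  fixes A :: "'x::complex_banach \<Rightarrow>\<^sub>L 'x"
  assumes "norm A < 1" shows "\<exists>U. is_op_inverse (id_blinfun - A) U"
proof -
  have "summable (\<lambda>n. norm (op_power A n))"
    by (rule summable_comparison_test' [of "\<lambda>n. norm A ^ n" 0])
       (use assms norm_op_power_le in auto)
  then show ?thesis using geometric_inverse by blast
qed

lemma op_power_scaleC:
  assumes "A \<in> bounded_ops" shows "op_power (c *\<^sub>C A) n = c ^ n *\<^sub>C op_power A n"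
  by (induction n) (auto simp: op_power_Suc scaleC_opcomp opcomp_scaleC assms scaleC_scaleC)

lemma is_op_inverse_scaleC:
  assumes "is_op_inverse A U" "c \<noteq> 0" "A \<in> bounded_ops"
  shows "is_op_inverse (c *\<^sub>C A) (inverse c *\<^sub>C U)"
  using assms bounded_ops_inverse [OF assms(3,1)]
  by (auto simp: is_op_inverse_def scaleC_opcomp opcomp_scaleC scaleC_scaleC)

text \<open>Outside the closed unit disc the resolvent of a power bounded operator is its Laurent
  series, so it is a norm limit of polynomials in the operator.\<close>

lemma power_bounded_resolvent:
  fixes A :: "'x::complex_banach \<Rightarrow>\<^sub>L 'x"
  assumes A: "A \<in> bounded_ops" and C: "\<And>n. norm (op_power A n) \<le> C" and \<kappa>: "cmod \<kappa> > 1"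
  shows "is_op_inverse (\<kappa> *\<^sub>C id_blinfun - A) (resolvent \<kappa> A)"
    and "norm (resolvent \<kappa> A) \<le> C / (cmod \<kappa> - 1)"
    and "(\<lambda>n. inverse (\<kappa> ^ Suc n) *\<^sub>C op_power A n) sums resolvent \<kappa> A"
proof -
  define B where "B = inverse \<kappa> *\<^sub>C A"
  have \<kappa>0: "\<kappa> \<noteq> 0" using \<kappa> by auto
  have Bn: "op_power B n = inverse \<kappa> ^ n *\<^sub>C op_power A n" for n
    unfolding B_def by (rule op_power_scaleC [OF A])
  have nB: "norm (op_power B n) \<le> C * inverse (cmod \<kappa>) ^ n" for n
    unfolding Bn norm_scaleC using mult_right_mono [OF C [of n], of "inverse (cmod \<kappa>) ^ n"]
    by (simp add: norm_power norm_inverse mult.commute)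
  have ik: "norm (inverse (cmod \<kappa>)) < 1" using \<kappa> by (simp add: inverse_less_1_iff)
  have smg: "summable (\<lambda>n. C * inverse (cmod \<kappa>) ^ n)"
    using ik by (intro summable_mult summable_geometric)
  have sm: "summable (\<lambda>n. norm (op_power B n))"
    by (rule summable_comparison_test' [OF smg]) (use nB in auto)
  have AB: "A = \<kappa> *\<^sub>C B" using \<kappa>0 by (simp add: B_def scaleC_scaleC)
  have Bops: "id_blinfun - B \<in> bounded_ops"
    using A by (auto simp: B_def bounded_ops_def blinfun.diff_left blinfun_apply_scaleC scaleC.diff_right
        scaleC_scaleC mult.commute)
  have "is_op_inverse (\<kappa> *\<^sub>C (id_blinfun - B)) (inverse \<kappa> *\<^sub>C (suminf (op_power B)))"
    by (intro is_op_inverse_scaleC geometric_inverse sm \<kappa>0 Bops)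
  then have inv: "is_op_inverse (\<kappa> *\<^sub>C id_blinfun - A) (inverse \<kappa> *\<^sub>C (suminf (op_power B)))"
    by (simp add: AB scaleC.diff_right)
  then have R: "resolvent \<kappa> A = inverse \<kappa> *\<^sub>C (suminf (op_power B))" by (rule resolvent_eqI)
  show "is_op_inverse (\<kappa> *\<^sub>C id_blinfun - A) (resolvent \<kappa> A)" using inv R by simp
  have "norm (suminf (op_power B)) \<le> suminf (\<lambda>n. C * inverse (cmod \<kappa>) ^ n)"
    using suminf_le [OF nB sm smg] summable_norm [OF sm] by linarith
  also have "\<dots> = C * (1 / (1 - inverse (cmod \<kappa>)))"
    using ik by (subst suminf_mult) (auto simp: suminf_geometric)
  finally have "norm (resolvent \<kappa> A) \<le> inverse (cmod \<kappa>) * (C * (1 / (1 - inverse (cmod \<kappa>))))"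
    unfolding R norm_scaleC norm_inverse by (intro mult_left_mono) auto
  also have "\<dots> = C / (cmod \<kappa> - 1)" using \<kappa> \<kappa>0 by (simp add: field_simps)
  finally show "norm (resolvent \<kappa> A) \<le> C / (cmod \<kappa> - 1)" .
  have "op_power B sums (suminf (op_power B))" using sm summable_norm_cancel by blast
  then have "(\<lambda>n. inverse \<kappa> *\<^sub>C op_power B n) sums resolvent \<kappa> A"
    unfolding R by (rule bounded_linear.sums [OF scaleC.bounded_linear_right])
  then show "(\<lambda>n. inverse (\<kappa> ^ Suc n) *\<^sub>C op_power A n) sums resolvent \<kappa> A"
    by (simp add: Bn scaleC_scaleC power_inverse [symmetric])
qed

section \<open>Averages over signs\<close>

text \<open>Sign patterns are extensional functions, so that there are finitely many of them.\<close>

definition signs :: "'i set \<Rightarrow> ('i \<Rightarrow> real) set"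
  where "signs J = PiE J (\<lambda>_. {-1, 1})"

text \<open>Up to the factor \<open>2\<close> to the power \<open>- card J / 2\<close> this is the Rademacher norm of the family.
  The factor is left out since it cancels in R-bounds, where the same \<open>J\<close> occurs on both sides.\<close>

definition rad :: "'i set \<Rightarrow> ('i \<Rightarrow> 'x::real_normed_vector) \<Rightarrow> real"
  where "rad J x = L2_set (\<lambda>\<epsilon>. norm (\<Sum>j\<in>J. \<epsilon> j *\<^sub>R x j)) (signs J)"

lemma finite_signs: "finite J \<Longrightarrow> finite (signs J)"
  unfolding signs_def by (intro finite_PiE) auto

lemma card_signs: "finite J \<Longrightarrow> card (signs J) = 2 ^ card J"
  unfolding signs_def by (simp add: card_PiE numeral_2_eq_2)

lemma abs_signs: "\<epsilon> \<in> signs J \<Longrightarrow> j \<in> J \<Longrightarrow> \<bar>\<epsilon> j\<bar> = 1"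
  unfolding signs_def by (force simp: PiE_def Pi_def)

lemma square_signs: "\<epsilon> \<in> signs J \<Longrightarrow> j \<in> J \<Longrightarrow> \<epsilon> j * \<epsilon> j = 1"
  unfolding signs_def by (force simp: PiE_def Pi_def)

lemma rad_nonneg [simp]: "0 \<le> rad J x"
  by (simp add: rad_def)

lemma rad_cong: "(\<And>j. j \<in> J \<Longrightarrow> x j = y j) \<Longrightarrow> rad J x = rad J y"
  unfolding rad_def by (intro L2_set_cong) (auto intro!: arg_cong [of _ _ norm] sum.cong)

lemma rad_add: "rad J (\<lambda>j. x j + y j) \<le> rad J x + rad J y"
proof -
  have "rad J (\<lambda>j. x j + y j)
      \<le> L2_set (\<lambda>\<epsilon>. norm (\<Sum>j\<in>J. \<epsilon> j *\<^sub>R x j) + norm (\<Sum>j\<in>J. \<epsilon> j *\<^sub>R y j)) (signs J)"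
    unfolding rad_def
    by (rule L2_set_mono) (auto simp: scaleR_add_right sum.distrib intro: norm_triangle_ineq)
  also have "\<dots> \<le> rad J x + rad J y"
    unfolding rad_def by (rule L2_set_triangle_ineq)
  finally show ?thesis .
qed

lemma rad_linear:
  assumes "\<And>y. norm (f y) = c * norm (y::'a::real_normed_vector)" "linear f" "c \<ge> 0"
  shows "rad J (\<lambda>j. f (x j)) = c * rad J x"
proof -
  have "(\<Sum>j\<in>J. \<epsilon> j *\<^sub>R f (x j)) = f (\<Sum>j\<in>J. \<epsilon> j *\<^sub>R x j)" for \<epsilon>
    using assms(2) by (simp add: linear_sum linear_scale)
  then show ?thesis
    unfolding rad_def by (simp add: assms(1) L2_set_right_distrib assms(3))
qed

lemma rad_scaleR: "rad J (\<lambda>j. c *\<^sub>R x j) = \<bar>c\<bar> * rad J x"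
  by (rule rad_linear) (auto simp: linear_iff scaleR_add_right)

lemma rad_scaleC:
  fixes x :: "_ \<Rightarrow> 'x::complex_normed_vector"
  shows "rad J (\<lambda>j. c *\<^sub>C x j) = cmod c * rad J x"
  by (rule rad_linear) (auto simp: linear_iff scaleC_add_right norm_scaleC scaleC.scaleR_right)

lemma rad_sign:
  assumes \<sigma>: "\<And>j. j \<in> J \<Longrightarrow> \<sigma> j \<in> {-1, 1}"
  shows "rad J (\<lambda>j. \<sigma> j *\<^sub>R x j) = rad J x"
proof -
  define h where "h \<epsilon> = (\<lambda>j\<in>J. \<epsilon> j * \<sigma> j)" for \<epsilon>
  have h: "h \<epsilon> \<in> signs J" if "\<epsilon> \<in> signs J" for \<epsilon>
    using that \<sigma> unfolding signs_def h_def by (fastforce simp: PiE_iff)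
  have hh: "h (h \<epsilon>) = \<epsilon>" if "\<epsilon> \<in> signs J" for \<epsilon>
  proof
    fix j show "h (h \<epsilon>) j = \<epsilon> j"
      using that \<sigma> [of j] unfolding signs_def h_def by (cases "j \<in> J") (auto simp: PiE_iff extensional_def)
  qed
  have "(\<Sum>\<epsilon>\<in>signs J. (norm (\<Sum>j\<in>J. \<epsilon> j *\<^sub>R \<sigma> j *\<^sub>R x j))\<^sup>2)
      = (\<Sum>\<epsilon>\<in>signs J. (norm (\<Sum>j\<in>J. \<epsilon> j *\<^sub>R x j))\<^sup>2)"
    by (rule sum.reindex_bij_witness [of _ h h])
       (simp_all add: h hh, simp add: h_def)
  then show ?thesis unfolding rad_def L2_set_def by simp
qed

text \<open>The scalar \<open>a\<close> is a convex combination of \<open>1\<close> and \<open>- 1\<close>, and changing the sign of one vector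
  permutes the sign patterns.\<close>

lemma rad_contraction_one:
  assumes a: "\<bar>a\<bar> \<le> 1"
  shows "rad J (\<lambda>j. if j = k then a *\<^sub>R x j else x j) \<le> rad J x"
proof -
  let ?u = "(1 + a) / 2" and ?v = "(1 - a) / 2"
  have "rad J (\<lambda>j. if j = k then a *\<^sub>R x j else x j)
      = rad J (\<lambda>j. ?u *\<^sub>R x j + ?v *\<^sub>R ((if j = k then -1 else 1) *\<^sub>R x j))"
    by (rule rad_cong) (auto simp: scaleR_left_diff_distrib [symmetric] scaleR_add_left [symmetric] field_simps)
  also have "\<dots> \<le> \<bar>?u\<bar> * rad J x + \<bar>?v\<bar> * rad J (\<lambda>j. (if j = k then -1 else 1) *\<^sub>R x j)"
    by (rule order_trans [OF rad_add]) (simp only: rad_scaleR order_refl)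
  also have "rad J (\<lambda>j. (if j = k then -1 else 1) *\<^sub>R x j) = rad J x"
    by (rule rad_sign) auto
  also have "\<bar>?u\<bar> * rad J x + \<bar>?v\<bar> * rad J x = rad J x"
    using a by (simp add: field_simps)
  finally show ?thesis .
qed

lemma rad_contraction:
  assumes J: "finite J" and a: "\<And>j. j \<in> J \<Longrightarrow> \<bar>a j\<bar> \<le> 1"
  shows "rad J (\<lambda>j. a j *\<^sub>R x j) \<le> rad J x"
proof -
  have "rad J (\<lambda>j. if j \<in> K then a j *\<^sub>R x j else x j) \<le> rad J x" if "finite K" "K \<subseteq> J" for K
    using that
  proof (induction K rule: finite_induct)
    case (insert k K)
    let ?y = "\<lambda>j. if j \<in> K then a j *\<^sub>R x j else x j"
    have "rad J (\<lambda>j. if j \<in> insert k K then a j *\<^sub>R x j else x j)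
        = rad J (\<lambda>j. if j = k then a k *\<^sub>R ?y j else ?y j)"
      using insert.hyps by (intro rad_cong) auto
    also have "\<dots> \<le> rad J ?y"
      using insert.prems a by (intro rad_contraction_one) auto
    also have "\<dots> \<le> rad J x" using insert by auto
    finally show ?case .
  qed auto
  from this [OF J order_refl] have "rad J (\<lambda>j. if j \<in> J then a j *\<^sub>R x j else x j) \<le> rad J x" .
  also have "rad J (\<lambda>j. if j \<in> J then a j *\<^sub>R x j else x j) = rad J (\<lambda>j. a j *\<^sub>R x j)"
    by (rule rad_cong) auto
  finally show ?thesis .
qed

lemma rad_reindex:
  assumes h: "bij_betw h I J"
  shows "rad J x = rad I (\<lambda>i. x (h i))"
proof -
  define g where "g = the_inv_into I h"
  have inj: "inj_on h I" and im: "h ` I = J" using h by (auto simp: bij_betw_def)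
  have gh: "g (h i) = i" if "i \<in> I" for i using that inj by (simp add: g_def the_inv_into_f_f)
  have hg: "h (g j) = j" "g j \<in> I" if "j \<in> J" for j
    using that inj im by (auto simp: g_def f_the_inv_into_f the_inv_into_into)
  have hJ: "h i \<in> J" if "i \<in> I" for i using that im by auto
  have s: "(\<Sum>j\<in>J. \<epsilon> j *\<^sub>R x j) = (\<Sum>i\<in>I. \<epsilon> (h i) *\<^sub>R x (h i))" for \<epsilon>
    using sum.reindex_bij_betw [OF h, of "\<lambda>j. \<epsilon> j *\<^sub>R x j"] by simp
  have "(\<Sum>\<epsilon>\<in>signs J. (norm (\<Sum>j\<in>J. \<epsilon> j *\<^sub>R x j))\<^sup>2)
      = (\<Sum>\<epsilon>\<in>signs I. (norm (\<Sum>i\<in>I. \<epsilon> i *\<^sub>R x (h i)))\<^sup>2)"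
  proof (rule sum.reindex_bij_witness [of _ "\<lambda>\<delta>. \<lambda>j\<in>J. \<delta> (g j)" "\<lambda>\<epsilon>. \<lambda>i\<in>I. \<epsilon> (h i)"])
    fix \<epsilon> assume e: "\<epsilon> \<in> signs J"
    show "(\<lambda>j\<in>J. (\<lambda>i\<in>I. \<epsilon> (h i)) (g j)) = \<epsilon>"
      using e hg by (auto simp: fun_eq_iff signs_def PiE_def extensional_def)
    show "(\<lambda>i\<in>I. \<epsilon> (h i)) \<in> signs I"
      using e hJ by (auto simp: signs_def PiE_iff)
    show "(norm (\<Sum>i\<in>I. (\<lambda>i\<in>I. \<epsilon> (h i)) i *\<^sub>R x (h i)))\<^sup>2 = (norm (\<Sum>j\<in>J. \<epsilon> j *\<^sub>R x j))\<^sup>2"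
      by (simp add: s)
  next
    fix \<delta> assume d: "\<delta> \<in> signs I"
    show "(\<lambda>i\<in>I. (\<lambda>j\<in>J. \<delta> (g j)) (h i)) = \<delta>"
      using d gh hJ by (auto simp: fun_eq_iff signs_def PiE_def extensional_def)
    show "(\<lambda>j\<in>J. \<delta> (g j)) \<in> signs J"
      using d hg by (auto simp: signs_def PiE_iff)
  qed
  then show ?thesis unfolding rad_def L2_set_def by simp
qed

lemma rad_singleton: "rad {k} x = sqrt 2 * norm (x k)"
proof -
  have "rad {k} x = L2_set (\<lambda>\<epsilon>. norm (x k)) (signs {k})"
    unfolding rad_def by (intro L2_set_cong) (auto simp: abs_signs)
  then show ?thesis by (simp add: L2_set_constant card_signs)
qed

section \<open>Rademacher norms are averages over signs\<close>

text \<open>By independence the vector of the first \<open>n\<close> Rademacher variables takes each of the \<open>2\<^sup>n\<close> sign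
  patterns with the same probability.\<close>

lemma Rademacher_norm_eq_rad:
  fixes x :: "nat \<Rightarrow> 'x::real_normed_vector"
  assumes r: "Rademacher_sequence \<Omega> r" and n: "n \<ge> 1"
  shows "Rademacher_norm \<Omega> r n x = rad {1..n} x / sqrt (2 ^ n)"
proof -
  interpret prob_space \<Omega> using r by (simp add: Rademacher_sequence_def)
  have ind: "indep_vars (\<lambda>_. borel) r {1..}"
    and half: "\<And>k. k \<ge> 1 \<Longrightarrow> prob {\<omega> \<in> space \<Omega>. r k \<omega> = 1} = 1 / 2"
              "\<And>k. k \<ge> 1 \<Longrightarrow> prob {\<omega> \<in> space \<Omega>. r k \<omega> = -1} = 1 / 2"
    using r by (auto simp: Rademacher_sequence_def)
  have meas: "r k \<in> borel_measurable \<Omega>" if "k \<ge> 1" for k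
    using ind that unfolding indep_vars_def by auto
  define J where "J = {1..n}"
  define q where "q \<epsilon> = (norm (\<Sum>k\<in>J. \<epsilon> k *\<^sub>R x k))\<^sup>2" for \<epsilon>
  \<comment> \<open>the event that the pattern \<open>\<epsilon>\<close> occurs\<close>
  define A where "A \<epsilon> = (\<Inter>k\<in>J. r k -` {\<epsilon> k} \<inter> space \<Omega>)" for \<epsilon>
  have A_ev: "A \<epsilon> \<in> events" for \<epsilon>
    unfolding A_def J_def using n meas
    by (intro sets.finite_INT) (auto intro!: measurable_sets)
  have one: "prob (r k -` {\<epsilon> k} \<inter> space \<Omega>) = 1 / 2" if "k \<in> J" "\<epsilon> \<in> signs J" for k \<epsilon>
  proof -
    have "r k -` {\<epsilon> k} \<inter> space \<Omega> = {\<omega> \<in> space \<Omega>. r k \<omega> = \<epsilon> k}" by auto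
    moreover have "\<epsilon> k = 1 \<or> \<epsilon> k = -1" "k \<ge> 1"
      using that by (auto simp: signs_def PiE_iff J_def)
    ultimately show ?thesis using half [of k] by auto
  qed
  have PA: "prob (A \<epsilon>) = 1 / 2 ^ n" if "\<epsilon> \<in> signs J" for \<epsilon>
  proof -
    have "prob (A \<epsilon>) = (\<Prod>k\<in>J. prob (r k -` {\<epsilon> k} \<inter> space \<Omega>))"
      unfolding A_def using n by (intro indep_varsD [OF ind]) (auto simp: J_def)
    also have "\<dots> = (\<Prod>k\<in>J. 1 / 2)" using one that by (intro prod.cong) auto
    finally show ?thesis by (simp add: J_def power_one_over)
  qed
  have AE1: "AE \<omega> in \<Omega>. r k \<omega> = 1 \<or> r k \<omega> = -1" if "k \<in> J" for k
  proof -
    have k: "k \<ge> 1" using that by (simp add: J_def)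
    have [measurable]: "r k \<in> borel_measurable \<Omega>" by (rule meas [OF k])
    have "prob ({\<omega> \<in> space \<Omega>. r k \<omega> = 1} \<union> {\<omega> \<in> space \<Omega>. r k \<omega> = -1}) = 1"
      by (subst finite_measure_Union) (auto simp: half [OF k])
    moreover have "{\<omega> \<in> space \<Omega>. r k \<omega> = 1} \<union> {\<omega> \<in> space \<Omega>. r k \<omega> = -1} \<in> events"
      by measurable
    ultimately have "AE \<omega> in \<Omega>. \<omega> \<in> {\<omega> \<in> space \<Omega>. r k \<omega> = 1} \<union> {\<omega> \<in> space \<Omega>. r k \<omega> = -1}"
      by (simp only: AE_prob_1)
    then show ?thesis by (rule AE_mp) (intro AE_I2, auto)
  qed
  have "AE \<omega> in \<Omega>. \<forall>k\<in>J. r k \<omega> = 1 \<or> r k \<omega> = -1"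
    by (subst AE_finite_all) (auto simp: AE1 J_def)
  then have AE2: "AE \<omega> in \<Omega>. q (\<lambda>k. r k \<omega>) = (\<Sum>\<epsilon>\<in>signs J. indicator (A \<epsilon>) \<omega> * q \<epsilon>)"
  proof (rule AE_mp, intro AE_I2 impI)
    fix \<omega> assume w: "\<omega> \<in> space \<Omega>" and *: "\<forall>k\<in>J. r k \<omega> = 1 \<or> r k \<omega> = -1"
    let ?d = "\<lambda>k\<in>J. r k \<omega>"
    have d: "?d \<in> signs J" using * by (auto simp: signs_def)
    have in_A: "\<omega> \<in> A \<epsilon> \<longleftrightarrow> \<epsilon> = ?d" if "\<epsilon> \<in> signs J" for \<epsilon>
      using that w by (auto simp: A_def signs_def PiE_iff fun_eq_iff extensional_def J_def n)
    have "(\<Sum>\<epsilon>\<in>signs J. indicator (A \<epsilon>) \<omega> * q \<epsilon>) = (\<Sum>\<epsilon>\<in>signs J. if \<epsilon> = ?d then q ?d else 0)"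
      by (intro sum.cong) (auto simp: indicator_def in_A)
    also have "\<dots> = q ?d" using d by (simp add: finite_signs J_def)
    also have "\<dots> = q (\<lambda>k. r k \<omega>)" by (simp add: q_def)
    finally show "q (\<lambda>k. r k \<omega>) = (\<Sum>\<epsilon>\<in>signs J. indicator (A \<epsilon>) \<omega> * q \<epsilon>)" ..
  qed
  have "continuous_on UNIV q"
    unfolding q_def
    by (intro continuous_intros continuous_on_product_coordinates)
  then have "q \<in> borel_measurable borel" by (rule borel_measurable_continuous_onI)
  moreover have "(\<lambda>\<omega> k. if k \<in> J then r k \<omega> else 0) \<in> borel_measurable \<Omega>"
  proof (rule measurable_coordinatewise_then_product)
    show "(\<lambda>\<omega>. if k \<in> J then r k \<omega> else 0) \<in> borel_measurable \<Omega>" for k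
      using meas [of k] by (cases "k \<in> J") (simp, simp add: J_def, simp)
  qed
  ultimately have "(\<lambda>\<omega>. q (\<lambda>k. if k \<in> J then r k \<omega> else 0)) \<in> borel_measurable \<Omega>"
    by (rule measurable_compose_rev)
  then have qm: "(\<lambda>\<omega>. q (\<lambda>k. r k \<omega>)) \<in> borel_measurable \<Omega>"
    by (simp add: q_def)
  have "(LINT \<omega>|\<Omega>. q (\<lambda>k. r k \<omega>)) = (LINT \<omega>|\<Omega>. (\<Sum>\<epsilon>\<in>signs J. indicator (A \<epsilon>) \<omega> * q \<epsilon>))"
    by (rule integral_cong_AE [OF qm _ AE2]) (use A_ev in measurable)
  also have "\<dots> = (\<Sum>\<epsilon>\<in>signs J. prob (A \<epsilon>) * q \<epsilon>)"
    using A_ev by (subst Bochner_Integration.integral_sum) (auto intro!: integrable_real_mult_indicator simp: mult.commute emeasure_eq_measure)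
  also have "\<dots> = (\<Sum>\<epsilon>\<in>signs J. q \<epsilon>) / 2 ^ n"
    by (simp add: PA sum_divide_distrib)
  finally show ?thesis
    by (simp add: Rademacher_norm_def rad_def L2_set_def q_def J_def real_sqrt_divide)
qed

section \<open>R-bounds\<close>

text \<open>R-boundedness with an explicit constant and freed from the probability space.\<close>

definition rad_bounded :: "real \<Rightarrow> ('x::real_normed_vector \<Rightarrow>\<^sub>L 'x) set \<Rightarrow> bool"
  where "rad_bounded C E \<longleftrightarrow> C \<ge> 0 \<and> (\<forall>(J::nat set) S x. finite J \<longrightarrow> (\<forall>j\<in>J. S j \<in> E) \<longrightarrow>
    rad J (\<lambda>j. blinfun_apply (S j) (x j)) \<le> C * rad J x)"

lemma rad_boundedI:
  assumes "C \<ge> 0" "\<And>(J::nat set) S x. finite J \<Longrightarrow> (\<And>j. j \<in> J \<Longrightarrow> S j \<in> E) \<Longrightarrow>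
    rad J (\<lambda>j. blinfun_apply (S j) (x j)) \<le> C * rad J x"
  shows "rad_bounded C E"
  using assms by (simp add: rad_bounded_def)

lemma rad_boundedD_nat:
  assumes "rad_bounded C E" "finite (J::nat set)" "\<And>j. j \<in> J \<Longrightarrow> S j \<in> E"
  shows "rad J (\<lambda>j. blinfun_apply (S j) (x j)) \<le> C * rad J x"
  using assms by (simp add: rad_bounded_def)

lemma rad_boundedD:
  fixes J :: "'i set"
  assumes "rad_bounded C E" "finite J" "\<And>j. j \<in> J \<Longrightarrow> S j \<in> E"
  shows "rad J (\<lambda>j. blinfun_apply (S j) (x j)) \<le> C * rad J x"
proof -
  obtain h where h: "bij_betw h {0..<card J} J"
    using ex_bij_betw_nat_finite [OF assms(2)] by blast
  have "\<And>i. i \<in> {0..<card J} \<Longrightarrow> S (h i) \<in> E"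
    using assms(3) bij_betwE [OF h] by blast
  from rad_boundedD_nat [OF assms(1) finite_atLeastLessThan this, where x = "\<lambda>i. x (h i)"]
  show ?thesis by (simp only: rad_reindex [OF h])
qed

lemma R_bounded_imp_rad_bounded:
  assumes r: "Rademacher_sequence \<Omega> r" and E: "R_bounded \<Omega> r E"
  shows "\<exists>C. rad_bounded C E"
proof -
  obtain C where C: "C \<ge> 0" and RC: "\<And>n S x. n \<ge> 1 \<Longrightarrow> (\<forall>k\<in>{1..n}. S k \<in> E) \<Longrightarrow>
      Rademacher_norm \<Omega> r n (\<lambda>k. blinfun_apply (S k) (x k)) \<le> C * Rademacher_norm \<Omega> r n x"
    using E unfolding R_bounded_def by blast
  have "rad J (\<lambda>j. blinfun_apply (S j) (x j)) \<le> C * rad J x"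
    if J: "finite J" and S: "\<And>j. j \<in> J \<Longrightarrow> S j \<in> E" for J :: "nat set" and S x
  proof (cases "J = {}")
    case True then show ?thesis by (simp add: rad_def L2_set_def)
  next
    case False
    define n where "n = card J"
    have n: "n \<ge> 1" using False J by (simp add: n_def Suc_leI card_gt_0_iff)
    obtain h where h: "bij_betw h {1..n} J"
      using ex_bij_betw_nat_finite_1 [OF J] by (auto simp: n_def)
    have "\<forall>k\<in>{1..n}. S (h k) \<in> E" using S h by (auto simp: bij_betw_def)
    from RC [OF n this, of "\<lambda>i. x (h i)"]
    have "rad {1..n} (\<lambda>k. blinfun_apply (S (h k)) (x (h k))) \<le> C * rad {1..n} (\<lambda>k. x (h k))"
      by (simp add: Rademacher_norm_eq_rad [OF r n] divide_le_cancel field_simps)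
    then show ?thesis by (simp only: rad_reindex [OF h])
  qed
  then have "rad_bounded C E" by (intro rad_boundedI C) blast
  then show ?thesis ..
qed

lemma rad_bounded_subset: "rad_bounded C E \<Longrightarrow> F \<subseteq> E \<Longrightarrow> rad_bounded C F"
  unfolding rad_bounded_def by blast

lemma rad_bounded_mono: "rad_bounded C E \<Longrightarrow> C \<le> D \<Longrightarrow> rad_bounded D E"
  unfolding rad_bounded_def by (meson mult_right_mono order_trans rad_nonneg)

lemma rad_bounded_norm_le:
  assumes "rad_bounded C E" "A \<in> E" shows "norm A \<le> C"
proof (rule norm_blinfun_bound)
  show "C \<ge> 0" using assms by (simp add: rad_bounded_def)
  show "norm (blinfun_apply A y) \<le> C * norm y" for y
    using rad_boundedD_nat [OF assms(1), of "{0}" "\<lambda>_. A" "\<lambda>_. y"] assms(2)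
    by (simp add: rad_singleton)
qed

lemma rad_bounded_id: "rad_bounded 1 {id_blinfun :: 'x::real_normed_vector \<Rightarrow>\<^sub>L 'x}"
proof (rule rad_boundedI)
  fix J :: "nat set" and S and x :: "nat \<Rightarrow> 'x"
  assume "\<And>j. j \<in> J \<Longrightarrow> S j \<in> {id_blinfun :: 'x \<Rightarrow>\<^sub>L 'x}"
  then have "rad J (\<lambda>j. blinfun_apply (S j) (x j)) = rad J x" by (intro rad_cong) simp
  then show "rad J (\<lambda>j. blinfun_apply (S j) (x j)) \<le> 1 * rad J x" by simp
qed simp

lemma rad_bounded_add:
  assumes "rad_bounded C E" "rad_bounded D F"
  shows "rad_bounded (C + D) {A + B |A B. A \<in> E \<and> B \<in> F}"
proof (rule rad_boundedI)
  show "C + D \<ge> 0" using assms by (simp add: rad_bounded_def)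
  fix J :: "nat set" and S x assume J: "finite J" and "\<And>j. j \<in> J \<Longrightarrow> S j \<in> {A + B |A B. A \<in> E \<and> B \<in> F}"
  then have "\<forall>j\<in>J. \<exists>A B. S j = A + B \<and> A \<in> E \<and> B \<in> F" by blast
  then obtain A B where AB: "\<And>j. j \<in> J \<Longrightarrow> S j = A j + B j \<and> A j \<in> E \<and> B j \<in> F" by metis
  have "rad J (\<lambda>j. blinfun_apply (S j) (x j)) = rad J (\<lambda>j. blinfun_apply (A j) (x j) + blinfun_apply (B j) (x j))"
    using AB by (intro rad_cong) (simp add: blinfun.add_left)
  also have "\<dots> \<le> C * rad J x + D * rad J x"
    using rad_boundedD_nat [OF assms(1) J, of A x] rad_boundedD_nat [OF assms(2) J, of B x] AB
      rad_add [of J "\<lambda>j. blinfun_apply (A j) (x j)" "\<lambda>j. blinfun_apply (B j) (x j)"] by force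
  finally show "rad J (\<lambda>j. blinfun_apply (S j) (x j)) \<le> (C + D) * rad J x" by (simp add: distrib_right)
qed

lemma rad_bounded_comp:
  assumes "rad_bounded C E" "rad_bounded D F"
  shows "rad_bounded (C * D) {A o\<^sub>L B |A B. A \<in> E \<and> B \<in> F}"
proof (rule rad_boundedI)
  have C: "C \<ge> 0" using assms by (simp add: rad_bounded_def)
  then show "C * D \<ge> 0" using assms by (simp add: rad_bounded_def)
  fix J :: "nat set" and S x assume J: "finite J" and "\<And>j. j \<in> J \<Longrightarrow> S j \<in> {A o\<^sub>L B |A B. A \<in> E \<and> B \<in> F}"
  then have "\<forall>j\<in>J. \<exists>A B. S j = A o\<^sub>L B \<and> A \<in> E \<and> B \<in> F" by blast
  then obtain A B where AB: "\<And>j. j \<in> J \<Longrightarrow> S j = (A j o\<^sub>L B j) \<and> A j \<in> E \<and> B j \<in> F" by metis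
  have "rad J (\<lambda>j. blinfun_apply (S j) (x j)) = rad J (\<lambda>j. blinfun_apply (A j) (blinfun_apply (B j) (x j)))"
    using AB by (intro rad_cong) simp
  also have "\<dots> \<le> C * rad J (\<lambda>j. blinfun_apply (B j) (x j))"
    using AB by (intro rad_boundedD_nat [OF assms(1) J]) auto
  also have "\<dots> \<le> C * (D * rad J x)"
    using AB by (intro mult_left_mono C rad_boundedD_nat [OF assms(2) J]) auto
  finally show "rad J (\<lambda>j. blinfun_apply (S j) (x j)) \<le> C * D * rad J x" by simp
qed

lemma rad_bounded_scaleC:
  assumes "rad_bounded C E"
  shows "rad_bounded (cmod c * C) ((\<lambda>A. c *\<^sub>C A) ` E)"
proof (rule rad_boundedI)
  show "cmod c * C \<ge> 0" using assms by (simp add: rad_bounded_def)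
  fix J :: "nat set" and S x assume J: "finite J" and "\<And>j. j \<in> J \<Longrightarrow> S j \<in> (\<lambda>A. c *\<^sub>C A) ` E"
  then have "\<forall>j\<in>J. \<exists>A. S j = c *\<^sub>C A \<and> A \<in> E" by blast
  then obtain A where A: "\<And>j. j \<in> J \<Longrightarrow> S j = c *\<^sub>C A j \<and> A j \<in> E" by metis
  have "rad J (\<lambda>j. blinfun_apply (S j) (x j)) = cmod c * rad J (\<lambda>j. blinfun_apply (A j) (x j))"
    unfolding rad_scaleC [symmetric] using A by (intro rad_cong) (simp add: blinfun_apply_scaleC)
  also have "\<dots> \<le> cmod c * (C * rad J x)"
    using A by (intro mult_left_mono rad_boundedD_nat [OF assms J]) auto
  finally show "rad J (\<lambda>j. blinfun_apply (S j) (x j)) \<le> cmod c * C * rad J x" by simp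
qed

lemma rad_bounded_contraction:
  assumes "rad_bounded C E"
  shows "rad_bounded C {a *\<^sub>R A |a A. \<bar>a\<bar> \<le> 1 \<and> A \<in> E}"
proof (rule rad_boundedI)
  show C: "C \<ge> 0" using assms by (simp add: rad_bounded_def)
  fix J :: "nat set" and S x assume J: "finite J" and "\<And>j. j \<in> J \<Longrightarrow> S j \<in> {a *\<^sub>R A |a A. \<bar>a\<bar> \<le> 1 \<and> A \<in> E}"
  then have "\<forall>j\<in>J. \<exists>a A. S j = a *\<^sub>R A \<and> \<bar>a\<bar> \<le> 1 \<and> A \<in> E" by blast
  then obtain a A where A: "\<And>j. j \<in> J \<Longrightarrow> S j = a j *\<^sub>R A j \<and> \<bar>a j\<bar> \<le> 1 \<and> A j \<in> E" by metis
  have "rad J (\<lambda>j. blinfun_apply (S j) (x j)) = rad J (\<lambda>j. a j *\<^sub>R blinfun_apply (A j) (x j))"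
    using A by (intro rad_cong) (simp add: blinfun.scaleR_left)
  also have "\<dots> \<le> rad J (\<lambda>j. blinfun_apply (A j) (x j))"
    using A by (intro rad_contraction J) auto
  also have "\<dots> \<le> C * rad J x"
    using A by (intro rad_boundedD_nat [OF assms J]) auto
  finally show "rad J (\<lambda>j. blinfun_apply (S j) (x j)) \<le> C * rad J x" .
qed

text \<open>One operator is moved from \<open>E\<close> into the convex hull at a time: with the others fixed, the
  operators for which the estimate holds form a convex set, by the triangle inequality.\<close>

lemma rad_bounded_convex_hull:
  assumes E: "rad_bounded C E"
  shows "rad_bounded C (convex hull E)"
proof (rule rad_boundedI)
  show C: "C \<ge> 0" using assms by (simp add: rad_bounded_def)
  fix J :: "nat set" and S x assume J: "finite J" and S: "\<And>j. j \<in> J \<Longrightarrow> S j \<in> convex hull E"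
  have "\<forall>S. (\<forall>j\<in>K. S j \<in> convex hull E) \<longrightarrow> (\<forall>j\<in>J-K. S j \<in> E) \<longrightarrow>
      rad J (\<lambda>j. blinfun_apply (S j) (x j)) \<le> C * rad J x" if "finite K" "K \<subseteq> J" for K
    using that
  proof (induction K rule: finite_induct)
    case empty
    then show ?case using rad_boundedD_nat [OF E J] by auto
  next
    case (insert k K)
    show ?case
    proof (intro allI impI)
      fix S assume S: "\<forall>j\<in>insert k K. S j \<in> convex hull E" "\<forall>j\<in>J - insert k K. S j \<in> E"
      define D where "D = {V. rad J (\<lambda>j. blinfun_apply ((S(k := V)) j) (x j)) \<le> C * rad J x}"
      have "E \<subseteq> D"
      proof
        fix V assume V: "V \<in> E"
        have "\<forall>j\<in>K. (S(k := V)) j \<in> convex hull E" "\<forall>j\<in>J - K. (S(k := V)) j \<in> E"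
          using S V insert.hyps by auto
        then show "V \<in> D" using insert.IH insert.prems by (auto simp: D_def)
      qed
      moreover have "convex D"
      proof (rule convexI)
        fix V W u v assume V: "V \<in> D" and W: "W \<in> D" and uv: "(0::real) \<le> u" "0 \<le> v" "u + v = 1"
        have "rad J (\<lambda>j. blinfun_apply ((S(k := u *\<^sub>R V + v *\<^sub>R W)) j) (x j))
          = rad J (\<lambda>j. u *\<^sub>R blinfun_apply ((S(k := V)) j) (x j) + v *\<^sub>R blinfun_apply ((S(k := W)) j) (x j))"
          using uv by (intro rad_cong)
            (auto simp: blinfun.add_left blinfun.scaleR_left scaleR_add_left [symmetric])
        also have "\<dots> \<le> u * rad J (\<lambda>j. blinfun_apply ((S(k := V)) j) (x j))
            + v * rad J (\<lambda>j. blinfun_apply ((S(k := W)) j) (x j))"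
          using uv by (intro order_trans [OF rad_add]) (simp only: rad_scaleR abs_of_nonneg order_refl)
        also have "\<dots> \<le> u * (C * rad J x) + v * (C * rad J x)"
          using V W uv by (intro add_mono mult_left_mono) (auto simp: D_def)
        also have "\<dots> = C * rad J x" using uv by (simp add: distrib_right [symmetric])
        finally show "u *\<^sub>R V + v *\<^sub>R W \<in> D" by (simp add: D_def)
      qed
      ultimately have "convex hull E \<subseteq> D" by (rule hull_minimal)
      moreover have "S k \<in> convex hull E" using S by auto
      ultimately have "S k \<in> D" by auto
      then show "rad J (\<lambda>j. blinfun_apply (S j) (x j)) \<le> C * rad J x"
        unfolding D_def by (simp only: mem_Collect_eq fun_upd_triv)
    qed
  qed
  from this [OF J order_refl] show "rad J (\<lambda>j. blinfun_apply (S j) (x j)) \<le> C * rad J x"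
    using S by auto
qed

text \<open>Real combinations whose coefficients have absolute sum at most \<open>1\<close> lie in the convex hull of
  the operators \<open>a A\<close> with \<open>\<bar>a\<bar> \<le> 1\<close>, which has the same R-bound by the contraction principle.
  Real and imaginary parts of complex coefficients are treated separately, whence the factor \<open>2\<close>.\<close>

lemma rad_bounded_complex_combinations:
  fixes E :: "('x::complex_normed_vector \<Rightarrow>\<^sub>L 'x) set"
  assumes E: "rad_bounded C E" and L: "L \<ge> 0"
  shows "rad_bounded (2 * L * C)
    {\<Sum>j\<in>J. c j *\<^sub>C S j |(J::nat set) c S. finite J \<and> (\<Sum>j\<in>J. cmod (c j)) \<le> L \<and> (\<forall>j\<in>J. S j \<in> E)}"
    (is "rad_bounded _ ?F")
proof -
  define B where "B = {a *\<^sub>R A |a A. \<bar>a\<bar> \<le> 1 \<and> A \<in> E}"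
  define D where "D = convex hull B"
  have D: "rad_bounded C D"
    unfolding D_def B_def by (intro rad_bounded_convex_hull rad_bounded_contraction E)
  have real_comb: "(\<Sum>j\<in>J. a j *\<^sub>R S j) \<in> D"
    if J: "finite J" "J \<noteq> {}" and a: "(\<Sum>j\<in>J. \<bar>a j\<bar>) \<le> 1" and S: "\<forall>j\<in>J. S j \<in> E"
    for J :: "nat set" and a :: "nat \<Rightarrow> real" and S
  proof -
    define s where "s = (\<Sum>j\<in>J. \<bar>a j\<bar>)"
    obtain k where "k \<in> J" using J by auto
    then have "0 *\<^sub>R S k \<in> B" using S unfolding B_def by (intro CollectI exI [of _ 0] exI [of _ "S k"]) auto
    then have "0 \<in> B" by simp
    then have 0: "0 \<in> D" unfolding D_def by (rule hull_inc)
    show ?thesis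
    proof (cases "s = 0")
      case True
      then have "\<forall>j\<in>J. a j = 0" using J by (simp add: s_def sum_nonneg_eq_0_iff)
      then show ?thesis using 0 by simp
    next
      case False
      then have s: "s > 0" unfolding s_def by (simp add: order_less_le sum_nonneg)
      have "(\<Sum>j\<in>J. (\<bar>a j\<bar> / s) *\<^sub>R (sgn (a j) *\<^sub>R S j)) \<in> D"
      proof (rule convex_sum [OF J(1)])
        show "convex D" by (simp add: D_def)
        show "(\<Sum>i\<in>J. \<bar>a i\<bar> / s) = 1" using s by (simp add: s_def sum_divide_distrib [symmetric])
        show "0 \<le> \<bar>a i\<bar> / s" for i using s by simp
        show "sgn (a i) *\<^sub>R S i \<in> D" if "i \<in> J" for i
        proof -
          have "\<bar>sgn (a i)\<bar> \<le> 1" by (simp add: sgn_real_def)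
          then have "sgn (a i) *\<^sub>R S i \<in> B" using S that unfolding B_def by blast
          then show ?thesis unfolding D_def by (rule hull_inc)
        qed
      qed
      then have "s *\<^sub>R (\<Sum>j\<in>J. (\<bar>a j\<bar> / s) *\<^sub>R (sgn (a j) *\<^sub>R S j)) + (1 - s) *\<^sub>R 0 \<in> D"
        using 0 a s by (intro convexD) (auto simp: D_def s_def)
      moreover have "s *\<^sub>R (\<Sum>j\<in>J. (\<bar>a j\<bar> / s) *\<^sub>R (sgn (a j) *\<^sub>R S j)) = (\<Sum>j\<in>J. a j *\<^sub>R S j)"
        using s by (simp add: scaleR_sum_right abs_mult_sgn)
      ultimately show ?thesis by simp
    qed
  qed
  have F1: "rad_bounded (C + cmod \<i> * C) {A + B |A B. A \<in> D \<and> B \<in> (\<lambda>A. \<i> *\<^sub>C A) ` D}"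
    by (intro rad_bounded_add rad_bounded_scaleC D)
  have "rad_bounded (cmod (of_real L) * (C + cmod \<i> * C))
      ((\<lambda>A. of_real L *\<^sub>C A) ` {A + B |A B. A \<in> D \<and> B \<in> (\<lambda>A. \<i> *\<^sub>C A) ` D})" (is "rad_bounded _ ?G")
    by (rule rad_bounded_scaleC [OF F1])
  then have G: "rad_bounded (2 * L * C) ?G" using L by (simp add: algebra_simps)
  have C: "C \<ge> 0" using E by (simp add: rad_bounded_def)
  have "rad_bounded (2 * L * C) (insert 0 ?G)"
  proof -
    have "insert 0 ?G \<subseteq> {a *\<^sub>R A |a A. \<bar>a\<bar> \<le> 1 \<and> A \<in> ?G}" if ne: "?G \<noteq> {}"
    proof -
      obtain A where A: "A \<in> ?G" using ne by (meson ex_in_conv)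
      have "0 \<in> {a *\<^sub>R A |a A. \<bar>a\<bar> \<le> 1 \<and> A \<in> ?G}"
        by (rule CollectI, rule exI [of _ 0], rule exI [of _ A]) (simp add: A)
      moreover have "V \<in> {a *\<^sub>R A |a A. \<bar>a\<bar> \<le> 1 \<and> A \<in> ?G}" if "V \<in> ?G" for V
        by (rule CollectI, rule exI [of _ 1], rule exI [of _ V]) (simp add: that)
      ultimately show ?thesis by (intro insert_subsetI subsetI)
    qed
    then have "rad_bounded (2 * L * C) (insert 0 ?G)" if "?G \<noteq> {}"
      using that rad_bounded_subset [OF rad_bounded_contraction [OF G]] by blast
    moreover have "rad_bounded (2 * L * C) (insert 0 ?G)" if "?G = {}"
      unfolding that using L C
      by (intro rad_boundedI) (auto simp: rad_def L2_set_def intro!: mult_nonneg_nonneg sum_nonneg)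
    ultimately show ?thesis by blast
  qed
  moreover have "?F \<subseteq> insert 0 ?G"
  proof (rule subsetI, elim CollectE exE conjE)
    fix V c S and J :: "nat set"
    assume V: "V = (\<Sum>j\<in>J. c j *\<^sub>C S j)" and J: "finite J"
      and c: "(\<Sum>j\<in>J. cmod (c j)) \<le> L" and S: "\<forall>j\<in>J. S j \<in> E"
    show "V \<in> insert 0 ?G"
    proof (cases "J = {} \<or> L = 0")
      case True
      then have "V = 0"
      proof
        assume "L = 0"
        then have "(\<Sum>j\<in>J. cmod (c j)) = 0" using c sum_nonneg [of J "\<lambda>j. cmod (c j)"] by simp
        then have "\<forall>j\<in>J. c j = 0" using J by (simp add: sum_nonneg_eq_0_iff)
        then show ?thesis by (simp add: V scaleC.zero_left)
      qed (simp add: V)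
      then show ?thesis by simp
    next
      case False
      then have L0: "L > 0" and J0: "J \<noteq> {}" using L by auto
      have re: "(\<Sum>j\<in>J. (Re (c j) / L) *\<^sub>R S j) \<in> D"
      proof (rule real_comb [OF J J0 _ S])
        have "(\<Sum>j\<in>J. \<bar>Re (c j)\<bar>) \<le> L"
          using c by (intro order_trans [OF sum_mono [OF abs_Re_le_cmod]])
        then show "(\<Sum>j\<in>J. \<bar>Re (c j) / L\<bar>) \<le> 1" using L0 by (simp add: sum_divide_distrib [symmetric])
      qed
      have im: "(\<Sum>j\<in>J. (Im (c j) / L) *\<^sub>R S j) \<in> D"
      proof (rule real_comb [OF J J0 _ S])
        have "(\<Sum>j\<in>J. \<bar>Im (c j)\<bar>) \<le> L"
          using c by (intro order_trans [OF sum_mono [OF abs_Im_le_cmod]])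
        then show "(\<Sum>j\<in>J. \<bar>Im (c j) / L\<bar>) \<le> 1" using L0 by (simp add: sum_divide_distrib [symmetric])
      qed
      have "V = of_real L *\<^sub>C ((\<Sum>j\<in>J. (Re (c j) / L) *\<^sub>R S j) + \<i> *\<^sub>C (\<Sum>j\<in>J. (Im (c j) / L) *\<^sub>R S j))"
        unfolding V scaleC.sum_right scaleC_add_right sum.distrib [symmetric]
      proof (rule sum.cong [OF refl])
        fix j
        have "c j = of_real (Re (c j)) + \<i> * of_real (Im (c j))" by (simp add: complex_eq mult.commute)
        then have "c j *\<^sub>C S j = of_real (Re (c j)) *\<^sub>C S j + (\<i> * of_real (Im (c j))) *\<^sub>C S j"
          by (metis scaleC_add_left)
        then show "c j *\<^sub>C S j = complex_of_real L *\<^sub>C (Re (c j) / L) *\<^sub>R S j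
            + complex_of_real L *\<^sub>C \<i> *\<^sub>C (Im (c j) / L) *\<^sub>R S j"
          using L0 by (simp add: scaleC_of_real [symmetric] scaleC_scaleC mult.commute)
      qed
      then show ?thesis using re im by blast
    qed
  qed
  ultimately show ?thesis by (rule rad_bounded_subset)
qed

text \<open>If \<open>y = x + A y\<close> with \<open>A\<close> of R-bound at most \<open>1/2\<close>, then the average of \<open>y\<close> is at most that
  of \<open>x\<close> plus half of itself.\<close>

lemma rad_bounded_inverse:
  assumes E: "rad_bounded (1/2) E"
  shows "rad_bounded 2 {U. \<exists>A\<in>E. is_op_inverse (id_blinfun - A) U}"
proof (rule rad_boundedI)
  fix J :: "nat set" and S x
  assume J: "finite J" and "\<And>j. j \<in> J \<Longrightarrow> S j \<in> {U. \<exists>A\<in>E. is_op_inverse (id_blinfun - A) U}"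
  then have "\<forall>j\<in>J. \<exists>A. A \<in> E \<and> is_op_inverse (id_blinfun - A) (S j)" by blast
  then obtain A where A: "\<And>j. j \<in> J \<Longrightarrow> A j \<in> E \<and> is_op_inverse (id_blinfun - A j) (S j)" by metis
  define y where "y j = blinfun_apply (S j) (x j)" for j
  have "y j = x j + blinfun_apply (A j) (y j)" if "j \<in> J" for j
  proof -
    have "blinfun_apply ((id_blinfun - A j) o\<^sub>L S j) (x j) = x j"
      using A [OF that] by (simp add: is_op_inverse_def)
    then show ?thesis by (simp add: y_def blinfun.diff_left algebra_simps)
  qed
  then have "rad J y = rad J (\<lambda>j. x j + blinfun_apply (A j) (y j))" by (intro rad_cong) auto
  also have "\<dots> \<le> rad J x + rad J (\<lambda>j. blinfun_apply (A j) (y j))" by (rule rad_add)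
  also have "rad J (\<lambda>j. blinfun_apply (A j) (y j)) \<le> 1 / 2 * rad J y"
    using A by (intro rad_boundedD_nat [OF E J]) auto
  finally show "rad J (\<lambda>j. blinfun_apply (S j) (x j)) \<le> 2 * rad J x" by (simp add: y_def [abs_def])
qed simp

section \<open>Randomization\<close>

lemma sum_signs_product:
  assumes J: "finite J" and jk: "j \<in> J" "k \<in> J"
  shows "(\<Sum>\<epsilon>\<in>signs J. \<epsilon> j * \<epsilon> k) = (if j = k then 2 ^ card J else 0)"
proof (cases "j = k")
  case True
  then have "(\<Sum>\<epsilon>\<in>signs J. \<epsilon> j * \<epsilon> k) = (\<Sum>\<epsilon>\<in>signs J. 1)"
    using jk by (intro sum.cong) (auto simp: square_signs)
  then show ?thesis using True by (simp add: card_signs J)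
next
  case False
  define h where "h \<epsilon> = (\<epsilon>(j := - \<epsilon> j :: real))" for \<epsilon> :: "'a \<Rightarrow> real"
  have "(\<Sum>\<epsilon>\<in>signs J. \<epsilon> j * \<epsilon> k) = (\<Sum>\<epsilon>\<in>signs J. - (\<epsilon> j * \<epsilon> k))"
    using False jk by (intro sum.reindex_bij_witness [of _ h h])
      (auto simp: h_def signs_def PiE_iff extensional_def)
  then show ?thesis using False by (simp add: sum_negf)
qed

text \<open>Since the average of \<open>\<epsilon>\<^sub>j \<epsilon>\<^sub>k\<close> over the signs is \<open>1\<close> for \<open>j = k\<close> and \<open>0\<close> otherwise, the sum is
  the average of the products of \<open>\<Sum> \<epsilon>\<^sub>j \<Psi>\<^sub>j\<close> and \<open>\<Sum> \<epsilon>\<^sub>k S\<^sub>k \<Phi>\<^sub>k\<close>. The first factor is bounded by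
  hypothesis; for the second, Cauchy-Schwarz and R-boundedness allow one to drop the \<open>S\<^sub>k\<close>.\<close>

lemma norm_sum_randomized:
  fixes J :: "'i set" and \<Phi> \<Psi> S :: "'i \<Rightarrow> 'x::real_normed_vector \<Rightarrow>\<^sub>L 'x"
  assumes J: "finite J" and E: "rad_bounded R E" and S: "\<And>j. j \<in> J \<Longrightarrow> S j \<in> E"
    and \<Phi>: "\<And>\<epsilon>. \<epsilon> \<in> signs J \<Longrightarrow> norm (\<Sum>j\<in>J. \<epsilon> j *\<^sub>R \<Phi> j) \<le> A"
    and \<Psi>: "\<And>\<epsilon>. \<epsilon> \<in> signs J \<Longrightarrow> norm (\<Sum>j\<in>J. \<epsilon> j *\<^sub>R \<Psi> j) \<le> B"
    and AB: "A \<ge> 0" "B \<ge> 0"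
  shows "norm (\<Sum>j\<in>J. \<Psi> j o\<^sub>L (S j o\<^sub>L \<Phi> j)) \<le> B * R * A"
proof (rule norm_blinfun_bound)
  have R: "R \<ge> 0" using E by (simp add: rad_bounded_def)
  then show "B * R * A \<ge> 0" using AB by simp
  fix x
  define y where "y j = blinfun_apply (S j) (blinfun_apply (\<Phi> j) x)" for j
  define N :: real where "N = 2 ^ card J"
  have N: "N > 0" by (simp add: N_def)
  have fs: "finite (signs J)" by (rule finite_signs [OF J])
  have "(\<Sum>\<epsilon>\<in>signs J. blinfun_apply (\<Sum>j\<in>J. \<epsilon> j *\<^sub>R \<Psi> j) (\<Sum>k\<in>J. \<epsilon> k *\<^sub>R y k))
      = (\<Sum>\<epsilon>\<in>signs J. \<Sum>j\<in>J. \<Sum>k\<in>J. (\<epsilon> j * \<epsilon> k) *\<^sub>R blinfun_apply (\<Psi> j) (y k))"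
    by (intro sum.cong refl, simp add: blinfun.sum_left blinfun.scaleR_left)
       (simp add: blinfun.sum_right blinfun.scaleR_right scaleR_sum_right)
  also have "\<dots> = (\<Sum>j\<in>J. \<Sum>k\<in>J. (\<Sum>\<epsilon>\<in>signs J. \<epsilon> j * \<epsilon> k) *\<^sub>R blinfun_apply (\<Psi> j) (y k))"
    by (subst sum.swap, rule sum.cong [OF refl], subst sum.swap) (simp add: scaleR_sum_left)
  also have "\<dots> = (\<Sum>j\<in>J. \<Sum>k\<in>J. if j = k then N *\<^sub>R blinfun_apply (\<Psi> j) (y j) else 0)"
    using J by (intro sum.cong) (auto simp: sum_signs_product N_def)
  also have "\<dots> = N *\<^sub>R (\<Sum>j\<in>J. blinfun_apply (\<Psi> j) (y j))"
    using J by (simp add: scaleR_sum_right)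
  finally have eq: "N *\<^sub>R (\<Sum>j\<in>J. blinfun_apply (\<Psi> j) (y j))
    = (\<Sum>\<epsilon>\<in>signs J. blinfun_apply (\<Sum>j\<in>J. \<epsilon> j *\<^sub>R \<Psi> j) (\<Sum>k\<in>J. \<epsilon> k *\<^sub>R y k))" ..
  have cs: "(\<Sum>\<epsilon>\<in>signs J. norm (\<Sum>k\<in>J. \<epsilon> k *\<^sub>R y k)) \<le> sqrt N * rad J y"
    using L2_set_mult_ineq [of "\<lambda>_. 1" "\<lambda>\<epsilon>. norm (\<Sum>k\<in>J. \<epsilon> k *\<^sub>R y k)" "signs J"]
    by (simp add: L2_set_constant card_signs J rad_def N_def)
  have "rad J y \<le> R * rad J (\<lambda>j. blinfun_apply (\<Phi> j) x)"
    unfolding y_def by (rule rad_boundedD [OF E J S])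
  also have "rad J (\<lambda>j. blinfun_apply (\<Phi> j) x) \<le> L2_set (\<lambda>_. A * norm x) (signs J)"
    unfolding rad_def
  proof (rule L2_set_mono)
    fix \<epsilon> assume e: "\<epsilon> \<in> signs J"
    have "(\<Sum>j\<in>J. \<epsilon> j *\<^sub>R blinfun_apply (\<Phi> j) x) = blinfun_apply (\<Sum>j\<in>J. \<epsilon> j *\<^sub>R \<Phi> j) x"
      by (simp add: blinfun.sum_left blinfun.scaleR_left)
    then show "norm (\<Sum>j\<in>J. \<epsilon> j *\<^sub>R blinfun_apply (\<Phi> j) x) \<le> A * norm x"
      using order_trans [OF norm_blinfun mult_right_mono [OF \<Phi> [OF e] norm_ge_zero]] by simp
  qed auto
  also have "L2_set (\<lambda>_. A * norm x) (signs J) = sqrt N * (A * norm x)"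
    using AB by (simp add: L2_set_constant card_signs J N_def)
  finally have y: "rad J y \<le> R * (sqrt N * (A * norm x))" using R by (simp add: mult_left_mono)
  have "N * norm (\<Sum>j\<in>J. blinfun_apply (\<Psi> j) (y j))
      = norm (\<Sum>\<epsilon>\<in>signs J. blinfun_apply (\<Sum>j\<in>J. \<epsilon> j *\<^sub>R \<Psi> j) (\<Sum>k\<in>J. \<epsilon> k *\<^sub>R y k))"
    unfolding eq [symmetric] using N by simp
  also have "\<dots> \<le> (\<Sum>\<epsilon>\<in>signs J. B * norm (\<Sum>k\<in>J. \<epsilon> k *\<^sub>R y k))"
    by (intro sum_norm_le order_trans [OF norm_blinfun] mult_right_mono \<Psi>) auto
  also have "\<dots> \<le> B * (sqrt N * rad J y)"
    unfolding sum_distrib_left [symmetric] using cs AB by (intro mult_left_mono) auto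
  also have "\<dots> \<le> B * (sqrt N * (R * (sqrt N * (A * norm x))))"
    using y AB N by (intro mult_left_mono) auto
  also have "\<dots> = N * (B * R * A * norm x)" using N by (simp add: mult_ac)
  finally have "norm (\<Sum>j\<in>J. blinfun_apply (\<Psi> j) (y j)) \<le> B * R * A * norm x" using N by simp
  then show "norm (blinfun_apply (\<Sum>j\<in>J. \<Psi> j o\<^sub>L (S j o\<^sub>L \<Phi> j)) x) \<le> B * R * A * norm x"
    by (simp add: blinfun.sum_left y_def)
qed

section \<open>Resolvents of R-Ritt operators\<close>

lemma truncated_resolvent:
  fixes A :: "'x::complex_normed_vector \<Rightarrow>\<^sub>L 'x"
  assumes A: "A \<in> bounded_ops" and \<mu>: "\<mu> \<noteq> 0"
  shows "(\<mu> *\<^sub>C id_blinfun - A) o\<^sub>L (\<Sum>j<N. inverse (\<mu> ^ Suc j) *\<^sub>C op_power A j)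
    = id_blinfun - inverse (\<mu> ^ N) *\<^sub>C op_power A N"
proof (induction N)
  case (Suc N)
  have "(\<mu> *\<^sub>C id_blinfun - A) o\<^sub>L (inverse (\<mu> ^ Suc N) *\<^sub>C op_power A N)
      = inverse (\<mu> ^ N) *\<^sub>C op_power A N - inverse (\<mu> ^ Suc N) *\<^sub>C op_power A (Suc N)"
    using \<mu> by (simp add: opcomp.diff_left scaleC_opcomp opcomp_scaleC A scaleC_scaleC op_power_Suc
        mult.assoc [symmetric])
  then show ?case
    using Suc by (simp only: sum.lessThan_Suc opcomp.add_right) simp
qed (simp add: opcomp.zero_right)

text \<open>With \<open>E\<close> the operator \<open>A\<^sup>N(I - A)\<close> divided by the value of the same polynomial at \<open>\<mu>\<close>, the
  operator \<open>\<mu> - A\<close> divides \<open>(\<mu> - 1)(I - E)\<close>, with an explicit polynomial quotient. The Ritt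
  condition makes \<open>E\<close> small as soon as \<open>N\<close> is a large multiple of \<open>1 / \<bar>1 - \<mu>\<bar>\<close>; this works also
  slightly inside the unit disc, as long as \<open>\<bar>\<mu>\<bar>\<^sup>N\<close> stays bounded below.\<close>

lemma ritt_resolvent_factorization:
  fixes A :: "'x::complex_banach \<Rightarrow>\<^sub>L 'x" and N :: nat
  assumes A: "A \<in> bounded_ops" and \<mu>: "\<mu> \<noteq> 0" "\<mu> \<noteq> 1"
  defines "E \<equiv> inverse (\<mu> ^ N * (1 - \<mu>)) *\<^sub>C (op_power A N - op_power A (Suc N))"
    and "G \<equiv> (\<mu> - 1) *\<^sub>C (\<Sum>j<N. inverse (\<mu> ^ Suc j) *\<^sub>C op_power A j) + inverse (\<mu> ^ N) *\<^sub>C op_power A N"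
  assumes U: "is_op_inverse (id_blinfun - E) U"
  shows "is_op_inverse (\<mu> *\<^sub>C id_blinfun - A) (inverse (\<mu> - 1) *\<^sub>C (G o\<^sub>L U))"
proof -
  interpret commuting_family "\<lambda>_::unit. A" by standard (simp_all add: A)
  have gA: "A \<in> \<A>" by (rule gen_A)
  have dA: "\<mu> *\<^sub>C id_blinfun - A \<in> \<A>" by (intro A_intros gA)
  have EA: "E \<in> \<A>" unfolding E_def by (intro A_intros gA)
  have GA: "G \<in> \<A>" unfolding G_def by (intro A_intros gA)
  have UA: "U \<in> \<A>" by (rule bicommutant_inverse [OF _ U]) (intro A_intros EA)
  have "(\<mu> *\<^sub>C id_blinfun - A) o\<^sub>L G
      = (\<mu> - 1) *\<^sub>C (id_blinfun - inverse (\<mu> ^ N) *\<^sub>C op_power A N)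
        + inverse (\<mu> ^ N) *\<^sub>C (\<mu> *\<^sub>C op_power A N - op_power A (Suc N))"
    unfolding G_def opcomp.add_right opcomp_scaleC [OF bicommutant_bounded_ops [OF dA]]
      truncated_resolvent [OF A \<mu>(1)]
    by (simp add: opcomp.diff_left scaleC_opcomp op_power_Suc)
  also have "\<dots> = (\<mu> - 1) *\<^sub>C (id_blinfun - E)"
  proof -
    have "(\<mu> - 1) *\<^sub>C E = - inverse (\<mu> ^ N) *\<^sub>C (op_power A N - op_power A (Suc N))"
      using \<mu> unfolding E_def scaleC_scaleC by (intro arg_cong2 [of _ _ _ _ scaleC]) (auto simp: field_simps)
    then show ?thesis
      by (simp add: scaleC.diff_right scaleC.diff_left scaleC_scaleC scaleC.minus_left algebra_simps)
  qed
  finally have 1: "(\<mu> *\<^sub>C id_blinfun - A) o\<^sub>L G = (\<mu> - 1) *\<^sub>C (id_blinfun - E)" .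
  have "(\<mu> *\<^sub>C id_blinfun - A) o\<^sub>L (inverse (\<mu> - 1) *\<^sub>C (G o\<^sub>L U))
      = inverse (\<mu> - 1) *\<^sub>C (((\<mu> *\<^sub>C id_blinfun - A) o\<^sub>L G) o\<^sub>L U)"
    using dA by (simp add: opcomp_scaleC bicommutant_bounded_ops opcomp_assoc)
  also have "\<dots> = id_blinfun"
    unfolding 1 using \<mu> U by (simp add: scaleC_opcomp scaleC_scaleC is_op_inverse_def)
  finally have 2: "(\<mu> *\<^sub>C id_blinfun - A) o\<^sub>L (inverse (\<mu> - 1) *\<^sub>C (G o\<^sub>L U)) = id_blinfun" .
  moreover have "inverse (\<mu> - 1) *\<^sub>C (G o\<^sub>L U) \<in> \<A>" by (intro A_intros GA UA)
  ultimately show ?thesis using commute_A [OF dA] by (simp add: is_op_inverse_def)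
qed

lemma power_lower_bound:
  assumes "0 \<le> x" "x \<le> 1" "real n * x \<le> 1 / 2" shows "(1 - x) ^ n \<ge> (1 / 2 :: real)"
  using Bernoulli_inequality [of "- x" n] assms by simp

text \<open>For \<open>N\<close> close to \<open>M / \<bar>1 - \<mu>\<bar>\<close> the factorization gives \<open>(\<mu> - 1)R(\<mu>,A) = G (I - V)\<^sup>-\<^sup>1\<close>. Here
  \<open>V\<close> is a small multiple of an operator of the Ritt condition, and \<open>G\<close> is a combination of powers
  of \<open>A\<close> whose coefficients are summable uniformly in \<open>\<mu>\<close>. Everything rests on \<open>\<bar>\<mu>\<bar>\<^sup>N \<ge> 1/2\<close>, which
  holds as long as \<open>1 - \<bar>\<mu>\<bar>\<close> is a small multiple of \<open>\<bar>1 - \<mu>\<bar>\<close>.\<close>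

lemma rad_bounded_resolvent_region:
  fixes A :: "'x::complex_banach \<Rightarrow>\<^sub>L 'x"
  assumes A: "A \<in> bounded_ops" and C: "C \<ge> 1"
    and R0: "rad_bounded C {op_power A n |n. True}"
    and R1: "rad_bounded C {real n *\<^sub>R (op_power A n - op_power A (n - 1)) |n. n \<ge> 1}"
  shows "\<exists>e>0. \<exists>D E. rad_bounded D E \<and> (\<forall>\<mu>. \<mu> \<noteq> 1 \<longrightarrow> 1 - cmod \<mu> \<le> e * cmod (1 - \<mu>) \<longrightarrow>
    is_op_inverse (\<mu> *\<^sub>C id_blinfun - A) (resolvent \<mu> A) \<and> (\<mu> - 1) *\<^sub>C resolvent \<mu> A \<in> E)"
proof -
  \<comment> \<open>\<open>M\<close> makes the R-bound \<open>2 (2 / M) C\<close> of the operators \<open>V\<close> equal to \<open>1/2\<close>; \<open>e\<close> ensures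
    \<open>(N + 1)(1 - \<bar>\<mu>\<bar>) \<le> 1/2\<close>, so that \<open>\<bar>\<mu>\<bar>\<^sup>k \<ge> 1/2\<close> for \<open>k \<le> N + 1\<close>; \<open>L\<close> bounds the coefficient sum of \<open>G\<close>\<close>
  define M where "M = 8 * C"
  define e where "e = 1 / (4 * (M + 4))"
  define L where "L = 2 * M + 6"
  have M: "M \<ge> 8" using C by (simp add: M_def)
  have e: "e > 0" "e < 1" using M by (simp_all add: e_def field_simps)
  define E1 where "E1 = {\<Sum>j\<in>J. c j *\<^sub>C S j |(J::nat set) c S. finite J \<and> (\<Sum>j\<in>J. cmod (c j)) \<le> 2 / M
    \<and> (\<forall>j\<in>J. S j \<in> {real n *\<^sub>R (op_power A n - op_power A (n - 1)) |n. n \<ge> 1})}"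
  define E2 where "E2 = {\<Sum>j\<in>J. c j *\<^sub>C S j |(J::nat set) c S. finite J \<and> (\<Sum>j\<in>J. cmod (c j)) \<le> L
    \<and> (\<forall>j\<in>J. S j \<in> {op_power A n |n. True})}"
  have "rad_bounded (2 * (2 / M) * C) E1"
    unfolding E1_def using M by (intro rad_bounded_complex_combinations R1) auto
  then have E1: "rad_bounded (1 / 2) E1" using M by (auto simp: M_def)
  have E2: "rad_bounded (2 * L * C) E2"
    unfolding E2_def using M by (intro rad_bounded_complex_combinations R0) (auto simp: L_def)
  let ?I = "{U. \<exists>V\<in>E1. is_op_inverse (id_blinfun - V) U}"
  define E where "E = {G o\<^sub>L U |G U. G \<in> E2 \<and> U \<in> ?I}"
  have RE: "rad_bounded (2 * L * C * 2) E"
    unfolding E_def by (intro rad_bounded_comp E2 rad_bounded_inverse E1)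
  have "is_op_inverse (\<mu> *\<^sub>C id_blinfun - A) (resolvent \<mu> A) \<and> (\<mu> - 1) *\<^sub>C resolvent \<mu> A \<in> E"
    if \<mu>1: "\<mu> \<noteq> 1" and \<mu>: "1 - cmod \<mu> \<le> e * cmod (1 - \<mu>)" for \<mu>
  proof -
    define d where "d = cmod (1 - \<mu>)"
    have d: "d > 0" using \<mu>1 by (simp add: d_def)
    define N where "N = nat \<lceil>M / d\<rceil>"
    have N: "M / d \<le> N" "N \<le> M / d + 1" using M d by (auto simp: N_def)
    then have Nd: "M \<le> real N * d" "real N * d \<le> M + d" using d by (auto simp: field_simps)
    have \<mu>0: "\<mu> \<noteq> 0" using \<mu> e by auto
    have dl: "d \<le> 1 + cmod \<mu>" using norm_triangle_ineq4 [of 1 \<mu>] by (simp add: d_def)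
    have low: "inverse (cmod \<mu> ^ k) \<le> 2" if k: "k \<le> N + 1" for k
    proof -
      have "cmod \<mu> ^ k \<ge> 1 / 2"
      proof (cases "cmod \<mu> \<ge> 1")
        case True
        then show ?thesis using one_le_power [OF True, of k] by linarith
      next
        case False
        then have d2: "d \<le> 2" using dl by simp
        have "real k * (1 - cmod \<mu>) \<le> (real N + 1) * (e * d)"
          using k \<mu> False by (intro mult_mono) (auto simp: d_def)
        also have "\<dots> = e * (real N * d + d)" by (simp add: algebra_simps)
        also have "\<dots> \<le> e * (M + 4)" using Nd d2 e by (intro mult_left_mono) auto
        also have "\<dots> \<le> 1 / 2" using M by (simp add: e_def field_simps)
        finally have "(1 - (1 - cmod \<mu>)) ^ k \<ge> 1 / 2"
          using False by (intro power_lower_bound) auto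
        then show ?thesis by simp
      qed
      then show ?thesis using le_imp_inverse_le [of "1 / 2" "cmod \<mu> ^ k"] by simp
    qed
    define V where "V = inverse (\<mu> ^ N * (1 - \<mu>)) *\<^sub>C (op_power A N - op_power A (Suc N))"
    define G where "G = (\<mu> - 1) *\<^sub>C (\<Sum>j<N. inverse (\<mu> ^ Suc j) *\<^sub>C op_power A j) + inverse (\<mu> ^ N) *\<^sub>C op_power A N"
    have V: "V \<in> E1"
    proof -
      define c where "c = - inverse (\<mu> ^ N * (1 - \<mu>)) / of_nat (Suc N)"
      have "V = c *\<^sub>C (real (Suc N) *\<^sub>R (op_power A (Suc N) - op_power A (Suc N - 1)))"
      proof -
        have "c * of_real (real (Suc N)) = - inverse (\<mu> ^ N * (1 - \<mu>))"
          by (simp add: c_def del: of_nat_Suc)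
        then show ?thesis
          unfolding V_def scaleC_of_real [symmetric] scaleC_scaleC
          by (simp only: scaleC.minus_left scaleC.minus_right [symmetric] diff_Suc_1 minus_diff_eq)
      qed
      moreover have "cmod c \<le> 2 / M"
      proof -
        have "cmod c = inverse (cmod \<mu> ^ N * d) / real (Suc N)"
          by (simp only: c_def norm_divide norm_minus_cancel norm_inverse norm_mult norm_power norm_of_nat d_def)
        also have "\<dots> = inverse (cmod \<mu> ^ N) * (1 / (d * (real N + 1)))"
          by (simp add: divide_inverse add.commute)
        also have "\<dots> \<le> 2 * (1 / M)"
          using low [of N] d M Nd by (intro mult_mono frac_le) (auto simp: algebra_simps)
        finally show ?thesis by simp
      qed
      ultimately show ?thesis unfolding E1_def
        by (intro CollectI exI [of _ "{0}"] exI [of _ "\<lambda>_. c"]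
            exI [of _ "\<lambda>_. real (Suc N) *\<^sub>R (op_power A (Suc N) - op_power A (Suc N - 1))"])
           (auto simp del: of_nat_Suc intro!: exI [of _ "Suc N"])
    qed
    have "norm V \<le> 1 / 2" by (rule rad_bounded_norm_le [OF E1 V])
    then obtain U where U: "is_op_inverse (id_blinfun - V) U" using neumann_inverse [of V] by auto
    have inv: "is_op_inverse (\<mu> *\<^sub>C id_blinfun - A) (inverse (\<mu> - 1) *\<^sub>C (G o\<^sub>L U))"
      unfolding G_def by (rule ritt_resolvent_factorization [OF A \<mu>0 \<mu>1 U [unfolded V_def]])
    then have R: "resolvent \<mu> A = inverse (\<mu> - 1) *\<^sub>C (G o\<^sub>L U)" by (rule resolvent_eqI)
    have G: "G \<in> E2"
    proof -
      define c where "c j = (if j < N then (\<mu> - 1) * inverse (\<mu> ^ Suc j) else inverse (\<mu> ^ N))" for j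
      have "G = (\<Sum>j\<in>{..N}. c j *\<^sub>C op_power A j)"
        unfolding G_def c_def lessThan_Suc_atMost [symmetric] sum.lessThan_Suc
        by (simp add: scaleC.sum_right scaleC_scaleC)
      moreover have "(\<Sum>j\<in>{..N}. cmod (c j)) \<le> L"
      proof -
        have "(\<Sum>j\<in>{..N}. cmod (c j)) = d * (\<Sum>j<N. inverse (cmod \<mu> ^ Suc j)) + inverse (cmod \<mu> ^ N)"
          unfolding c_def lessThan_Suc_atMost [symmetric] sum.lessThan_Suc
          by (simp add: norm_mult norm_inverse norm_power sum_distrib_left d_def norm_minus_commute)
        also have "\<dots> \<le> L"
        proof (cases "cmod \<mu> \<ge> 1")
          case True
          have "(\<Sum>j<N. inverse (cmod \<mu> ^ Suc j)) \<le> (\<Sum>j<N. inverse (cmod \<mu>))"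
          proof (intro sum_mono le_imp_inverse_le)
            show "cmod \<mu> \<le> cmod \<mu> ^ Suc j" for j
              using mult_left_mono [OF one_le_power [OF True, of j], of "cmod \<mu>"] by simp
          qed (use \<mu>0 in auto)
          then have "d * (\<Sum>j<N. inverse (cmod \<mu> ^ Suc j)) \<le> d * (real N * inverse (cmod \<mu>))"
            using d by (intro mult_left_mono) auto
          also have "\<dots> \<le> (M + d) / cmod \<mu>"
            using Nd \<mu>0 by (simp add: field_simps)
          also have "\<dots> \<le> M + 2"
          proof -
            have "M + d \<le> (M + 2) * cmod \<mu>"
            proof -
              have "M * 1 \<le> M * cmod \<mu>" using True M by (intro mult_left_mono) auto
              then show ?thesis using dl True by (simp add: algebra_simps)
            qed
            then show ?thesis using \<mu>0 by (simp add: divide_le_eq)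
          qed
          finally show ?thesis
            using low [of N] M by (simp add: L_def)
        next
          case False
          have "(\<Sum>j<N. inverse (cmod \<mu> ^ Suc j)) \<le> (\<Sum>j<N. 2)"
            by (intro sum_mono low) auto
          then have "d * (\<Sum>j<N. inverse (cmod \<mu> ^ Suc j)) \<le> d * (real N * 2)"
            using d by (intro mult_left_mono) auto
          also have "\<dots> \<le> 2 * (M + 2)" using Nd dl False by (simp add: algebra_simps)
          finally show ?thesis using low [of N] by (simp add: L_def)
        qed
        finally show ?thesis .
      qed
      ultimately show ?thesis unfolding E2_def by blast
    qed
    have "(\<mu> - 1) *\<^sub>C resolvent \<mu> A = G o\<^sub>L U" using \<mu>1 by (simp add: R scaleC_scaleC)
    then have "(\<mu> - 1) *\<^sub>C resolvent \<mu> A \<in> E" unfolding E_def using G U V by blast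
    then show ?thesis using inv R by simp
  qed
  then show ?thesis using e RE by blast
qed

section \<open>Stolz domains\<close>

lemma open_stolz [simp]: "open (stolz a)" and convex_stolz [simp]: "convex (stolz a)"
  by (simp_all add: stolz_def convex_interior)

lemma mem_stolz:
  assumes w: "cmod w < sin a" and u: "0 < u" "u \<le> 1"
  shows "of_real (1 - u) + of_real u * w \<in> stolz a"
proof -
  let ?H = "convex hull (insert 1 (ball 0 (sin a))) :: complex set"
  have "ball (of_real (1 - u)) (u * sin a) \<subseteq> ?H"
  proof
    fix z :: complex assume z: "z \<in> ball (of_real (1 - u)) (u * sin a)"
    define v where "v = (z - of_real (1 - u)) / of_real u"
    have "cmod v < sin a"
      using z u by (simp add: v_def norm_divide dist_norm norm_minus_commute divide_less_eq mult.commute)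
    then have "v \<in> ?H" by (intro hull_inc) auto
    moreover have "1 \<in> ?H" by (intro hull_inc) auto
    ultimately have "(1 - u) *\<^sub>R 1 + u *\<^sub>R v \<in> ?H"
      using u by (intro convexD convex_convex_hull) auto
    then show "z \<in> ?H" using u by (simp add: v_def scaleR_conv_of_real)
  qed
  then have "ball (of_real (1 - u)) (u * sin a) \<subseteq> stolz a"
    unfolding stolz_def by (intro interior_maximal) auto
  moreover have "of_real (1 - u) + of_real u * w \<in> ball (of_real (1 - u)) (u * sin a)"
    using w u by (simp add: dist_norm norm_mult)
  ultimately show ?thesis by blast
qed

lemma radius_in_stolz: "0 < a \<Longrightarrow> a < pi \<Longrightarrow> 0 < u \<Longrightarrow> u \<le> 1 \<Longrightarrow> of_real (1 - u) \<in> stolz a"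
  using mem_stolz [of 0 a u] sin_gt_zero [of a] by simp

lemma zero_in_stolz: "0 < a \<Longrightarrow> a < pi \<Longrightarrow> 0 \<in> stolz a"
  using radius_in_stolz [of a 1] by simp

lemma stolz_subset_disc: "stolz a \<subseteq> ball 0 1"
proof -
  have "convex hull (insert 1 (ball 0 (sin a))) \<subseteq> (cball 0 1 :: complex set)"
    by (intro hull_minimal) (auto intro: order_trans [OF less_imp_le sin_le_one])
  then have "stolz a \<subseteq> interior (cball 0 1)" unfolding stolz_def by (rule interior_mono)
  then show ?thesis by simp
qed

lemma stolz_norm_less: "z \<in> stolz a \<Longrightarrow> cmod z < 1"
  using stolz_subset_disc by fastforce

lemma stolz_Re_less: "z \<in> stolz a \<Longrightarrow> Re z < 1"
  using stolz_norm_less complex_Re_le_cmod order_le_less_trans by blast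

lemma mem_closure_stolz:
  assumes a: "0 < a" "a < pi" and w: "cmod w \<le> sin a" and u: "0 \<le> u" "u \<le> 1"
  shows "of_real (1 - u) + of_real u * w \<in> closure (stolz a)"
proof -
  let ?H = "convex hull (insert 1 (ball 0 (sin a))) :: complex set"
  have "interior ?H \<noteq> {}" using zero_in_stolz [OF a] by (auto simp: stolz_def)
  then have cl: "closure (stolz a) = closure ?H"
    unfolding stolz_def by (intro convex_closure_interior) auto
  have "w \<in> closure (ball 0 (sin a))" using w sin_gt_zero [OF a] by simp
  also have "\<dots> \<subseteq> closure ?H" by (intro closure_mono) (auto intro: hull_inc)
  finally have "w \<in> closure ?H" .
  moreover have "1 \<in> closure ?H" by (intro subsetD [OF closure_subset] hull_inc) auto
  ultimately have "(1 - u) *\<^sub>R 1 + u *\<^sub>R w \<in> closure ?H"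
    using u by (intro convexD convex_closure convex_convex_hull) auto
  then show ?thesis by (simp add: cl scaleR_conv_of_real)
qed

text \<open>A point of the unit disc is outside the Stolz domain only if it is tangentially close to the
  circle, with a constant that tends to \<open>0\<close> as the angle tends to \<open>\<pi>/2\<close>: either it lies outside
  the sector at \<open>1\<close>, or it lies in the sector but beyond the point where the domain ends, and then
  \<open>\<bar>1 - \<mu>\<bar>\<close> is at least the length \<open>cos a\<close> of the tangent.\<close>

lemma outside_stolz:
  assumes a: "0 < a" "a < pi / 2" and \<mu>: "\<mu> \<notin> closure (stolz a)"
  shows "\<mu> \<noteq> 1" and "1 - cmod \<mu> \<le> 2 * cos a * cmod (1 - \<mu>)"
proof -
  have "1 \<in> closure (stolz a)" using mem_closure_stolz [of a 0 0] a sin_gt_zero [of a] by simp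
  then show \<mu>1: "\<mu> \<noteq> 1" using \<mu> by auto
  have c: "cos a > 0" using a by (intro cos_gt_zero) auto
  have s: "sin a > 0" using a by (intro sin_gt_zero) auto
  define n where "n = 1 - \<mu>"
  have n: "cmod n > 0" using \<mu>1 by (simp add: n_def)
  have r: "cmod \<mu> > sin a" using \<mu> mem_closure_stolz [of a \<mu> 1] a by force
  have key: "(cmod n)\<^sup>2 = 2 * Re n - 1 + (cmod \<mu>)\<^sup>2"
    unfolding n_def cmod_power2 by (simp add: power2_eq_square algebra_simps)
  show "1 - cmod \<mu> \<le> 2 * cos a * cmod (1 - \<mu>)"
  proof (cases "cmod \<mu> \<ge> 1")
    case True
    then have "1 - cmod \<mu> \<le> 0" by simp
    also have "0 \<le> 2 * cos a * cmod (1 - \<mu>)" using c by simp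
    finally show ?thesis .
  next
    case False
    consider "Re n < cos a * cmod n" | "Re n > (cos a)\<^sup>2" | "Re n \<ge> cos a * cmod n" "Re n \<le> (cos a)\<^sup>2" by linarith
    then show ?thesis
    proof cases
      case 1
      have "1 - cmod \<mu> \<le> (1 - cmod \<mu>) * (1 + cmod \<mu>)" using False by (simp add: mult_le_cancel_left1)
      also have "\<dots> = 2 * Re n - (cmod n)\<^sup>2" using key by (simp add: power2_eq_square algebra_simps)
      also have "\<dots> \<le> 2 * (cos a * cmod n)" using 1 by (smt (verit) zero_le_power2)
      finally show ?thesis by (simp add: n_def)
    next
      case 2
      have "(cos a)\<^sup>2 = 1 - (sin a)\<^sup>2" by (simp add: cos_squared_eq)
      moreover have "(sin a)\<^sup>2 \<le> (cmod \<mu>)\<^sup>2" using r s by (intro power_mono) auto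
      ultimately have "(cos a)\<^sup>2 \<le> (cmod n)\<^sup>2" using key 2 by linarith
      then have cn: "cos a \<le> cmod n" using c by (simp add: power2_le_iff_abs_le)
      have "1 - cmod \<mu> \<le> 1 - sin a" using r by simp
      also have "\<dots> \<le> (1 - sin a) * (1 + sin a)"
        using mult_left_mono [of 1 "1 + sin a" "1 - sin a"] s by simp
      also have "\<dots> = cos a * cos a"
        using sin_cos_squared_add [of a] by (simp add: power2_eq_square algebra_simps)
      also have "\<dots> \<le> 2 * cos a * cmod n" using cn c n by (simp add: mult_le_cancel_left)
      finally show ?thesis by (simp add: n_def)
    next
      case 3
      define u where "u = Re n / (cos a)\<^sup>2"
      have Rn: "Re n > 0" using 3(1) c n by (smt (verit) mult_pos_pos)
      have u: "0 < u" "u \<le> 1" using 3 Rn c by (simp_all add: u_def divide_le_eq_1)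
      define w where "w = 1 - n / of_real u"
      have "(cmod w)\<^sup>2 = 1 - 2 * Re n / u + (cmod n)\<^sup>2 / u\<^sup>2"
        unfolding w_def cmod_power2 using u by (simp add: power2_eq_square field_simps)
      also have "2 * Re n / u = 2 * (cos a)\<^sup>2" using Rn c by (simp add: u_def)
      also have "(cmod n)\<^sup>2 / u\<^sup>2 \<le> (cos a)\<^sup>2"
      proof -
        have "(cmod n * cos a)\<^sup>2 \<le> (Re n)\<^sup>2"
          using 3(1) c n by (intro power_mono) (auto simp: mult.commute)
        then have "(cmod n)\<^sup>2 * ((cos a)\<^sup>2 * (cos a)\<^sup>2) \<le> (cos a)\<^sup>2 * (Re n)\<^sup>2"
          using mult_left_mono [of "(cmod n * cos a)\<^sup>2" "(Re n)\<^sup>2" "(cos a)\<^sup>2"]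
          by (simp add: power_mult_distrib mult_ac)
        then show ?thesis using Rn c by (simp add: u_def power_divide divide_simps mult_ac power2_eq_square)
      qed
      finally have "(cmod w)\<^sup>2 \<le> (sin a)\<^sup>2" by (simp add: sin_squared_eq)
      then have "cmod w \<le> sin a" using s by (simp add: power2_le_iff_abs_le)
      then have "of_real (1 - u) + of_real u * w \<in> closure (stolz a)"
        using a u by (intro mem_closure_stolz) auto
      moreover have "of_real (1 - u) + of_real u * w = \<mu>"
        using u by (simp add: w_def n_def field_simps)
      ultimately show ?thesis using \<mu> by simp
    qed
  qed
qed

text \<open>The points that satisfy the inequality form a convex set that contains \<open>1\<close> and the disc.\<close>

lemma stolz_nontangential:
  assumes "z \<in> stolz a"
  shows "(1 - sin a) / 2 * cmod (1 - z) \<le> Re (1 - z)"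
proof -
  define k where "k = (1 - sin a) / 2"
  have k: "k \<ge> 0" by (simp add: k_def)
  let ?S = "{z. k * cmod (1 - z) \<le> Re (1 - z)}"
  have "convex hull (insert 1 (ball 0 (sin a))) \<subseteq> ?S"
  proof (rule hull_minimal)
    have "z \<in> ?S" if "cmod z < sin a" for z
    proof -
      have "cmod (1 - z) \<le> 1 + cmod z" using norm_triangle_ineq4 [of 1 z] by simp
      also have "\<dots> \<le> 2" using that order_trans [OF less_imp_le [OF that] sin_le_one] by simp
      finally have "k * cmod (1 - z) \<le> k * 2" using k by (intro mult_left_mono)
      also have "\<dots> = 1 - sin a" by (simp add: k_def)
      also have "\<dots> \<le> 1 - cmod z" using that by simp
      also have "\<dots> \<le> Re (1 - z)" using complex_Re_le_cmod [of z] by simp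
      finally show ?thesis by simp
    qed
    then show "insert 1 (ball 0 (sin a)) \<subseteq> ?S" by auto
    show "convex ?S"
    proof (rule convexI, clarify)
      fix x y and u v :: real
      assume x: "k * cmod (1 - x) \<le> Re (1 - x)" and y: "k * cmod (1 - y) \<le> Re (1 - y)"
        and uv: "0 \<le> u" "0 \<le> v" "u + v = 1"
      have "1 - (u *\<^sub>R x + v *\<^sub>R y) = u *\<^sub>R (1 - x) + v *\<^sub>R (1 - y)"
        using uv by (simp add: scaleR_right_diff_distrib) (metis of_real_1 of_real_add add.commute scaleR_conv_of_real mult_1_right)
      then have eq: "1 - (u *\<^sub>R x + v *\<^sub>R y) = u *\<^sub>R (1 - x) + v *\<^sub>R (1 - y)" .
      have "k * cmod (1 - (u *\<^sub>R x + v *\<^sub>R y)) \<le> k * (u * cmod (1 - x) + v * cmod (1 - y))"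
        unfolding eq using uv norm_triangle_ineq [of "u *\<^sub>R (1 - x)" "v *\<^sub>R (1 - y)"] k
        by (intro mult_left_mono) auto
      also have "\<dots> = u * (k * cmod (1 - x)) + v * (k * cmod (1 - y))" by (simp add: algebra_simps)
      also have "\<dots> \<le> u * Re (1 - x) + v * Re (1 - y)" using x y uv by (intro add_mono mult_left_mono) auto
      also have "\<dots> = Re (1 - (u *\<^sub>R x + v *\<^sub>R y))" unfolding eq by simp
      finally show "k * cmod (1 - (u *\<^sub>R x + v *\<^sub>R y)) \<le> Re (1 - (u *\<^sub>R x + v *\<^sub>R y))" .
    qed
  qed
  then show ?thesis using assms interior_subset unfolding stolz_def k_def by blast
qed

section \<open>The boundary path\<close>

lemma tangent_point: "complex_of_real (sin b) * cis (pi / 2 - b) = 1 - of_real (cos b) * cis (- b)"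
  using sin_cos_squared_add [of b]
  by (simp add: complex_eq_iff cos_diff sin_diff power2_eq_square)

lemma tangent_point': "complex_of_real (sin b) * cis (3 * pi / 2 + b) = 1 - of_real (cos b) * cis b"
proof -
  have "cis (3 * pi / 2 + b) = cis (2 * pi + (b - pi / 2))" by (simp add: field_simps)
  also have "\<dots> = cis (b - pi / 2)" by (simp only: cis_mult [symmetric] cis_2pi mult_1)
  finally show ?thesis
    using sin_cos_squared_add [of b]
    by (simp add: complex_eq_iff cos_diff sin_diff power2_eq_square)
qed

lemma stolz_path_left:
  assumes "t \<le> 1 / 2" shows "stolz_path b t = 1 - of_real (2 * t * cos b) * cis (- b)"
  using assms unfolding stolz_path_def tangent_point
  by (simp add: joinpaths_def linepath_def scaleR_conv_of_real algebra_simps)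

definition stolz_arc :: "real \<Rightarrow> real \<Rightarrow> real"
  where "stolz_arc b t = (pi / 2 - b) + (4 * t - 2) * (pi + 2 * b)"

lemma stolz_path_arc:
  assumes "1 / 2 < t" "t \<le> 3 / 4" shows "stolz_path b t = of_real (sin b) * cis (stolz_arc b t)"
proof -
  have "linepath (pi / 2 - b) (3 * pi / 2 + b) (4 * t - 2) = stolz_arc b t"
    by (simp add: linepath_def stolz_arc_def field_simps)
  then show ?thesis
    using assms unfolding stolz_path_def
    by (simp add: joinpaths_def part_circlepath_def cis_conv_exp algebra_simps)
qed

lemma stolz_path_right:
  assumes "3 / 4 < t" shows "stolz_path b t = 1 - of_real ((4 - 4 * t) * cos b) * cis b"
  using assms unfolding stolz_path_def tangent_point'
  by (simp add: joinpaths_def linepath_def scaleR_conv_of_real algebra_simps)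

lemma path_stolz_path: "path (stolz_path b)"
  unfolding stolz_path_def
  by (intro path_join_imp path_linepath path_part_circlepath)
     (simp_all add: cis_conv_exp)

definition stolz_deriv :: "real \<Rightarrow> real \<Rightarrow> complex"
  where "stolz_deriv b t = (if t < 1 / 2 then - of_real (2 * cos b) * cis (- b)
    else if t < 3 / 4 then of_real (4 * (pi + 2 * b) * sin b) * (\<i> * cis (stolz_arc b t))
    else of_real (4 * cos b) * cis b)"

definition stolz_params :: "real set"
  where "stolz_params = {0<..<1} - {1 / 2, 3 / 4}"

lemma open_stolz_params [simp]: "open stolz_params"
  unfolding stolz_params_def by (intro open_Diff) auto

lemma stolz_path_has_derivative:
  assumes t: "t \<in> stolz_params"
  shows "(stolz_path b has_vector_derivative stolz_deriv b t) (at t)"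
proof -
  consider "0 < t" "t < 1 / 2" | "1 / 2 < t" "t < 3 / 4" | "3 / 4 < t" "t < 1"
    using t by (force simp: stolz_params_def)
  then show ?thesis
  proof cases
    case 1
    have "((\<lambda>t. 1 - of_real (2 * t * cos b) * cis (- b)) has_vector_derivative stolz_deriv b t) (at t)"
      using 1 by (auto simp: stolz_deriv_def intro!: derivative_eq_intros)
    then show ?thesis
      by (rule has_vector_derivative_transform_within_open [of _ _ _ "{0<..<1/2}"])
         (use 1 in \<open>auto simp: stolz_path_left\<close>)
  next
    case 2
    have "((\<lambda>t. \<i> * of_real (stolz_arc b t)) has_vector_derivative \<i> * of_real (4 * (pi + 2 * b))) (at t)"
      unfolding stolz_arc_def by (auto intro!: derivative_eq_intros)
    from field_vector_diff_chain_at [OF this DERIV_exp]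
    have "((\<lambda>t. cis (stolz_arc b t)) has_vector_derivative
        \<i> * of_real (4 * (pi + 2 * b)) * cis (stolz_arc b t)) (at t)"
      by (simp add: o_def cis_conv_exp)
    from has_vector_derivative_mult_right [OF this, of "of_real (sin b)"]
    have "((\<lambda>t. of_real (sin b) * cis (stolz_arc b t)) has_vector_derivative stolz_deriv b t) (at t)"
      using 2 by (simp add: stolz_deriv_def mult_ac)
    then show ?thesis
      by (rule has_vector_derivative_transform_within_open [of _ _ _ "{1/2<..<3/4}"])
         (use 2 in \<open>auto simp: stolz_path_arc\<close>)
  next
    case 3
    have "((\<lambda>t. 1 - of_real ((4 - 4 * t) * cos b) * cis b) has_vector_derivative stolz_deriv b t) (at t)"
      using 3 by (auto simp: stolz_deriv_def intro!: derivative_eq_intros)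
    then show ?thesis
      by (rule has_vector_derivative_transform_within_open [of _ _ _ "{3/4<..<1}"])
         (use 3 in \<open>auto simp: stolz_path_right\<close>)
  qed
qed

lemma stolz_path_vector_derivative:
  assumes t: "t \<in> stolz_params"
  shows "vector_derivative (stolz_path b) (at t within {0..1}) = stolz_deriv b t"
proof (rule vector_derivative_within)
  show "at t within {0..1} \<noteq> bot"
    using at_within_Icc_at [of 0 t 1] t unfolding stolz_params_def by simp
  show "(stolz_path b has_vector_derivative stolz_deriv b t) (at t within {0..1})"
    by (rule has_vector_derivative_at_within [OF stolz_path_has_derivative [OF t]])
qed

lemma continuous_stolz_deriv: "continuous_on stolz_params (stolz_deriv b)"
proof -
  have "continuous_on ({0<..<1/2} \<union> ({1/2<..<3/4} \<union> {3/4<..<1})) (stolz_deriv b)"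
  proof (intro continuous_on_open_Un)
    show "continuous_on {0<..<1/2} (stolz_deriv b)"
      by (rule continuous_on_eq [where f = "\<lambda>_. - of_real (2 * cos b) * cis (- b)"]) (auto simp: stolz_deriv_def)
    show "continuous_on {1/2<..<3/4} (stolz_deriv b)"
      by (rule continuous_on_eq [where f = "\<lambda>t. of_real (4 * (pi + 2 * b) * sin b) * (\<i> * cis (stolz_arc b t))"])
         (auto simp: stolz_deriv_def stolz_arc_def cis_conv_exp intro!: continuous_intros)
    show "continuous_on {3/4<..<1} (stolz_deriv b)"
      by (rule continuous_on_eq [where f = "\<lambda>_. of_real (4 * cos b) * cis b"]) (auto simp: stolz_deriv_def)
  qed auto
  then show ?thesis
    by (rule continuous_on_subset) (auto simp: stolz_params_def)
qed

lemma norm_stolz_deriv: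
  assumes b: "0 < b" "b < pi / 2" shows "cmod (stolz_deriv b t) \<le> 8 * pi"
proof -
  have c: "\<bar>cos b\<bar> \<le> 1" and s: "\<bar>sin b\<bar> \<le> 1" by simp_all
  have 1: "\<bar>4 * (pi + 2 * b)\<bar> * \<bar>sin b\<bar> \<le> 8 * pi * 1"
    using b s by (intro mult_mono) auto
  consider "t < 1 / 2" | "\<not> t < 1 / 2" "t < 3 / 4" | "\<not> t < 1 / 2" "\<not> t < 3 / 4" by blast
  then show ?thesis
  proof cases
    case 1
    then have "cmod (stolz_deriv b t) = 2 * \<bar>cos b\<bar>" by (simp add: stolz_deriv_def norm_mult)
    then show ?thesis using c pi_gt3 by linarith
  next
    case 2
    then have "cmod (stolz_deriv b t) = \<bar>4 * (pi + 2 * b)\<bar> * \<bar>sin b\<bar>"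
      by (simp only: stolz_deriv_def if_False if_True norm_mult norm_of_real norm_ii norm_cis abs_mult mult_1 mult_1_right)
    then show ?thesis using 1 by linarith
  next
    case 3
    then have "cmod (stolz_deriv b t) = 4 * \<bar>cos b\<bar>" by (simp add: stolz_deriv_def norm_mult)
    then show ?thesis using c pi_gt3 by linarith
  qed
qed

lemma stolz_path_cases:
  assumes t: "t \<in> {0<..<1}" and b: "0 < b"
  obtains (seg) \<tau> \<sigma> where "stolz_path b t = 1 - of_real (\<tau> * cos b) * cis \<sigma>" "\<sigma> = b \<or> \<sigma> = - b"
      "0 < \<tau>" "\<tau> \<le> 1" "2 * min t (1 - t) \<le> \<tau>" "\<tau> \<le> 4 * min t (1 - t)"
    | (arc) \<theta> where "stolz_path b t = of_real (sin b) * cis \<theta>" "pi / 2 - b \<le> \<theta>" "\<theta> \<le> 3 * pi / 2 + b"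
      "1 / 4 \<le> min t (1 - t)" 
proof -
  consider "t \<le> 1 / 2" | "1 / 2 < t" "t \<le> 3 / 4" | "3 / 4 < t" by linarith
  then show ?thesis
  proof cases
    case 1
    then show ?thesis using t by (intro seg [of "2 * t" "- b"]) (auto simp: stolz_path_left)
  next
    case 2
    have "stolz_arc b t \<le> (pi / 2 - b) + 1 * (pi + 2 * b)"
      unfolding stolz_arc_def using 2 b by (intro add_left_mono mult_right_mono) auto
    moreover have "stolz_arc b t \<ge> (pi / 2 - b) + 0 * (pi + 2 * b)"
      unfolding stolz_arc_def using 2 b by (intro add_left_mono mult_right_mono) auto
    ultimately show ?thesis using 2 by (intro arc [of "stolz_arc b t"]) (auto simp: stolz_path_arc)
  next
    case 3
    then show ?thesis using t by (intro seg [of "4 - 4 * t" b]) (auto simp: stolz_path_right)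
  qed
qed

lemma cos_arc_le:
  assumes b: "0 < b" "b < pi / 2" and \<theta>: "pi / 2 - b \<le> \<theta>" "\<theta> \<le> 3 * pi / 2 + b"
  shows "cos \<theta> \<le> sin b"
proof -
  have sb: "sin b = cos (pi / 2 - b)" by (simp add: cos_diff)
  show ?thesis
  proof (cases "\<theta> \<le> pi")
    case True
    then show ?thesis unfolding sb using b \<theta> by (intro cos_monotone_0_pi_le) auto
  next
    case False
    have "cos \<theta> = cos (2 * pi - \<theta>)" by (simp add: cos_diff)
    also have "\<dots> \<le> cos (pi / 2 - b)" using b \<theta> False by (intro cos_monotone_0_pi_le) auto
    finally show ?thesis by (simp add: sb)
  qed
qed

text \<open>All constants below depend on \<open>b\<close> only through \<open>cos b\<close>, so they are uniform as long as \<open>b\<close>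
  stays away from \<open>\<pi>/2\<close>.\<close>

lemma stolz_path_bounds:
  assumes t: "t \<in> {0<..<1}" and b: "0 < b" "b < pi / 2"
  defines "n \<equiv> 1 - stolz_path b t"
  shows "cos b * min t (1 - t) \<le> cmod n" "cmod n \<le> 8 * min t (1 - t)"
    and "(cos b)\<^sup>2 / 4 * cmod n \<le> Re n"
    and "1 - cmod (stolz_path b t) \<le> 2 * cos b * cmod n"
proof -
  have c: "cos b > 0" using b by (intro cos_gt_zero) auto
  have s: "sin b > 0" using b by (intro sin_gt_zero) auto
  have cs: "(cos b)\<^sup>2 = 1 - (sin b)\<^sup>2" by (simp add: cos_squared_eq)
  have key: "(cmod n)\<^sup>2 = 2 * Re n - 1 + (cmod (stolz_path b t))\<^sup>2"
    unfolding n_def cmod_power2 by (simp add: power2_eq_square algebra_simps)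
  define m where "m = min t (1 - t)"
  have m: "0 < m" "m \<le> 1 / 2" using t by (auto simp: m_def min_def)
  have "cos b * m \<le> cmod n \<and> cmod n \<le> 8 * m \<and> (cos b)\<^sup>2 / 4 * cmod n \<le> Re n \<and>
     1 - cmod (stolz_path b t) \<le> 2 * cos b * cmod n"
    using t b(1)
  proof (cases rule: stolz_path_cases)
    case (seg \<tau> \<sigma>)
    have n: "n = of_real (\<tau> * cos b) * cis \<sigma>" using seg by (simp add: n_def)
    have cn: "cmod n = \<tau> * cos b" using seg(3) c by (simp add: n norm_mult abs_mult)
    have Re: "Re n = cos b * cmod n" unfolding cn unfolding n using seg(2) by auto
    have "cos b * m \<le> \<tau> * cos b" 
    proof -
      have "m \<le> 2 * m" using m by simp
      also have "2 * m \<le> \<tau>" using seg(5) by (simp add: m_def)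
      finally have "m \<le> \<tau>" .
      then show ?thesis using c by (simp add: mult.commute)
    qed
    moreover have "\<tau> * cos b \<le> \<tau> * 1" using seg(3) by (intro mult_left_mono) auto
    moreover have "(cos b)\<^sup>2 / 4 * cmod n \<le> cos b * cmod n"
    proof (rule mult_right_mono)
      have "cos b * cos b \<le> cos b * 1" using c by (intro mult_left_mono) auto
      then show "(cos b)\<^sup>2 / 4 \<le> cos b" using c unfolding power2_eq_square by linarith
    qed simp
    moreover have "1 - cmod (stolz_path b t) \<le> 2 * cos b * cmod n"
    proof (cases "cmod (stolz_path b t) \<le> 1")
      case True
      then have "1 - cmod (stolz_path b t) \<le> (1 - cmod (stolz_path b t)) * (1 + cmod (stolz_path b t))"
        by (simp add: mult_le_cancel_left1)
      also have "\<dots> = 2 * Re n - (cmod n)\<^sup>2" using key by (simp add: power2_eq_square algebra_simps)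
      also have "\<dots> \<le> 2 * cos b * cmod n" using Re by simp
      finally show ?thesis .
    next
      case False
      then show ?thesis using c by (smt (verit) mult_nonneg_nonneg norm_ge_zero)
    qed
    moreover have "\<tau> \<le> 4 * m" using seg(6) by (simp add: m_def)
    ultimately show ?thesis using m Re by (simp add: cn)
  next
    case (arc \<theta>)
    have r: "cmod (stolz_path b t) = sin b" using s by (simp add: arc(1) norm_mult)
    have Ren: "Re n = 1 - sin b * cos \<theta>" by (simp add: n_def arc(1))
    have ct: "cos \<theta> \<le> sin b" by (rule cos_arc_le [OF b arc(2,3)])
    have "sin b * cos \<theta> \<le> sin b * sin b" using ct s by (intro mult_left_mono) auto
    then have Re1: "(cos b)\<^sup>2 \<le> Re n" using cs unfolding Ren power2_eq_square by linarith
    have "(cos b)\<^sup>2 \<le> (cmod n)\<^sup>2" using key Re1 cs unfolding r by linarith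
    then have cn: "cos b \<le> cmod n" using c by (simp add: power2_le_iff_abs_le)
    have n2: "cmod n \<le> 2"
      using norm_triangle_ineq4 [of 1 "stolz_path b t"] sin_le_one [of b]
      unfolding r n_def norm_one by linarith
    have "cos b * m \<le> cos b * 1" using c m by (intro mult_left_mono) auto
    moreover have "(cos b)\<^sup>2 / 4 * cmod n \<le> (cos b)\<^sup>2 / 4 * 4" using n2 by (intro mult_left_mono) auto
    moreover have "1 - sin b \<le> 2 * cos b * cmod n"
    proof -
      have "1 - sin b \<le> (1 - sin b) * (1 + sin b)"
        using mult_left_mono [of 1 "1 + sin b" "1 - sin b"] s by simp
      also have "\<dots> = cos b * cos b"
        using cs by (simp only: power2_eq_square algebra_simps)
      also have "\<dots> \<le> 2 * cos b * cmod n" using cn c by (simp add: mult_le_cancel_left)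
      finally show ?thesis .
    qed
    moreover have "1 / 4 \<le> m" using arc(4) by (simp add: m_def)
    moreover have "cos b * 1 \<le> cmod n" using cn by simp
    ultimately show ?thesis using cn n2 Re1 unfolding r by linarith
  qed
  then show "cos b * min t (1 - t) \<le> cmod n" "cmod n \<le> 8 * min t (1 - t)"
    "(cos b)\<^sup>2 / 4 * cmod n \<le> Re n" "1 - cmod (stolz_path b t) \<le> 2 * cos b * cmod n"
    by (simp_all add: m_def)
qed

lemma stolz_path_in_stolz:
  assumes t: "t \<in> {0<..<1}" and b: "0 < b" "b < c" "c < pi / 2"
  shows "stolz_path b t \<in> stolz c"
  using t b(1)
proof (cases rule: stolz_path_cases)
  case (seg \<tau> \<sigma>)
  have ss: "sin b < sin c" using b by (intro sin_monotone_2pi) auto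
  define w where "w = 1 - of_real (cos b) * cis \<sigma>"
  have "w = of_real (sin b) * cis (pi / 2 - b) \<or> w = of_real (sin b) * cis (3 * pi / 2 + b)"
    using seg(2) tangent_point tangent_point' by (auto simp: w_def)
  then have "cmod w = \<bar>sin b\<bar>" by (auto simp: norm_mult)
  then have "cmod w < sin c" using ss sin_gt_zero [of b] b by auto
  then have "of_real (1 - \<tau>) + of_real \<tau> * w \<in> stolz c" using seg by (intro mem_stolz) auto
  moreover have "of_real (1 - \<tau>) + of_real \<tau> * w = stolz_path b t"
    by (simp add: w_def seg(1) algebra_simps)
  ultimately show ?thesis by simp
next
  case (arc \<theta>)
  have ss: "sin b < sin c" using b by (intro sin_monotone_2pi) auto
  have "cmod (stolz_path b t) = \<bar>sin b\<bar>" by (simp add: arc(1) norm_mult)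
  then have "cmod (stolz_path b t) < sin c" using ss sin_gt_zero [of b] b by auto
  from mem_stolz [OF this, of 1] show ?thesis by simp
qed

section \<open>Cauchy's theorem for the boundary path\<close>

lemma stolz_path_primitive:
  assumes b: "0 < b" "b < c" "c < pi / 2"
    and G: "\<And>z. z \<in> stolz c \<Longrightarrow> (G has_field_derivative g z) (at z)"
    and uv: "0 < u" "u \<le> v" "v < 1"
  shows "((\<lambda>t. g (stolz_path b t) * stolz_deriv b t) has_integral G (stolz_path b v) - G (stolz_path b u)) {u..v}"
proof (rule fundamental_theorem_of_calculus_interior_strong [where S = "{1/2, 3/4}"])
  have inS: "stolz_path b t \<in> stolz c" if "t \<in> {u..v}" for t
    using that uv by (intro stolz_path_in_stolz b) auto
  fix t assume t: "t \<in> {u<..<v} - {1 / 2, 3 / 4}"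
  then have "t \<in> stolz_params" using uv by (auto simp: stolz_params_def)
  from field_vector_diff_chain_at [OF stolz_path_has_derivative [OF this] G [OF inS]] t
  show "((\<lambda>t. G (stolz_path b t)) has_vector_derivative g (stolz_path b t) * stolz_deriv b t) (at t)"
    by (simp add: o_def mult.commute)
next
  have "continuous_on (stolz c) G"
    by (rule DERIV_continuous_on [of _ _ g]) (blast intro: G has_field_derivative_at_within)
  moreover have "continuous_on {u..v} (stolz_path b)"
    by (rule continuous_on_subset [OF path_stolz_path [unfolded path_def]]) (use uv in auto)
  moreover have "stolz_path b ` {u..v} \<subseteq> stolz c"
    using uv by (auto intro!: stolz_path_in_stolz b)
  ultimately show "continuous_on {u..v} (\<lambda>t. G (stolz_path b t))"
    by (rule continuous_on_compose2)
qed (use uv in auto)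

text \<open>The path ends at the boundary point \<open>1\<close>, where \<open>g\<close> may have an integrable singularity. The
  primitive of \<open>g\<close> takes nearly the same value at the two points at which the path enters a small
  neighbourhood of \<open>1\<close>, because the vertical segment between them stays at a comparable distance
  from \<open>1\<close>.\<close>

lemma cauchy_stolz:
  assumes b: "0 < b" "b < c" "c < pi / 2"
    and g: "g holomorphic_on stolz c" and s: "0 < s" "s \<le> 1"
    and bound: "\<And>z. z \<in> stolz c \<Longrightarrow> cmod (g z) \<le> K * cmod (1 - z) powr (s - 1)"
  shows "(LINT t:stolz_params|lborel. g (stolz_path b t) * stolz_deriv b t) = 0"
proof (cases "set_integrable lborel stolz_params (\<lambda>t. g (stolz_path b t) * stolz_deriv b t)")
  case False
  then show ?thesis
    by (simp add: set_lebesgue_integral_def set_integrable_def not_integrable_integral_eq)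
next
  case int: True
  define h where "h t = g (stolz_path b t) * stolz_deriv b t" for t
  have cb: "cos b > 0" using b by (intro cos_gt_zero) auto
  obtain G where G: "\<And>z. z \<in> stolz c \<Longrightarrow> (G has_field_derivative g z) (at z)"
    using holomorphic_convex_primitive' [OF convex_stolz open_stolz g] at_within_open [OF _ open_stolz] by metis
  define d where "d n = 1 / (real n + 3)" for n
  have d: "0 < d n" "d n \<le> 1 / 3" for n by (auto simp: d_def field_simps)
  \<comment> \<open>The last segment is run through twice as fast as the first one, so that the end points of
    this interval are mapped to complex conjugates.\<close>
  define A where "A n = {d n..1 - d n / 2} - {1 / 2, 3 / 4}" for n
  have UA: "(\<Union>n. A n) = stolz_params"
  proof
    show "(\<Union>n. A n) \<subseteq> stolz_params"
    proof clarify
      fix n t assume "t \<in> A n"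
      then show "t \<in> stolz_params" using d [of n] by (auto simp: A_def stolz_params_def)
    qed
    show "stolz_params \<subseteq> (\<Union>n. A n)"
    proof
      fix t assume t: "t \<in> stolz_params"
      define m where "m = min t (1 - t)"
      obtain n where n: "1 / m < real n" using reals_Archimedean2 by blast
      have m: "m > 0" using t by (auto simp: m_def stolz_params_def)
      have "1 < real n * m" using n m by (simp add: field_simps)
      then have "d n \<le> m" using m unfolding d_def by (simp add: divide_le_eq algebra_simps)
      then have "d n \<le> t" "d n \<le> 1 - t" by (simp_all add: m_def)
      then show "t \<in> (\<Union>n. A n)" using t d [of n] by (intro UN_I [of n]) (auto simp: A_def stolz_params_def)
    qed
  qed
  have mono: "incseq A"
  proof (rule incseq_SucI)
    fix n
    have "d (Suc n) \<le> d n" by (simp add: d_def frac_le)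
    then show "A n \<le> A (Suc n)" by (auto simp: A_def)
  qed
  have "(\<lambda>n. LINT t:A n|lborel. h t) \<longlonglongrightarrow> (LINT t:(\<Union>n. A n)|lborel. h t)"
    using int UA by (intro set_integral_cont_up mono) (auto simp: A_def h_def)
  then have lim: "(\<lambda>n. LINT t:A n|lborel. h t) \<longlonglongrightarrow> (LINT t:stolz_params|lborel. h t)"
    by (simp only: UA)
  define k where "k = K * (2 * (cos b)\<^sup>2) powr (s - 1) * 4"
  have est: "cmod (LINT t:A n|lborel. h t) \<le> k * d n powr s" for n
  proof -
    have "set_integrable lborel (A n) h"
      using int UA by (intro set_integrable_subset [OF int [folded h_def]]) (auto simp: A_def h_def)
    then have "(LINT t:A n|lborel. h t) = integral (A n) h"
      by (simp add: set_borel_integral_eq_integral)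
    also have "\<dots> = integral {d n..1 - d n / 2} h"
    proof (rule integral_spike_set)
      have "negligible {1 / 2, 3 / 4 :: real}" by simp
      then show "negligible {t \<in> A n - {d n..1 - d n / 2}. h t \<noteq> 0}"
        "negligible {t \<in> {d n..1 - d n / 2} - A n. h t \<noteq> 0}"
        by (rule negligible_subset; auto simp: A_def)+
    qed
    also have "\<dots> = G (stolz_path b (1 - d n / 2)) - G (stolz_path b (d n))"
      unfolding h_def using d [of n] by (intro integral_unique stolz_path_primitive [OF b G]) auto
    finally have eq: "(LINT t:A n|lborel. h t) = G (stolz_path b (1 - d n / 2)) - G (stolz_path b (d n))" .
    define p where "p = stolz_path b (1 - d n / 2)"
    define q where "q = stolz_path b (d n)"
    have p: "p = 1 - of_real (2 * d n * cos b) * cis b"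
      using d [of n] by (simp add: p_def stolz_path_right)
    have q: "q = 1 - of_real (2 * d n * cos b) * cis (- b)"
      using d [of n] by (simp add: q_def stolz_path_left)
    have pq: "p \<in> stolz c" "q \<in> stolz c"
      unfolding p_def q_def using d [of n] by (auto intro!: stolz_path_in_stolz b)
    define e where "e = 2 * d n * (cos b)\<^sup>2"
    have e: "e > 0" using d [of n] cb by (simp add: e_def)
    define S where "S = stolz c \<inter> {z. Re z = 1 - e}"
    have cS: "convex S"
    proof -
      have "{z. Re z = 1 - e} = {z. Re z \<le> 1 - e} \<inter> {z. Re z \<ge> 1 - e}" by auto
      then show ?thesis
        unfolding S_def by (simp add: convex_Int convex_halfspace_Re_le convex_halfspace_Re_ge)
    qed
    have "0 \<le> cmod (g p)" by simp
    also have "\<dots> \<le> K * cmod (1 - p) powr (s - 1)" by (rule bound [OF pq(1)])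
    finally have "K \<ge> 0 \<or> 1 - p = 0" by (auto simp: zero_le_mult_iff)
    then have K: "K \<ge> 0" using cb d [of n] by (auto simp: p)
    have Gpq: "norm (G p - G q) \<le> (K * e powr (s - 1)) * norm (p - q)"
    proof (rule field_differentiable_bound [OF cS])
      show "(G has_field_derivative g z) (at z within S)" if "z \<in> S" for z
        using that G by (auto simp: S_def intro: has_field_derivative_at_within)
      show "norm (g z) \<le> K * e powr (s - 1)" if "z \<in> S" for z
      proof -
        have "e \<le> cmod (1 - z)" using that abs_Re_le_cmod [of "1 - z"] e by (auto simp: S_def)
        then have "cmod (1 - z) powr (s - 1) \<le> e powr (s - 1)" using s e by (intro powr_mono2') auto
        then have "K * cmod (1 - z) powr (s - 1) \<le> K * e powr (s - 1)"
          by (intro mult_left_mono K)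
        then show ?thesis using bound [of z] that by (auto simp: S_def)
      qed
      show "p \<in> S" "q \<in> S" using pq by (auto simp: S_def p q e_def power2_eq_square)
    qed
    have pq4: "norm (p - q) \<le> 4 * d n"
    proof -
      have "norm (p - q) \<le> cmod (of_real (2 * d n * cos b) * cis (- b)) + cmod (of_real (2 * d n * cos b) * cis b)"
        unfolding p q using norm_triangle_ineq4 [of "of_real (2 * d n * cos b) * cis (- b)" "of_real (2 * d n * cos b) * cis b"]
        by (simp add: norm_minus_commute)
      also have "\<dots> = 4 * d n * \<bar>cos b\<bar>" using d [of n] by (simp add: norm_mult)
      also have "\<dots> \<le> 4 * d n * 1" using d [of n] by (intro mult_left_mono) auto
      finally show ?thesis by simp
    qed
    have keq: "(K * e powr (s - 1)) * (4 * d n) = k * d n powr s"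
    proof -
      have "e powr (s - 1) = (2 * (cos b)\<^sup>2) powr (s - 1) * d n powr (s - 1)"
        unfolding e_def using d [of n] by (subst powr_mult [symmetric]) (auto simp: mult_ac)
      moreover have "d n powr (s - 1) * d n = d n powr s"
        using d [of n] by (simp add: powr_mult_base mult.commute)
      ultimately show ?thesis by (simp add: k_def)
    qed
    have "norm (G p - G q) \<le> (K * e powr (s - 1)) * (4 * d n)"
      using K pq4 by (intro order_trans [OF Gpq] mult_left_mono) auto
    then show ?thesis unfolding eq p_def q_def keq by simp
  qed
  have "d \<longlonglongrightarrow> 0" unfolding d_def by real_asymp
  then have "(\<lambda>n. d n powr s) \<longlonglongrightarrow> 0"
    using s d by (intro tendsto_zero_powrI [of _ _ _ s]) (auto intro!: always_eventually simp: less_imp_le)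
  then have "(\<lambda>n. k * d n powr s) \<longlonglongrightarrow> k * 0" by (intro tendsto_intros)
  then have k0: "(\<lambda>n. k * d n powr s) \<longlonglongrightarrow> 0" by simp
  have "(\<lambda>n. LINT t:A n|lborel. h t) \<longlonglongrightarrow> 0"
    by (rule Lim_null_comparison [OF always_eventually k0]) (use est in blast)
  with lim show ?thesis unfolding h_def by (rule LIMSEQ_unique)
qed

section \<open>Holomorphic operator-valued functions\<close>

text \<open>The derivative is given by an operator, hence complex linear, and composition with a complex
  functional yields a holomorphic function.\<close>

definition op_holomorphic :: "(complex \<Rightarrow> 'x::complex_normed_vector \<Rightarrow>\<^sub>L 'x) \<Rightarrow> complex set \<Rightarrow> bool"
  where "op_holomorphic F S \<longleftrightarrow>
    (\<forall>z\<in>S. F z \<in> bounded_ops \<and> (\<exists>F'. (F has_derivative (\<lambda>h. h *\<^sub>C F')) (at z)))"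

lemma op_holomorphic_const: "A \<in> bounded_ops \<Longrightarrow> op_holomorphic (\<lambda>_. A) S"
  unfolding op_holomorphic_def by (auto intro!: exI [of _ 0] simp: scaleC.zero_right)

lemma bounded_ops_add: "A \<in> bounded_ops \<Longrightarrow> B \<in> bounded_ops \<Longrightarrow> A + B \<in> bounded_ops"
  by (simp add: bounded_ops_def blinfun.add_left scaleC_add_right)

lemma bounded_ops_scaleC: "A \<in> bounded_ops \<Longrightarrow> c *\<^sub>C A \<in> bounded_ops"
  by (simp add: bounded_ops_def blinfun_apply_scaleC scaleC_scaleC mult.commute)

lemma op_holomorphic_add:
  assumes "op_holomorphic F S" "op_holomorphic G S" shows "op_holomorphic (\<lambda>z. F z + G z) S"
  unfolding op_holomorphic_def
proof
  fix z assume z: "z \<in> S"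
  obtain F' where F': "(F has_derivative (\<lambda>h. h *\<^sub>C F')) (at z)" using assms(1) z by (auto simp: op_holomorphic_def)
  obtain G' where G': "(G has_derivative (\<lambda>h. h *\<^sub>C G')) (at z)" using assms(2) z by (auto simp: op_holomorphic_def)
  have "((\<lambda>z. F z + G z) has_derivative (\<lambda>h. h *\<^sub>C (F' + G'))) (at z)"
    using has_derivative_add [OF F' G'] by (simp add: scaleC_add_right)
  then show "F z + G z \<in> bounded_ops \<and> (\<exists>F'. ((\<lambda>z. F z + G z) has_derivative (\<lambda>h. h *\<^sub>C F')) (at z))"
    using assms z by (auto simp: op_holomorphic_def intro: bounded_ops_add)
qed

lemma op_holomorphic_comp:
  assumes "op_holomorphic F S" "op_holomorphic G S" shows "op_holomorphic (\<lambda>z. F z o\<^sub>L G z) S"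
  unfolding op_holomorphic_def
proof
  fix z assume z: "z \<in> S"
  obtain F' where F': "(F has_derivative (\<lambda>h. h *\<^sub>C F')) (at z)" using assms(1) z by (auto simp: op_holomorphic_def)
  obtain G' where G': "(G has_derivative (\<lambda>h. h *\<^sub>C G')) (at z)" using assms(2) z by (auto simp: op_holomorphic_def)
  have Fz: "F z \<in> bounded_ops" using assms(1) z by (auto simp: op_holomorphic_def)
  have "((\<lambda>z. F z o\<^sub>L G z) has_derivative (\<lambda>h. h *\<^sub>C ((F z o\<^sub>L G') + (F' o\<^sub>L G z)))) (at z)"
    using opcomp.FDERIV [OF F' G'] by (simp add: scaleC_add_right opcomp_scaleC [OF Fz] scaleC_opcomp)
  then show "(F z o\<^sub>L G z) \<in> bounded_ops \<and> (\<exists>F'. ((\<lambda>z. F z o\<^sub>L G z) has_derivative (\<lambda>h. h *\<^sub>C F')) (at z))"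
    using assms z by (auto simp: op_holomorphic_def intro: bounded_ops_comp)
qed

lemma op_holomorphic_scaleC:
  assumes f: "f holomorphic_on S" "open S" and "op_holomorphic G S" shows "op_holomorphic (\<lambda>z. f z *\<^sub>C G z) S"
  unfolding op_holomorphic_def
proof
  fix z assume z: "z \<in> S"
  obtain f' where "(f has_field_derivative f') (at z)"
    using f z by (meson field_differentiable_def holomorphic_on_imp_differentiable_at)
  then have f': "(f has_derivative (\<lambda>h. h * f')) (at z)"
    by (simp add: has_field_derivative_def mult_commute_abs)
  obtain G' where G': "(G has_derivative (\<lambda>h. h *\<^sub>C G')) (at z)" using assms(3) z by (auto simp: op_holomorphic_def)
  have "((\<lambda>z. f z *\<^sub>C G z) has_derivative (\<lambda>h. h *\<^sub>C (f z *\<^sub>C G' + f' *\<^sub>C G z))) (at z)"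
    using scaleC.FDERIV [OF f' G'] by (simp add: scaleC_add_right scaleC_scaleC mult.commute)
  then show "f z *\<^sub>C G z \<in> bounded_ops \<and> (\<exists>F'. ((\<lambda>z. f z *\<^sub>C G z) has_derivative (\<lambda>h. h *\<^sub>C F')) (at z))"
    using assms z by (auto simp: op_holomorphic_def intro: bounded_ops_scaleC)
qed

definition complex_functional :: "('a::complex_normed_vector \<Rightarrow> complex) \<Rightarrow> bool"
  where "complex_functional l \<longleftrightarrow> bounded_linear l \<and> (\<forall>c v. l (c *\<^sub>C v) = c * l v)"

lemma op_holomorphic_functional:
  assumes l: "complex_functional l" and F: "op_holomorphic F S" and S: "open S"
  shows "(\<lambda>z. l (F z)) holomorphic_on S"
  unfolding holomorphic_on_def
proof
  fix z assume z: "z \<in> S"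
  obtain F' where F': "(F has_derivative (\<lambda>h. h *\<^sub>C F')) (at z)" using F z by (auto simp: op_holomorphic_def)
  have "((\<lambda>z. l (F z)) has_derivative (\<lambda>h. l (h *\<^sub>C F'))) (at z)"
    using l F' bounded_linear.has_derivative [of l F _ "at z"] unfolding complex_functional_def by blast
  then have "((\<lambda>z. l (F z)) has_field_derivative l F') (at z)"
    using l by (simp add: has_field_derivative_def complex_functional_def mult_commute_abs)
  then show "(\<lambda>z. l (F z)) field_differentiable at z within S"
    by (meson field_differentiable_at_within field_differentiable_def)
qed

lemma op_inverse_difference:
  assumes U: "is_op_inverse (u *\<^sub>C id_blinfun - A) U" and V: "is_op_inverse (v *\<^sub>C id_blinfun - A) V"
    and ops: "A \<in> bounded_ops"
  shows "U - V = (v - u) *\<^sub>C (U o\<^sub>L V)"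
proof -
  have Uo: "U \<in> bounded_ops"
    by (rule bounded_ops_inverse [OF _ U])
       (use ops in \<open>simp add: bounded_ops_def blinfun.diff_left blinfun_apply_scaleC scaleC.diff_right
          scaleC_scaleC mult.commute\<close>)
  have "U - V = (U o\<^sub>L ((v *\<^sub>C id_blinfun - A) o\<^sub>L V)) - ((U o\<^sub>L (u *\<^sub>C id_blinfun - A)) o\<^sub>L V)"
    using U V by (simp add: is_op_inverse_def)
  also have "\<dots> = (v - u) *\<^sub>C (U o\<^sub>L V)"
    by (simp add: opcomp_assoc opcomp.diff_left opcomp.diff_right scaleC_opcomp opcomp_scaleC Uo
        scaleC.diff_left)
  finally show ?thesis .
qed

lemma continuous_on_op_inverse:
  assumes U: "\<And>z. z \<in> S \<Longrightarrow> is_op_inverse (z *\<^sub>C id_blinfun - A) (U z)" and A: "A \<in> bounded_ops"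
    and bd: "\<And>z. z \<in> S \<Longrightarrow> \<exists>e>0. \<exists>B. \<forall>w\<in>S. dist w z < e \<longrightarrow> norm (U w) \<le> B"
  shows "continuous_on S U"
  unfolding continuous_on_def
proof
  fix z assume z: "z \<in> S"
  obtain e B where e: "e > 0" and B: "\<And>w. w \<in> S \<Longrightarrow> dist w z < e \<Longrightarrow> norm (U w) \<le> B" using bd [OF z] by blast
  have B0: "B \<ge> 0" using order_trans [OF norm_ge_zero B [OF z]] e by simp
  have "norm (U w - U z) \<le> cmod (z - w) * (B * B)" if "w \<in> S" "dist w z < e" for w
    unfolding op_inverse_difference [OF U [OF that(1)] U [OF z] A] norm_scaleC
    using B [OF that] B [OF z] e by (intro mult_left_mono norm_opcomp_le) auto
  then have ev: "\<forall>\<^sub>F w in at z within S. norm (U w - U z) \<le> cmod (z - w) * (B * B)"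
    unfolding eventually_at using e by (intro exI [of _ e]) auto
  have "((\<lambda>w. cmod (z - w) * (B * B)) \<longlongrightarrow> cmod (z - z) * (B * B)) (at z within S)"
    by (intro tendsto_intros)
  then have "((\<lambda>w. cmod (z - w) * (B * B)) \<longlongrightarrow> 0) (at z within S)" by simp
  then have "((\<lambda>w. U w - U z) \<longlongrightarrow> 0) (at z within S)"
    by (rule Lim_null_comparison [OF ev])
  then show "(U \<longlongrightarrow> U z) (at z within S)" by (rule LIM_zero_cancel)
qed

lemma op_holomorphic_inverse:
  assumes S: "open S"
    and U: "\<And>z. z \<in> S \<Longrightarrow> is_op_inverse (z *\<^sub>C id_blinfun - A) (U z)" and A: "A \<in> bounded_ops"
    and bd: "\<And>z. z \<in> S \<Longrightarrow> \<exists>e>0. \<exists>B. \<forall>w\<in>S. dist w z < e \<longrightarrow> norm (U w) \<le> B"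
  shows "op_holomorphic U S"
  unfolding op_holomorphic_def
proof
  fix z assume z: "z \<in> S"
  have Uo: "U w \<in> bounded_ops" if "w \<in> S" for w
    by (rule bounded_ops_inverse [OF _ U [OF that]])
       (use A in \<open>simp add: bounded_ops_def blinfun.diff_left blinfun_apply_scaleC scaleC.diff_right
          scaleC_scaleC mult.commute\<close>)
  have "continuous_on S U" by (rule continuous_on_op_inverse [OF U A bd])
  then have cU: "(U \<longlongrightarrow> U z) (at z)"
    using z S by (simp add: continuous_on_eq_continuous_at continuous_at)
  have ev: "\<forall>\<^sub>F w in at z. w \<in> S" using z S by (simp add: eventually_at_in_open')
  have "(U has_derivative (\<lambda>h. h *\<^sub>C (- (U z o\<^sub>L U z)))) (at z)"
    unfolding has_derivative_at_within
  proof
    show "bounded_linear (\<lambda>h. h *\<^sub>C (- (U z o\<^sub>L U z)))" by (rule scaleC.bounded_linear_left)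
    have "((\<lambda>w. norm ((U z o\<^sub>L U z) - (U w o\<^sub>L U z))) \<longlongrightarrow> norm ((U z o\<^sub>L U z) - (U z o\<^sub>L U z))) (at z)"
      by (intro tendsto_norm tendsto_diff opcomp.tendsto cU tendsto_const)
    then have lim0: "((\<lambda>w. norm ((U z o\<^sub>L U z) - (U w o\<^sub>L U z))) \<longlongrightarrow> 0) (at z)" by simp
    have "\<forall>\<^sub>F w in at z. norm ((U w - U z - (w - z) *\<^sub>C (- (U z o\<^sub>L U z))) /\<^sub>R norm (w - z))
        \<le> norm ((U z o\<^sub>L U z) - (U w o\<^sub>L U z))"
      using ev
    proof eventually_elim
      case (elim w)
      have "U w - U z - (w - z) *\<^sub>C (- (U z o\<^sub>L U z)) = (w - z) *\<^sub>C ((U z o\<^sub>L U z) - (U w o\<^sub>L U z))"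
        unfolding op_inverse_difference [OF U [OF elim] U [OF z] A]
        by (simp add: scaleC.diff_right scaleC.minus_right scaleC.diff_left algebra_simps)
      then show ?case by (simp add: norm_scaleC divide_simps)
    qed
    then show "((\<lambda>w. (U w - U z - (w - z) *\<^sub>C (- (U z o\<^sub>L U z))) /\<^sub>R norm (w - z)) \<longlongrightarrow> 0) (at z)"
      by (rule Lim_null_comparison [OF _ lim0])
  qed
  then show "U z \<in> bounded_ops \<and> (\<exists>F'. (U has_derivative (\<lambda>h. h *\<^sub>C F')) (at z))"
    using Uo [OF z] by blast
qed

section \<open>Functions of the tuple that are limits of polynomials\<close>

lemma poly_eval_superset:
  assumes "finite A" "Poly_Mapping.keys h \<subseteq> A"
  shows "poly_eval h z = (\<Sum>m\<in>A. Poly_Mapping.lookup h m * (\<Prod>i\<in>UNIV. (z $ i) ^ Poly_Mapping.lookup m i))"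
  unfolding poly_eval_def using assms by (intro sum.mono_neutral_left) (auto simp: in_keys_iff)

lemma poly_op_superset:
  assumes "finite A" "Poly_Mapping.keys h \<subseteq> A"
  shows "poly_op h T = (\<Sum>m\<in>A. Poly_Mapping.lookup h m *\<^sub>C op_prod (\<lambda>i. op_power (T i) (Poly_Mapping.lookup m i)) UNIV)"
  unfolding poly_op_def using assms by (intro sum.mono_neutral_left) (auto simp: in_keys_iff scaleC.zero_left)

lemma poly_eval_add: "poly_eval (h + g) z = poly_eval h z + poly_eval g z"
  using poly_eval_superset [of "Poly_Mapping.keys h \<union> Poly_Mapping.keys g" h z]
    poly_eval_superset [of "Poly_Mapping.keys h \<union> Poly_Mapping.keys g" g z]
    poly_eval_superset [of "Poly_Mapping.keys h \<union> Poly_Mapping.keys g" "h + g" z]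
    Poly_Mapping.keys_add [of h g]
  by (simp add: lookup_add distrib_right sum.distrib)

lemma poly_op_add: "poly_op (h + g) T = poly_op h T + poly_op g T"
  using poly_op_superset [of "Poly_Mapping.keys h \<union> Poly_Mapping.keys g" h T]
    poly_op_superset [of "Poly_Mapping.keys h \<union> Poly_Mapping.keys g" g T]
    poly_op_superset [of "Poly_Mapping.keys h \<union> Poly_Mapping.keys g" "h + g" T]
    Poly_Mapping.keys_add [of h g]
  by (simp add: lookup_add scaleC_add_left sum.distrib)

lemma poly_eval_zero [simp]: "poly_eval 0 z = 0"
  by (simp add: poly_eval_def)

lemma poly_op_zero [simp]: "poly_op 0 T = 0"
  by (simp add: poly_op_def)

lemma poly_eval_sum: "poly_eval (sum h I) z = (\<Sum>i\<in>I. poly_eval (h i) z)"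
  by (induction I rule: infinite_finite_induct) (simp_all add: poly_eval_add)

lemma poly_op_sum: "poly_op (sum h I) T = (\<Sum>i\<in>I. poly_op (h i) T)"
  by (induction I rule: infinite_finite_induct) (simp_all add: poly_op_add)

lemma poly_eval_single: "poly_eval (Poly_Mapping.single m c) z = c * (\<Prod>i\<in>UNIV. (z $ i) ^ Poly_Mapping.lookup m i)"
  using poly_eval_superset [of "{m}" "Poly_Mapping.single m c" z] by simp

lemma poly_op_single:
  "poly_op (Poly_Mapping.single m c) T = c *\<^sub>C op_prod (\<lambda>i. op_power (T i) (Poly_Mapping.lookup m i)) UNIV"
  using poly_op_superset [of "{m}" "Poly_Mapping.single m c" T] by simp

lemma poly_mapping_sum_singles:
  fixes h :: "'k \<Rightarrow>\<^sub>0 'b::comm_monoid_add"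
  shows "h = (\<Sum>a\<in>Poly_Mapping.keys h. Poly_Mapping.single a (Poly_Mapping.lookup h a))"
proof (rule poly_mapping_eqI)
  fix k
  have "(\<Sum>a\<in>Poly_Mapping.keys h. if k = a then Poly_Mapping.lookup h a else 0) = Poly_Mapping.lookup h k"
    by (simp add: in_keys_iff)
  then show "Poly_Mapping.lookup h k
      = Poly_Mapping.lookup (\<Sum>a\<in>Poly_Mapping.keys h. Poly_Mapping.single a (Poly_Mapping.lookup h a)) k"
    by (simp add: lookup_sum lookup_single when_def eq_commute [of _ k] del: sum.delta sum.delta')
qed

lemma times_as_sum_singles:
  fixes h g :: "('k::monoid_add \<Rightarrow>\<^sub>0 'b::semiring_0)"
  shows "h * g = (\<Sum>a\<in>Poly_Mapping.keys h. \<Sum>b\<in>Poly_Mapping.keys g.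
    Poly_Mapping.single (a + b) (Poly_Mapping.lookup h a * Poly_Mapping.lookup g b))"
proof -
  have "h * g = (\<Sum>a\<in>Poly_Mapping.keys h. Poly_Mapping.single a (Poly_Mapping.lookup h a))
     * (\<Sum>b\<in>Poly_Mapping.keys g. Poly_Mapping.single b (Poly_Mapping.lookup g b))"
    using poly_mapping_sum_singles [of h] poly_mapping_sum_singles [of g] by simp
  then show ?thesis
    by (simp add: sum_product mult_single)
qed

lemma poly_eval_mult: "poly_eval (h * g) z = poly_eval h z * poly_eval g z"
  unfolding times_as_sum_singles poly_eval_sum poly_eval_single
  unfolding poly_eval_def sum_product
  by (intro sum.cong refl) (simp add: lookup_add power_add prod.distrib)

context commuting_family
begin

lemma op_prod_power_A: "op_prod (\<lambda>i. op_power (T i) (k i)) \<Lambda> \<in> \<A>"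
  by (intro op_prod_A bicommutant_power gen_A)

lemma op_prod_id:
  fixes S :: "'n \<Rightarrow> 'x \<Rightarrow>\<^sub>L 'x" and \<Lambda> :: "'n set"
  assumes "\<And>i. i \<in> \<Lambda> \<Longrightarrow> S i = id_blinfun"
  shows "op_prod S \<Lambda> = id_blinfun"
  using finite [of \<Lambda>] assms
proof (induction \<Lambda> rule: finite_induct)
  case (insert j F)
  have "op_prod S (insert j F) = S j o\<^sub>L op_prod S F"
    by (rule op_prod_insert) (use insert in auto)
  then show ?case using insert by simp
qed auto

lemma poly_op_mult: "poly_op (h * g) T = poly_op h T o\<^sub>L poly_op g T"
proof -
  let ?P = "\<lambda>m. op_prod (\<lambda>i. op_power (T i) (Poly_Mapping.lookup m i)) UNIV"
  have P: "?P (a + b) = ?P a o\<^sub>L ?P b" for a b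
    unfolding lookup_add op_power_add by (intro op_prod_comp bicommutant_power gen_A)
  have PA: "?P a \<in> bounded_ops" for a
    using op_prod_power_A by (rule bicommutant_bounded_ops)
  have "poly_op h T o\<^sub>L poly_op g T = (\<Sum>a\<in>Poly_Mapping.keys h. \<Sum>b\<in>Poly_Mapping.keys g.
      (Poly_Mapping.lookup h a * Poly_Mapping.lookup g b) *\<^sub>C (?P a o\<^sub>L ?P b))"
    unfolding poly_op_def opcomp.sum_left
    by (intro sum.cong refl) (simp add: opcomp.sum_right scaleC_opcomp opcomp_scaleC [OF PA] scaleC_scaleC)
  then show ?thesis
    by (simp only: times_as_sum_singles [of h g] poly_op_sum poly_op_single P)
qed

lemma poly_op_const: "poly_op (Poly_Mapping.single 0 c) T = c *\<^sub>C id_blinfun"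
  unfolding poly_op_single by (subst op_prod_id) auto

lemma poly_op_var: "poly_op (Poly_Mapping.single (Poly_Mapping.single k 1) 1) T = T k"
proof -
  let ?S = "\<lambda>i. op_power (T i) (Poly_Mapping.lookup (Poly_Mapping.single k 1) i)"
  have "op_prod ?S UNIV = op_prod ?S (insert k (UNIV - {k}))" by (simp add: insert_Diff insert_absorb)
  also have "\<dots> = ?S k o\<^sub>L op_prod ?S (UNIV - {k})"
    by (rule op_prod_insert) (auto intro: bicommutant_power)
  also have "op_prod ?S (UNIV - {k}) = id_blinfun" by (rule op_prod_id) (auto simp: lookup_single)
  finally show ?thesis unfolding poly_op_single by simp
qed

definition torus :: "(complex ^ 'n) set"
  where "torus = {z. \<forall>i. cmod (z $ i) = 1}"

lemma poly_eval_const: "poly_eval (Poly_Mapping.single 0 c) z = c"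
  by (simp add: poly_eval_single)

lemma poly_eval_var: "poly_eval (Poly_Mapping.single (Poly_Mapping.single k 1) 1) z = z $ (k::'n)"
proof -
  have "(\<Prod>i\<in>UNIV. (z $ i) ^ Poly_Mapping.lookup (Poly_Mapping.single k 1) i) = (\<Prod>i\<in>UNIV. if i = k then z $ k else 1)"
    by (intro prod.cong) (auto simp: lookup_single)
  then show ?thesis by (simp add: poly_eval_single)
qed

lemma bounded_poly_eval: "bounded (poly_eval h ` torus)"
proof -
  have "cmod (poly_eval h z) \<le> (\<Sum>m\<in>Poly_Mapping.keys h. cmod (Poly_Mapping.lookup h m))" if "z \<in> torus" for z
    unfolding poly_eval_def using that
    by (intro sum_norm_le) (simp add: norm_mult prod_norm [symmetric] norm_power torus_def)
  then show ?thesis by (auto simp: bounded_iff)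
qed

text \<open>A pair of a function on the torus and an operator that can be approximated simultaneously by
  the same polynomials. Such pairs form an algebra, and the estimate for polynomials extends to
  them.\<close>

definition polynomial_limit :: "(complex ^ 'n \<Rightarrow> complex) \<Rightarrow> ('x \<Rightarrow>\<^sub>L 'x) \<Rightarrow> bool"
  where "polynomial_limit g V \<longleftrightarrow> (\<exists>h :: nat \<Rightarrow> (('n \<Rightarrow>\<^sub>0 nat) \<Rightarrow>\<^sub>0 complex).
    uniform_limit torus (\<lambda>n. poly_eval (h n)) g sequentially \<and> (\<lambda>n. poly_op (h n) T) \<longlonglongrightarrow> V)"

lemma polynomial_limit_poly: "polynomial_limit (poly_eval h) (poly_op h T)"
  unfolding polynomial_limit_def by (rule exI [of _ "\<lambda>_. h"]) (auto intro: uniform_limit_const)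

lemma polynomial_limit_const: "polynomial_limit (\<lambda>_. c) (c *\<^sub>C id_blinfun)"
  using polynomial_limit_poly [of "Poly_Mapping.single 0 c"]
  by (simp add: poly_op_const poly_eval_const [abs_def])

lemma polynomial_limit_add:
  assumes "polynomial_limit f V" "polynomial_limit g W"
  shows "polynomial_limit (\<lambda>z. f z + g z) (V + W)"
proof -
  obtain h k where h: "uniform_limit torus (\<lambda>n. poly_eval (h n)) f sequentially" "(\<lambda>n. poly_op (h n) T) \<longlonglongrightarrow> V"
    and k: "uniform_limit torus (\<lambda>n. poly_eval (k n)) g sequentially" "(\<lambda>n. poly_op (k n) T) \<longlonglongrightarrow> W"
    using assms unfolding polynomial_limit_def by blast
  have "poly_eval (h n + k n) = (\<lambda>z. poly_eval (h n) z + poly_eval (k n) z)" for n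
    by (simp add: fun_eq_iff poly_eval_add)
  then show ?thesis unfolding polynomial_limit_def
    using uniform_limit_add [OF h(1) k(1)] tendsto_add [OF h(2) k(2)]
    by (intro exI [of _ "\<lambda>n. h n + k n"]) (simp add: poly_op_add)
qed

lemma polynomial_limit_bounded:
  assumes "polynomial_limit f V" shows "bounded (f ` torus)"
proof -
  obtain h where h: "uniform_limit torus (\<lambda>n. poly_eval (h n)) f sequentially"
    using assms unfolding polynomial_limit_def by blast
  show ?thesis
    by (rule uniform_limit_bounded [OF h]) (auto simp: bounded_poly_eval intro!: always_eventually)
qed

lemma polynomial_limit_mult:
  assumes "polynomial_limit f V" "polynomial_limit g W"
  shows "polynomial_limit (\<lambda>z. f z * g z) (V o\<^sub>L W)"
proof -
  obtain h k where h: "uniform_limit torus (\<lambda>n. poly_eval (h n)) f sequentially" "(\<lambda>n. poly_op (h n) T) \<longlonglongrightarrow> V"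
    and k: "uniform_limit torus (\<lambda>n. poly_eval (k n)) g sequentially" "(\<lambda>n. poly_op (k n) T) \<longlonglongrightarrow> W"
    using assms unfolding polynomial_limit_def by blast
  have "uniform_limit torus (\<lambda>n z. poly_eval (h n) z * poly_eval (k n) z) (\<lambda>z. f z * g z) sequentially"
    by (intro uniform_lim_mult h k polynomial_limit_bounded [OF assms(1)] polynomial_limit_bounded [OF assms(2)])
  moreover have "poly_eval (h n * k n) = (\<lambda>z. poly_eval (h n) z * poly_eval (k n) z)" for n
    by (simp add: fun_eq_iff poly_eval_mult)
  ultimately show ?thesis unfolding polynomial_limit_def
    using opcomp.tendsto [OF h(2) k(2)]
    by (intro exI [of _ "\<lambda>n. h n * k n"]) (simp add: poly_op_mult)
qed

lemma polynomial_limit_scaleC: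
  assumes "polynomial_limit f V" shows "polynomial_limit (\<lambda>z. c * f z) (c *\<^sub>C V)"
  using polynomial_limit_mult [OF polynomial_limit_const assms, of c] by (simp add: scaleC_opcomp)

lemma polynomial_limit_sum:
  assumes "\<And>j. j \<in> J \<Longrightarrow> polynomial_limit (f j) (V j)"
  shows "polynomial_limit (\<lambda>z. \<Sum>j\<in>J. f j z) (\<Sum>j\<in>J. V j)"
  using assms polynomial_limit_const [of 0]
  by (induction J rule: infinite_finite_induct) (auto simp: scaleC.zero_left intro: polynomial_limit_add)

lemma polynomial_limit_op_prod:
  fixes \<Lambda> :: "'n set"
  assumes "\<And>i. i \<in> \<Lambda> \<Longrightarrow> polynomial_limit (f i) (V i)" "\<And>i. i \<in> \<Lambda> \<Longrightarrow> V i \<in> \<A>"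
  shows "polynomial_limit (\<lambda>z. \<Prod>i\<in>\<Lambda>. f i z) (op_prod V \<Lambda>)"
  using finite [of \<Lambda>] assms
proof (induction \<Lambda> rule: finite_induct)
  case empty
  then show ?case using polynomial_limit_const [of 1] by simp
next
  case (insert j F)
  have "op_prod V (insert j F) = V j o\<^sub>L op_prod V F"
    by (rule op_prod_insert) (use insert in auto)
  then show ?case using insert by (simp add: polynomial_limit_mult)
qed

lemma poly_op_power_term:
  "poly_op (Poly_Mapping.single 0 c * Poly_Mapping.single (Poly_Mapping.single k 1) 1 ^ n) T = c *\<^sub>C op_power (T k) n"
  and poly_eval_power_term:
  "poly_eval (Poly_Mapping.single 0 c * Poly_Mapping.single (Poly_Mapping.single k 1) 1 ^ n) z = c * (z $ k) ^ n"
proof -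
  have one: "(1 :: ('n \<Rightarrow>\<^sub>0 nat) \<Rightarrow>\<^sub>0 complex) = Poly_Mapping.single 0 1" by simp
  have "poly_op (Poly_Mapping.single (Poly_Mapping.single k 1) 1 ^ n) T = op_power (T k) n"
  proof (induction n)
    case 0 show ?case unfolding power_0 one poly_op_const by simp
  qed (simp add: poly_op_mult poly_op_var [unfolded One_nat_def] op_power_Suc)
  then show "poly_op (Poly_Mapping.single 0 c * Poly_Mapping.single (Poly_Mapping.single k 1) 1 ^ n) T = c *\<^sub>C op_power (T k) n"
    by (simp add: poly_op_mult poly_op_const scaleC_opcomp)
  have "poly_eval (Poly_Mapping.single (Poly_Mapping.single k 1) 1 ^ n) z = (z $ k) ^ n"
  proof (induction n)
    case 0 show ?case unfolding power_0 one poly_eval_const by simp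
  qed (simp add: poly_eval_mult poly_eval_var [unfolded One_nat_def])
  then show "poly_eval (Poly_Mapping.single 0 c * Poly_Mapping.single (Poly_Mapping.single k 1) 1 ^ n) z = c * (z $ k) ^ n"
    by (simp add: poly_eval_mult poly_eval_const)
qed

text \<open>The geometric series converges uniformly on the torus, and it converges in norm for a power
  bounded operator.\<close>

lemma polynomial_limit_resolvent:
  assumes C: "\<And>n. norm (op_power (T k) n) \<le> C" and \<kappa>: "cmod \<kappa> > 1"
  shows "polynomial_limit (\<lambda>z. 1 / (\<kappa> - z $ k)) (resolvent \<kappa> (T k))"
proof -
  define h where "h N = (\<Sum>n<N. Poly_Mapping.single 0 (inverse (\<kappa> ^ Suc n)) * Poly_Mapping.single (Poly_Mapping.single k 1) 1 ^ n
    :: ('n \<Rightarrow>\<^sub>0 nat) \<Rightarrow>\<^sub>0 complex)" for N :: nat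
  have hop: "poly_op (h N) T = (\<Sum>n<N. inverse (\<kappa> ^ Suc n) *\<^sub>C op_power (T k) n)" for N
    unfolding h_def poly_op_sum poly_op_power_term ..
  have hev: "poly_eval (h N) z = (\<Sum>n<N. inverse (\<kappa> ^ Suc n) * (z $ k) ^ n)" for N z
    unfolding h_def poly_eval_sum poly_eval_power_term ..
  have "(\<lambda>N. poly_op (h N) T) \<longlonglongrightarrow> resolvent \<kappa> (T k)"
    using power_bounded_resolvent(3) [OF T_ops C \<kappa>] unfolding hop sums_def .
  moreover have "uniform_limit torus (\<lambda>N. poly_eval (h N)) (\<lambda>z. 1 / (\<kappa> - z $ k)) sequentially"
  proof -
    have "uniform_limit torus (\<lambda>N z. \<Sum>n<N. inverse (\<kappa> ^ Suc n) * (z $ k) ^ n)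
        (\<lambda>z. suminf (\<lambda>n. inverse (\<kappa> ^ Suc n) * (z $ k) ^ n)) sequentially"
    proof (rule Weierstrass_m_test)
      show "norm (inverse (\<kappa> ^ Suc n) * (z $ k) ^ n) \<le> inverse (cmod \<kappa>) * inverse (cmod \<kappa>) ^ n" if "z \<in> torus" for n z
        using that by (simp add: torus_def norm_mult norm_inverse norm_power power_inverse)
      show "summable (\<lambda>n. inverse (cmod \<kappa>) * inverse (cmod \<kappa>) ^ n)"
        using \<kappa> by (intro summable_mult summable_geometric) (simp add: inverse_less_1_iff)
    qed
    moreover have "suminf (\<lambda>n. inverse (\<kappa> ^ Suc n) * (z $ k) ^ n) = 1 / (\<kappa> - z $ k)" if "z \<in> torus" for z
    proof -
      have k0: "\<kappa> \<noteq> 0" "\<kappa> \<noteq> z $ k" using \<kappa> that by (auto simp: torus_def)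
      have q: "cmod (z $ k / \<kappa>) < 1" using that \<kappa> by (simp add: torus_def norm_divide divide_less_eq)
      have "(\<lambda>n. inverse \<kappa> * (z $ k / \<kappa>) ^ n) sums (inverse \<kappa> * (1 / (1 - z $ k / \<kappa>)))"
        by (intro sums_mult geometric_sums q)
      moreover have "inverse \<kappa> * (z $ k / \<kappa>) ^ n = inverse (\<kappa> ^ Suc n) * (z $ k) ^ n" for n
        using k0 by (simp add: field_simps)
      moreover have "inverse \<kappa> * (1 / (1 - z $ k / \<kappa>)) = 1 / (\<kappa> - z $ k)"
        using k0 by (simp add: field_simps)
      ultimately show ?thesis by (simp add: sums_iff)
    qed
    ultimately show ?thesis
      unfolding hev [abs_def] by (subst uniform_limit_cong') auto
  qed
  ultimately show ?thesis unfolding polynomial_limit_def by blast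
qed

lemma polynomial_limit_norm_le:
  assumes pb: "\<And>h. norm (poly_op h T) \<le> C * (SUP z\<in>torus. cmod (poly_eval h z))" and C: "C \<ge> 0"
    and f: "polynomial_limit f V" and B: "\<And>z. z \<in> torus \<Longrightarrow> cmod (f z) \<le> B"
  shows "norm V \<le> C * B"
proof -
  obtain h where h: "uniform_limit torus (\<lambda>n. poly_eval (h n)) f sequentially" "(\<lambda>n. poly_op (h n) T) \<longlonglongrightarrow> V"
    using f unfolding polynomial_limit_def by blast
  have ne: "(\<chi> i. 1) \<in> torus" by (simp add: torus_def)
  have "norm V \<le> C * (B + e)" if e: "e > 0" for e
  proof (rule tendsto_upperbound [OF tendsto_norm [OF h(2)]])
    have "\<forall>\<^sub>F n in sequentially. \<forall>z\<in>torus. dist (poly_eval (h n) z) (f z) < e"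
      using h(1) e unfolding uniform_limit_iff by blast
    then show "\<forall>\<^sub>F n in sequentially. norm (poly_op (h n) T) \<le> C * (B + e)"
    proof eventually_elim
      case (elim n)
      have "(SUP z\<in>torus. cmod (poly_eval (h n) z)) \<le> B + e"
      proof (rule cSUP_least)
        show "cmod (poly_eval (h n) z) \<le> B + e" if z: "z \<in> torus" for z
          using elim z B [OF z] norm_triangle_sub [of "poly_eval (h n) z" "f z"]
          by (fastforce simp: dist_norm)
      qed (use ne in auto)
      then show ?case using order_trans [OF pb mult_left_mono [OF _ C]] by blast
    qed
  qed simp
  then have "norm V \<le> C * B + e" if e: "e > 0" for e
  proof -
    have "norm V \<le> C * (B + e / (C + 1))" using e C \<open>\<And>e. e > 0 \<Longrightarrow> norm V \<le> C * (B + e)\<close> by simp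
    also have "\<dots> = C * B + e * (C / (C + 1))" by (simp add: algebra_simps)
    also have "\<dots> \<le> C * B + e * 1" using e C by (intro add_left_mono mult_left_mono) auto
    finally show ?thesis by simp
  qed
  then show ?thesis by (rule field_le_epsilon)
qed

end

section \<open>A telescoping bound for dyadic sums\<close>

text \<open>Up to a factor \<open>2\<close> the summand is the increment of \<open>x / (x + s)\<close> from \<open>x = 2\<^sup>-\<^sup>k\<^sup>-\<^sup>1\<close> to
  \<open>x = 2\<^sup>-\<^sup>k\<close>.\<close>

lemma dyadic_sum_le:
  assumes s: "s \<ge> (0::real)"
  shows "(\<Sum>k<N. (1/2)^k * s / ((1/2)^k + s)\<^sup>2) \<le> 2"
proof -
  define F where "F k = (1/2)^k / ((1/2)^k + s)" for k :: nat
  have "(1/2)^k * s / ((1/2)^k + s)\<^sup>2 \<le> 2 * (F k - F (Suc k))" for k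
  proof -
    define x :: real where "x = (1/2)^k"
    have x: "x > 0" by (simp add: x_def)
    have "2 * (F k - F (Suc k)) = x * s / ((x + s) * (x / 2 + s))"
    proof -
      have "x + s > 0" "x / 2 + s > 0" using x s by auto
      then have "2 * (x / (x + s) - (x / 2) / (x / 2 + s)) = x * s / ((x + s) * (x / 2 + s))"
        by (simp add: divide_simps) (simp add: algebra_simps)
      then show ?thesis by (simp add: F_def x_def)
    qed
    moreover have "x * s / ((x + s) * (x + s)) \<le> x * s / ((x + s) * (x / 2 + s))"
      using x s by (intro divide_left_mono mult_left_mono mult_pos_pos mult_nonneg_nonneg) auto
    ultimately show ?thesis by (simp add: x_def power2_eq_square)
  qed
  then have "(\<Sum>k<N. (1/2)^k * s / ((1/2)^k + s)\<^sup>2) \<le> (\<Sum>k<N. 2 * (F k - F (Suc k)))"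
    by (intro sum_mono)
  also have "\<dots> = 2 * (F 0 - F N)"
    unfolding sum_distrib_left [symmetric] by (simp add: sum_lessThan_telescope')
  also have "\<dots> \<le> 2"
  proof -
    have "F 0 \<le> 1" using s by (simp add: F_def)
    moreover have "F N \<ge> 0" using s by (simp add: F_def)
    ultimately show ?thesis by simp
  qed
  finally show ?thesis .
qed

section \<open>Regularizing kernels\<close>

text \<open>The data of all contour integrals: the constant \<open>C\<close> of polynomial boundedness, the R-bound
  \<open>D\<close> of the sets \<open>E\<^sub>k\<close> of operators \<open>(l - 1)R(l,T\<^sub>k)\<close>, and a lower bound \<open>c\<close> for the cosines of the
  contour angles. The final estimate depends on nothing else, so that it is uniform in the
  contours \<open>b\<close>.\<close>

locale stolz_calculus = commuting_family T
  for T :: "'n::finite \<Rightarrow> 'x::complex_banach \<Rightarrow>\<^sub>L 'x" +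
  fixes C D c :: real and E :: "'n \<Rightarrow> ('x \<Rightarrow>\<^sub>L 'x) set" and \<gamma> b :: "'n \<Rightarrow> real"
  assumes C: "C \<ge> 1" and power_bounded: "norm (op_power (T k) n) \<le> C"
    and poly_bounded: "norm (poly_op h T) \<le> C * (SUP z\<in>torus. cmod (poly_eval h z))"
    and rad_E: "rad_bounded D (E k)"
    and angles: "0 < b k" "b k < \<gamma> k" "\<gamma> k < pi / 2"
    and c: "0 < c" "c \<le> cos (b k)"
    and path_resolvent: "t \<in> {0<..<1} \<Longrightarrow>
        is_op_inverse (stolz_path (b k) t *\<^sub>C id_blinfun - T k) (resolvent (stolz_path (b k) t) (T k)) \<and>
        (stolz_path (b k) t - 1) *\<^sub>C resolvent (stolz_path (b k) t) (T k) \<in> E k"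
begin

lemma c_le_1: "c \<le> 1"
  using c(2) cos_le_one order_trans by blast

lemma D_nonneg: "D \<ge> 0"
  using rad_E by (auto simp: rad_bounded_def)

lemma b_less: "b k < pi / 2"
  using angles(2,3) [of k] by linarith

text \<open>The resolvent at the reflection \<open>2 - l\<close> of \<open>l\<close> in \<open>1\<close>, which lies outside the closed unit
  disc if \<open>Re l < 1\<close>.\<close>

definition Q :: "'n \<Rightarrow> complex \<Rightarrow> 'x \<Rightarrow>\<^sub>L 'x"
  where "Q k l = resolvent (2 - l) (T k)"

text \<open>With \<open>\<mu> = 1 - l\<close> and \<open>\<sigma> = 1 - T\<close>, the operators below are \<open>P = (\<sigma> - \<mu>) / (\<sigma> + \<mu>)\<close>,
  \<open>\<phi> = 1 - P\<^sup>2 = 4\<mu>\<sigma> / (\<sigma> + \<mu>)\<^sup>2\<close> and \<open>H = (2P - P\<^sup>3) / (\<sigma> + \<mu>)\<close>.\<close>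

definition P :: "'n \<Rightarrow> complex \<Rightarrow> 'x \<Rightarrow>\<^sub>L 'x"
  where "P k l = id_blinfun - (2 * (1 - l)) *\<^sub>C Q k l"

definition \<phi> :: "'n \<Rightarrow> complex \<Rightarrow> 'x \<Rightarrow>\<^sub>L 'x"
  where "\<phi> k l = id_blinfun - (P k l o\<^sub>L P k l)"

definition H :: "'n \<Rightarrow> complex \<Rightarrow> 'x \<Rightarrow>\<^sub>L 'x"
  where "H k l = 2 *\<^sub>C (P k l o\<^sub>L Q k l) - (P k l o\<^sub>L (P k l o\<^sub>L (P k l o\<^sub>L Q k l)))"

abbreviation R :: "'n \<Rightarrow> complex \<Rightarrow> 'x \<Rightarrow>\<^sub>L 'x"
  where "R k l \<equiv> resolvent l (T k)"

lemma outside_disc: assumes "Re l < 1" shows "cmod (2 - l) > 1" "Re (1 - l) \<le> cmod (2 - l) - 1"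
  using assms complex_Re_le_cmod [of "2 - l"] by auto

lemma Q_inverse: assumes "Re l < 1" shows "is_op_inverse ((2 - l) *\<^sub>C id_blinfun - T k) (Q k l)"
  unfolding Q_def by (rule power_bounded_resolvent(1) [OF T_ops power_bounded outside_disc(1) [OF assms]])

lemma norm_Q: assumes "Re l < 1" shows "norm (Q k l) \<le> C / Re (1 - l)"
proof -
  have "norm (Q k l) \<le> C / (cmod (2 - l) - 1)"
    unfolding Q_def by (rule power_bounded_resolvent(2) [OF T_ops power_bounded outside_disc(1) [OF assms]])
  also have "\<dots> \<le> C / Re (1 - l)"
    using outside_disc [OF assms] assms C by (intro divide_left_mono mult_pos_pos) auto
  finally show ?thesis .
qed

lemma kernel_A:
  assumes "Re l < 1" shows "Q k l \<in> \<A>" "P k l \<in> \<A>" "\<phi> k l \<in> \<A>" "H k l \<in> \<A>"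
proof -
  show 1: "Q k l \<in> \<A>" by (rule bicommutant_inverse [OF _ Q_inverse [OF assms]]) (intro A_intros)
  show 2: "P k l \<in> \<A>" unfolding P_def by (intro A_intros 1)
  show "\<phi> k l \<in> \<A>" unfolding \<phi>_def by (intro A_intros 2)
  show "H k l \<in> \<A>" unfolding H_def by (intro A_intros 1 2)
qed

lemma norm_H_le:
  assumes "Re l < 1" and q: "q > 0" "q * cmod (1 - l) \<le> Re (1 - l)"
  shows "norm (H k l) \<le> (2 * (1 + 2 * C / q) + (1 + 2 * C / q) ^ 3) * C / q / cmod (1 - l)"
proof -
  have m: "cmod (1 - l) > 0" using assms(1) by auto
  define p where "p = 1 + 2 * C / q"
  have p: "p \<ge> 0" using C q by (simp add: p_def)
  have "norm (Q k l) \<le> C / Re (1 - l)" by (rule norm_Q [OF assms(1)])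
  also have "\<dots> \<le> C / (q * cmod (1 - l))"
    using assms m C by (intro divide_left_mono mult_pos_pos) auto
  finally have Q: "norm (Q k l) \<le> C / (q * cmod (1 - l))" .
  have "norm (P k l) \<le> norm (id_blinfun :: 'x \<Rightarrow>\<^sub>L 'x) + 2 * cmod (1 - l) * norm (Q k l)"
    unfolding P_def using norm_triangle_ineq4 [of "id_blinfun :: 'x \<Rightarrow>\<^sub>L 'x" "(2 * (1 - l)) *\<^sub>C Q k l"]
    by (simp only: norm_scaleC norm_mult norm_numeral)
  also have "\<dots> \<le> 1 + 2 * cmod (1 - l) * (C / (q * cmod (1 - l)))"
    by (intro add_mono mult_left_mono Q) (auto simp: norm_blinfun_id_le)
  also have "\<dots> = p" using m q by (simp add: p_def)
  finally have P: "norm (P k l) \<le> p" .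
  define w where "w = C / (q * cmod (1 - l))"
  have "norm (H k l) \<le> norm (2 *\<^sub>C (P k l o\<^sub>L Q k l)) + norm (P k l o\<^sub>L (P k l o\<^sub>L (P k l o\<^sub>L Q k l)))"
    unfolding H_def by (rule norm_triangle_ineq4)
  also have "\<dots> \<le> 2 * (p * w) + p * (p * (p * w))"
  proof (rule add_mono)
    have Qw: "norm (Q k l) \<le> w" using Q by (simp add: w_def)
    show "norm (2 *\<^sub>C (P k l o\<^sub>L Q k l)) \<le> 2 * (p * w)"
      using norm_opcomp_le [OF P Qw] by (simp add: norm_scaleC)
    show "norm (P k l o\<^sub>L (P k l o\<^sub>L (P k l o\<^sub>L Q k l))) \<le> p * (p * (p * w))"
      by (intro norm_opcomp_le P Qw)
  qed
  also have "\<dots> = (2 * p + p ^ 3) * C / q / cmod (1 - l)"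
    by (simp add: w_def power3_eq_cube algebra_simps add_divide_distrib)
  finally show "norm (H k l) \<le> (2 * (1 + 2 * C / q) + (1 + 2 * C / q) ^ 3) * C / q / cmod (1 - l)"
    by (simp add: p_def)
qed

text \<open>The resolvent is \<open>1 / (\<sigma> - \<mu>)\<close>, so \<open>P R = Q\<close>: the factor \<open>P\<close> cancels the pole. Expanding
  \<open>\<phi>\<^sup>2 = 1 - 2P\<^sup>2 + P\<^sup>4\<close>, every term but the first contains such a factor.\<close>

lemma resolvent_decomposition:
  assumes l: "Re l < 1" and R: "is_op_inverse (l *\<^sub>C id_blinfun - T k) (R k l)"
  shows "R k l = (\<phi> k l o\<^sub>L (\<phi> k l o\<^sub>L R k l)) + H k l"
proof -
  have "Q k l - R k l = (l - (2 - l)) *\<^sub>C (Q k l o\<^sub>L R k l)"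
    by (rule op_inverse_difference [OF Q_inverse [OF l] R T_ops])
  moreover have "l - (2 - l) = - (2 * (1 - l))" by simp
  ultimately have "(2 * (1 - l)) *\<^sub>C (Q k l o\<^sub>L R k l) = R k l - Q k l"
    by (metis minus_diff_eq minus_minus scaleC.minus_left)
  then have PR: "P k l o\<^sub>L R k l = Q k l"
    by (simp only: P_def opcomp.diff_left scaleC_opcomp opcomp_id) simp
  let ?P = "P k l"
  have "\<phi> k l o\<^sub>L R k l = R k l - (?P o\<^sub>L Q k l)"
    by (simp add: \<phi>_def opcomp.diff_left opcomp_assoc PR)
  then have "\<phi> k l o\<^sub>L (\<phi> k l o\<^sub>L R k l) = R k l - (?P o\<^sub>L Q k l) - ((?P o\<^sub>L Q k l) - (?P o\<^sub>L (?P o\<^sub>L (?P o\<^sub>L Q k l))))"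
    by (simp add: \<phi>_def opcomp.diff_left opcomp.diff_right opcomp_assoc PR)
  moreover have "2 *\<^sub>C (?P o\<^sub>L Q k l) = (?P o\<^sub>L Q k l) + (?P o\<^sub>L Q k l)"
    by (metis one_add_one scaleC_add_left scaleC_one)
  ultimately show ?thesis by (simp add: H_def)
qed

lemma op_holomorphic_H: "op_holomorphic (H k) {l. Re l < 1}"
proof -
  let ?S = "{l. Re l < 1}"
  have o: "open ?S" by (rule open_halfspace_Re_lt)
  have "op_holomorphic (\<lambda>l. - Q k l) ?S"
  proof (rule op_holomorphic_inverse [OF o])
    show "is_op_inverse (l *\<^sub>C id_blinfun - (2 *\<^sub>C id_blinfun - T k)) (- Q k l)" if "l \<in> ?S" for l
    proof -
      have "l *\<^sub>C id_blinfun - (2 *\<^sub>C id_blinfun - T k) = - ((2 - l) *\<^sub>C id_blinfun - T k)"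
        by (simp add: scaleC.diff_left)
      moreover have "is_op_inverse ((2 - l) *\<^sub>C id_blinfun - T k) (Q k l)" using that Q_inverse by simp
      ultimately show ?thesis
        by (simp only: is_op_inverse_def opcomp.minus_left opcomp.minus_right minus_minus)
    qed
    show "2 *\<^sub>C id_blinfun - T k \<in> bounded_ops"
      by (intro bicommutant_bounded_ops [of _ T] A_intros)
    show "\<exists>e>0. \<exists>B. \<forall>w\<in>?S. dist w l < e \<longrightarrow> norm (- Q k w) \<le> B" if l: "l \<in> ?S" for l
    proof (intro exI conjI ballI impI)
      show "(1 - Re l) / 2 > 0" using l by simp
      fix w assume w: "w \<in> ?S" "dist w l < (1 - Re l) / 2"
      have "Re w - Re l \<le> cmod (w - l)" using complex_Re_le_cmod [of "w - l"] by simp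
      then have "Re (1 - w) \<ge> (1 - Re l) / 2" using w by (simp add: dist_norm)
      then have "C / Re (1 - w) \<le> C / ((1 - Re l) / 2)"
        using l w C by (intro divide_left_mono mult_pos_pos) auto
      then show "norm (- Q k w) \<le> C / ((1 - Re l) / 2)"
        using norm_Q [of w k] w by simp
    qed
  qed
  from op_holomorphic_scaleC [OF holomorphic_on_const [of "-1"] o this]
  have Q: "op_holomorphic (Q k) ?S" by (simp add: scaleC.minus_left scaleC.minus_right)
  have P: "op_holomorphic (P k) ?S"
  proof -
    have "op_holomorphic (\<lambda>l. id_blinfun + (- (2 * (1 - l))) *\<^sub>C Q k l) ?S"
      by (intro op_holomorphic_add op_holomorphic_const op_holomorphic_scaleC o Q holomorphic_intros bounded_ops_id)
    then show ?thesis by (simp only: P_def [abs_def] scaleC.minus_left add_uminus_conv_diff)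
  qed
  have "op_holomorphic (\<lambda>l. 2 *\<^sub>C (P k l o\<^sub>L Q k l) + (-1) *\<^sub>C (P k l o\<^sub>L (P k l o\<^sub>L (P k l o\<^sub>L Q k l)))) ?S"
    by (intro op_holomorphic_add op_holomorphic_comp op_holomorphic_scaleC o P Q holomorphic_intros)
  then show ?thesis by (simp only: H_def [abs_def] scaleC.minus_left scaleC_one add_uminus_conv_diff)
qed

text \<open>The scalar function of which \<open>\<phi>\<close> is the value at \<open>T\<^sub>k\<close>.\<close>

definition \<phi>s :: "complex \<Rightarrow> complex \<Rightarrow> complex"
  where "\<phi>s l z = 1 - (1 - 2 * (1 - l) / (2 - l - z))\<^sup>2"

lemma polynomial_limit_\<phi>:
  assumes l: "Re l < 1" shows "polynomial_limit (\<lambda>z. \<phi>s l (z $ k)) (\<phi> k l)"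
proof -
  have Q: "polynomial_limit (\<lambda>z. 1 / (2 - l - z $ k)) (Q k l)"
    unfolding Q_def by (rule polynomial_limit_resolvent [OF power_bounded outside_disc(1) [OF l]])
  have "polynomial_limit (\<lambda>z. 1 + (- (2 * (1 - l))) * (1 / (2 - l - z $ k))) (1 *\<^sub>C id_blinfun + (- (2 * (1 - l))) *\<^sub>C Q k l)"
    by (intro polynomial_limit_add polynomial_limit_const polynomial_limit_scaleC Q)
  note that = this
  have P: "polynomial_limit (\<lambda>z. 1 - 2 * (1 - l) / (2 - l - z $ k)) (P k l)"
  proof -
    have "(\<lambda>z. 1 + (- (2 * (1 - l))) * (1 / (2 - l - z $ k))) = (\<lambda>z. 1 - 2 * (1 - l) / (2 - l - z $ k))"
      by (simp only: fun_eq_iff times_divide_eq_right mult_1_right divide_minus_left add_uminus_conv_diff simp_thms)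
    moreover have "1 *\<^sub>C id_blinfun + (- (2 * (1 - l))) *\<^sub>C Q k l = P k l"
      by (simp only: P_def scaleC.minus_left scaleC_one add_uminus_conv_diff)
    ultimately show ?thesis using that by metis
  qed
  have "polynomial_limit (\<lambda>z. 1 + (-1) * ((1 - 2 * (1 - l) / (2 - l - z $ k)) * (1 - 2 * (1 - l) / (2 - l - z $ k))))
      (1 *\<^sub>C id_blinfun + (-1) *\<^sub>C (P k l o\<^sub>L P k l))"
    by (intro polynomial_limit_add polynomial_limit_const polynomial_limit_scaleC polynomial_limit_mult P)
  then show ?thesis by (simp add: \<phi>s_def \<phi>_def scaleC.minus_left power2_eq_square)
qed

text \<open>The modulus of \<open>\<phi>\<close> is \<open>4\<bar>\<mu>\<sigma>\<bar> / \<bar>\<mu> + \<sigma>\<bar>\<^sup>2\<close> with \<open>\<mu> = 1 - l\<close>, \<open>\<sigma> = 1 - z\<close>. There is no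
  cancellation in the denominator: both numbers have nonnegative real part, and \<open>\<mu>\<close> stays away
  from the imaginary axis, so \<open>\<bar>\<mu> + \<sigma>\<bar>\<close> is comparable to \<open>\<bar>\<mu>\<bar> + \<bar>\<sigma>\<bar>\<close> and hence to \<open>x + \<bar>\<sigma>\<bar>\<close>.\<close>

lemma norm_\<phi>s_le:
  assumes x: "x > 0" and l: "c * (x / 4) \<le> cmod (1 - l)" "cmod (1 - l) \<le> 4 * x"
    and nt: "c\<^sup>2 / 4 * cmod (1 - l) \<le> Re (1 - l)" and z: "cmod z = 1"
  shows "cmod (\<phi>s l z) \<le> 16 * (36 / c ^ 3)\<^sup>2 * (x * cmod (1 - z) / (x + cmod (1 - z))\<^sup>2)"
proof -
  define m s where "m = 1 - l" and "s = 1 - z"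
  have cp: "0 < c" "c \<le> 1" using c c_le_1 by auto
  have m0: "cmod m > 0" 
  proof -
    have "0 < c * (x / 4)" using x cp by simp
    then show ?thesis using l(1) unfolding m_def by linarith
  qed
  have Re_s: "Re s \<ge> 0" using complex_Re_le_cmod [of z] z by (simp add: s_def)
  have c2: "c\<^sup>2 / 4 * cmod m \<le> cmod (m + s)"
    using nt Re_s complex_Re_le_cmod [of "m + s"] by (simp add: m_def)
  have ms0: "cmod (m + s) > 0" using c2 m0 cp by (smt (verit) mult_pos_pos zero_less_power divide_pos_pos)
  have "cmod m \<le> 4 / c\<^sup>2 * cmod (m + s)" using c2 cp by (simp add: field_simps)
  moreover have "cmod s \<le> cmod (m + s) + cmod m" using norm_triangle_ineq4 [of "m + s" m] by simp
  moreover have "(1 + 8 / c\<^sup>2) * cmod (m + s) = cmod (m + s) + 2 * (4 / c\<^sup>2 * cmod (m + s))"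
    by (simp add: distrib_right)
  ultimately have "cmod m + cmod s \<le> (1 + 8 / c\<^sup>2) * cmod (m + s)" by linarith
  also have "\<dots> \<le> 9 / c\<^sup>2 * cmod (m + s)"
  proof (rule mult_right_mono)
    have "c\<^sup>2 \<le> 1" using cp by (simp add: power_le_one)
    then have "1 \<le> 1 / c\<^sup>2" using cp by simp
    moreover have "9 / c\<^sup>2 = 1 / c\<^sup>2 + 8 / c\<^sup>2" by (simp add: add_divide_distrib [symmetric])
    ultimately show "1 + 8 / c\<^sup>2 \<le> 9 / c\<^sup>2" by linarith
  qed simp
  finally have 1: "cmod m + cmod s \<le> 9 / c\<^sup>2 * cmod (m + s)" .
  have "x \<le> 4 / c * cmod m" using l cp by (simp add: m_def field_simps)
  moreover have "1 * cmod s \<le> 4 / c * cmod s" using cp by (intro mult_right_mono) (auto simp: field_simps)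
  ultimately have "x + cmod s \<le> 4 / c * (cmod m + cmod s)" unfolding distrib_left by linarith
  also have "\<dots> \<le> 4 / c * (9 / c\<^sup>2 * cmod (m + s))" using 1 cp by (intro mult_left_mono) auto
  also have "\<dots> = 36 / c ^ 3 * cmod (m + s)" by (simp add: power2_eq_square power3_eq_cube)
  finally have 2: "x + cmod s \<le> 36 / c ^ 3 * cmod (m + s)" .
  have "\<phi>s l z = 4 * m * s / (m + s)\<^sup>2"
  proof -
    have d: "2 - l - z = m + s" "m + s \<noteq> 0" using ms0 by (auto simp: m_def s_def)
    have "1 - (1 - 2 * m / (m + s))\<^sup>2 = 4 * m * s / (m + s)\<^sup>2"
      using d(2) by (simp add: divide_simps power2_eq_square) (simp add: algebra_simps)
    then show ?thesis by (simp add: \<phi>s_def d(1)) (simp add: m_def)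
  qed
  then have "cmod (\<phi>s l z) = 4 * cmod m * cmod s / (cmod (m + s))\<^sup>2"
    by (simp add: norm_divide norm_mult norm_power)
  also have "\<dots> \<le> 4 * (4 * x) * cmod s / (cmod (m + s))\<^sup>2"
    using l by (intro divide_right_mono mult_right_mono mult_left_mono) (auto simp: m_def)
  also have "\<dots> \<le> 4 * (4 * x) * cmod s * ((36 / c ^ 3)\<^sup>2 / (x + cmod s)\<^sup>2)"
  proof -
    have "(x + cmod s)\<^sup>2 \<le> (36 / c ^ 3 * cmod (m + s))\<^sup>2"
      using 2 x by (intro power_mono) auto
    then have "1 * (x + cmod s)\<^sup>2 \<le> (36 / c ^ 3)\<^sup>2 * (cmod (m + s))\<^sup>2"
      by (simp only: power_mult_distrib mult_1)
    moreover have "(x + cmod s)\<^sup>2 > 0" using x by (intro zero_less_power add_pos_nonneg) auto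
    moreover have "(cmod (m + s))\<^sup>2 > 0" using ms0 by (intro zero_less_power)
    ultimately have "1 / (cmod (m + s))\<^sup>2 \<le> (36 / c ^ 3)\<^sup>2 / (x + cmod s)\<^sup>2"
      by (simp only: frac_le_eq pos_divide_le_eq pos_le_divide_eq times_divide_eq_left)
    then have "4 * (4 * x) * cmod s * (1 / (cmod (m + s))\<^sup>2) \<le> 4 * (4 * x) * cmod s * ((36 / c ^ 3)\<^sup>2 / (x + cmod s)\<^sup>2)"
      using x by (intro mult_left_mono) auto
    then show ?thesis by simp
  qed
  also have "\<dots> = 16 * (36 / c ^ 3)\<^sup>2 * (x * cmod s / (x + cmod s)\<^sup>2)" by simp
  finally show ?thesis by (simp add: s_def)
qed

end

section \<open>Dyadic blocks of the boundary\<close>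

text \<open>For \<open>u\<close> in the unit interval, \<open>block (True, n)\<close> runs through the parameters between \<open>2\<^sup>-\<^sup>n\<^sup>-\<^sup>2\<close>
  and \<open>2\<^sup>-\<^sup>n\<^sup>-\<^sup>1\<close>, and \<open>block (False, n)\<close> through their reflections at \<open>1/2\<close>. The break points \<open>1/2\<close>
  and \<open>3/4\<close> of the boundary path are end points of blocks.\<close>

definition block :: "bool \<times> nat \<Rightarrow> real \<Rightarrow> real"
  where "block k u = (if fst k then (1/2) ^ (snd k + 2) * (1 + u) else 1 - (1/2) ^ (snd k + 2) * (1 + u))"

definition weight :: "bool \<times> nat \<Rightarrow> real"
  where "weight k = (1/2) ^ (snd k + 2)"

lemma weight_pos: "weight k > 0" by (simp add: weight_def)

lemma weight_eq: "weight k = (1/2) ^ snd k / 4"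
  by (simp add: weight_def)

lemma block_in_unit:
  assumes u: "u \<in> {0<..<1}"
  shows "block k u \<in> {0<..<1}" and "min (block k u) (1 - block k u) = weight k * (1 + u)"
proof -
  have "(1/2::real) ^ snd k \<le> 1" by (simp add: power_le_one)
  then have w: "weight k \<le> 1 / 4" by (simp add: weight_eq)
  have "weight k * (1 + u) < weight k * 2" using u weight_pos by (intro mult_strict_left_mono) auto
  then have lt: "weight k * (1 + u) < 1 / 2" using w by simp
  have gt: "weight k * (1 + u) > 0" using u weight_pos [of k] by simp
  have "block k u = (if fst k then weight k * (1 + u) else 1 - weight k * (1 + u))"
    by (simp add: block_def weight_def)
  then show "block k u \<in> {0<..<1}" "min (block k u) (1 - block k u) = weight k * (1 + u)"
    using lt gt by auto
qed

lemma block_in_params: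
  assumes u: "u \<in> {0<..<1}" shows "block k u \<in> stolz_params"
proof -
  have "weight k * (1 + u) \<noteq> 1 / 4"
  proof (cases "snd k = 0")
    case True
    then show ?thesis using u by (simp add: weight_def power2_eq_square)
  next
    case False
    then have "(1/2::real) ^ snd k \<le> (1/2) ^ 1" by (intro power_decreasing) auto
    then have "weight k \<le> 1 / 8" by (simp add: weight_eq)
    then have "weight k * (1 + u) \<le> 1 / 8 * (1 + u)" using u by (intro mult_right_mono) auto
    also have "\<dots> < 1 / 4" using u by simp
    finally show ?thesis by simp
  qed
  moreover have "weight k * (1 + u) \<noteq> 1 / 2"
  proof -
    have "(1/2::real) ^ snd k \<le> 1" by (simp add: power_le_one)
    then have w: "weight k \<le> 1 / 4" by (simp add: weight_eq)
    have "weight k * (1 + u) < weight k * 2" using u weight_pos by (intro mult_strict_left_mono) auto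
    then show ?thesis using w by simp
  qed
  ultimately have "min (block k u) (1 - block k u) \<noteq> 1 / 4" "min (block k u) (1 - block k u) \<noteq> 1 / 2"
    using block_in_unit(2) [OF u] by auto
  then have "block k u \<noteq> 1 / 2" "block k u \<noteq> 3 / 4" by (auto simp: min_def)
  then show ?thesis using block_in_unit(1) [OF u] by (simp add: stolz_params_def)
qed

context stolz_calculus
begin

lemma path_point:
  fixes k :: 'n
  assumes t: "t \<in> {0<..<1}"
  defines "l \<equiv> stolz_path (b k) t"
  shows "Re l < 1" "c * min t (1 - t) \<le> cmod (1 - l)" "cmod (1 - l) \<le> 8 * min t (1 - t)"
    "c\<^sup>2 / 4 * cmod (1 - l) \<le> Re (1 - l)" "l \<in> stolz (\<gamma> k)"
    "is_op_inverse (l *\<^sub>C id_blinfun - T k) (R k l)" "(l - 1) *\<^sub>C R k l \<in> E k"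
proof -
  have m: "min t (1 - t) > 0" using t by auto
  note bd = stolz_path_bounds [OF t angles(1) b_less]
  show "cmod (1 - l) \<le> 8 * min t (1 - t)" unfolding l_def by (rule bd(2))
  have "c * min t (1 - t) \<le> cos (b k) * min t (1 - t)" using c m by (intro mult_right_mono) auto
  then show "c * min t (1 - t) \<le> cmod (1 - l)" using bd(1) [of k] by (simp add: l_def)
  have "c\<^sup>2 / 4 * cmod (1 - l) \<le> (cos (b k))\<^sup>2 / 4 * cmod (1 - l)"
    using c by (intro mult_right_mono divide_right_mono power_mono) auto
  then show "c\<^sup>2 / 4 * cmod (1 - l) \<le> Re (1 - l)" using bd(3) [of k] by (simp add: l_def)
  show ls: "l \<in> stolz (\<gamma> k)" unfolding l_def by (rule stolz_path_in_stolz [OF t angles])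
  show "Re l < 1" by (rule stolz_Re_less [OF ls])
  show "is_op_inverse (l *\<^sub>C id_blinfun - T k) (R k l)" "(l - 1) *\<^sub>C R k l \<in> E k"
    using path_resolvent [OF t, of k] by (auto simp: l_def)
qed

lemma R_in_A:
  assumes "t \<in> {0<..<1}" shows "R k (stolz_path (b k) t) \<in> \<A>"
  by (rule bicommutant_inverse [OF _ path_point(6) [OF assms]]) (intro A_intros)

definition B1 :: real where "B1 = 64 * (36 / c ^ 3)\<^sup>2"

text \<open>The \<open>n\<close>-th piece at either end lies at distance about \<open>2\<^sup>-\<^sup>n\<close> from \<open>1\<close>, so that the two sums
  over \<open>n\<close> are dyadic sums with \<open>s = \<bar>1 - z\<bar>\<close>.\<close>

lemma sum_\<phi>s_le:
  assumes u: "u \<in> {0<..<1}" and z: "cmod z = 1"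
  shows "(\<Sum>j\<in>UNIV \<times> {..<N}. cmod (\<phi>s (stolz_path (b k) (block j u)) z)) \<le> B1"
proof -
  have one: "cmod (\<phi>s (stolz_path (b k) (block j u)) z)
      \<le> 16 * (36 / c ^ 3)\<^sup>2 * ((1/2) ^ snd j * cmod (1 - z) / ((1/2) ^ snd j + cmod (1 - z))\<^sup>2)" for j
  proof (rule norm_\<phi>s_le [OF _ _ _ _ z])
    note pp = path_point [where k = k and t = "block j u", OF block_in_unit(1) [OF u], unfolded block_in_unit(2) [OF u]]
    define x :: real where "x = (1/2) ^ snd j"
    have w: "weight j = x / 4" by (simp add: weight_eq x_def)
    have x: "x > 0" by (simp add: x_def)
    show "(1/2::real) ^ snd j > 0" by simp
    have "x / 4 * 1 \<le> x / 4 * (1 + u)" "x / 4 * (1 + u) \<le> x / 4 * 2"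
      using u x by (auto intro!: mult_left_mono)
    then have 1: "x / 4 \<le> weight j * (1 + u)" "weight j * (1 + u) \<le> x / 2" by (auto simp: w)
    have "c * (x / 4) \<le> c * (weight j * (1 + u))" using 1 c by (intro mult_left_mono) auto
    then show "c * ((1/2) ^ snd j / 4) \<le> cmod (1 - stolz_path (b k) (block j u))"
      using pp(2) by (simp add: x_def)
    show "cmod (1 - stolz_path (b k) (block j u)) \<le> 4 * (1/2) ^ snd j"
      using pp(3) 1(2) by (simp add: x_def)
    show "c\<^sup>2 / 4 * cmod (1 - stolz_path (b k) (block j u)) \<le> Re (1 - stolz_path (b k) (block j u))"
      by (rule pp(4))
  qed
  have "(\<Sum>j\<in>UNIV \<times> {..<N}. cmod (\<phi>s (stolz_path (b k) (block j u)) z))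
      \<le> (\<Sum>j\<in>(UNIV::bool set) \<times> {..<N}. 16 * (36 / c ^ 3)\<^sup>2 * ((1/2) ^ snd j * cmod (1 - z) / ((1/2) ^ snd j + cmod (1 - z))\<^sup>2))"
    by (intro sum_mono one)
  also have "\<dots> = (\<Sum>s\<in>(UNIV::bool set). \<Sum>n<N. 16 * (36 / c ^ 3)\<^sup>2 * ((1/2) ^ n * cmod (1 - z) / ((1/2) ^ n + cmod (1 - z))\<^sup>2))"
    by (subst sum.cartesian_product) (simp add: case_prod_unfold)
  also have "\<dots> = 2 * (16 * (36 / c ^ 3)\<^sup>2 * (\<Sum>n<N. (1/2) ^ n * cmod (1 - z) / ((1/2) ^ n + cmod (1 - z))\<^sup>2))"
    by (simp only: sum_distrib_left [symmetric]) (simp add: UNIV_bool)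
  also have "\<dots> \<le> 2 * (16 * (36 / c ^ 3)\<^sup>2 * 2)"
    by (intro mult_left_mono dyadic_sum_le) auto
  finally show ?thesis by (simp add: B1_def)
qed

definition op_prods :: "'n set \<Rightarrow> ('x \<Rightarrow>\<^sub>L 'x) set"
  where "op_prods \<Lambda> = {op_prod S \<Lambda> |S. \<forall>i\<in>\<Lambda>. S i \<in> \<A> \<and> S i \<in> E i}"

lemma rad_bounded_op_prods:
  fixes \<Lambda> :: "'n set"
  shows "rad_bounded (D ^ card \<Lambda>) (op_prods \<Lambda>)"
  using finite [of \<Lambda>]
proof (induction \<Lambda> rule: finite_induct)
  case empty
  then show ?case using rad_bounded_id by (simp add: op_prods_def)
next
  case (insert j F)
  have "op_prods (insert j F) \<subseteq> {A o\<^sub>L B |A B. A \<in> E j \<and> B \<in> op_prods F}"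
  proof
    fix V assume "V \<in> op_prods (insert j F)"
    then obtain S where S: "\<And>i. i \<in> insert j F \<Longrightarrow> S i \<in> \<A>" "\<And>i. i \<in> insert j F \<Longrightarrow> S i \<in> E i"
      and V: "V = op_prod S (insert j F)" by (auto simp: op_prods_def)
    have "V = S j o\<^sub>L op_prod S F" unfolding V by (rule op_prod_insert) (use S insert in auto)
    moreover have "op_prod S F \<in> op_prods F" using S by (auto simp: op_prods_def)
    ultimately show "V \<in> {A o\<^sub>L B |A B. A \<in> E j \<and> B \<in> op_prods F}" using S by blast
  qed
  moreover have "rad_bounded (D * D ^ card F) {A o\<^sub>L B |A B. A \<in> E j \<and> B \<in> op_prods F}"
    by (intro rad_bounded_comp rad_E insert)
  ultimately show ?case using insert by (simp add: rad_bounded_subset)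
qed

text \<open>The operator belongs to a function that is dominated by \<open>A\<close> times the product over the
  variables of the sums of \<open>\<bar>\<phi>\<bar>\<close>.\<close>

lemma signed_sum_le:
  fixes \<Lambda> :: "'n set"
  assumes u: "\<And>i. i \<in> \<Lambda> \<Longrightarrow> u i \<in> {0<..<1}"
    and a: "\<And>\<kappa>. \<kappa> \<in> PiE \<Lambda> (\<lambda>_. UNIV \<times> {..<N}) \<Longrightarrow> cmod (a \<kappa>) \<le> A" and A: "A \<ge> 0"
  shows "norm (\<Sum>\<kappa>\<in>PiE \<Lambda> (\<lambda>_. UNIV \<times> {..<N}). a \<kappa> *\<^sub>C op_prod (\<lambda>i. \<phi> i (stolz_path (b i) (block (\<kappa> i) (u i)))) \<Lambda>)
    \<le> C * (A * B1 ^ card \<Lambda>)"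
proof (rule polynomial_limit_norm_le [OF poly_bounded])
  let ?K = "PiE \<Lambda> (\<lambda>_. UNIV \<times> {..<N}) :: ('n \<Rightarrow> bool \<times> nat) set"
  let ?l = "\<lambda>\<kappa> i. stolz_path (b i) (block (\<kappa> i) (u i))"
  show "C \<ge> 0" using C by simp
  have l: "Re (?l \<kappa> i) < 1" if "i \<in> \<Lambda>" for \<kappa> i
    by (rule path_point(1) [OF block_in_unit(1) [OF u [OF that]]])
  show "polynomial_limit (\<lambda>z. \<Sum>\<kappa>\<in>?K. a \<kappa> * (\<Prod>i\<in>\<Lambda>. \<phi>s (?l \<kappa> i) (z $ i))) (\<Sum>\<kappa>\<in>?K. a \<kappa> *\<^sub>C op_prod (\<lambda>i. \<phi> i (?l \<kappa> i)) \<Lambda>)"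
    by (intro polynomial_limit_sum polynomial_limit_scaleC polynomial_limit_op_prod polynomial_limit_\<phi> kernel_A l)
  fix z :: "complex ^ 'n" assume z: "z \<in> torus"
  have "cmod (\<Sum>\<kappa>\<in>?K. a \<kappa> * (\<Prod>i\<in>\<Lambda>. \<phi>s (?l \<kappa> i) (z $ i))) \<le> (\<Sum>\<kappa>\<in>?K. A * (\<Prod>i\<in>\<Lambda>. cmod (\<phi>s (?l \<kappa> i) (z $ i))))"
    unfolding prod_norm norm_mult
    by (intro order_trans [OF norm_sum] sum_mono) (auto simp: norm_mult intro!: mult_right_mono a)
  also have "\<dots> = A * (\<Prod>i\<in>\<Lambda>. \<Sum>j\<in>UNIV \<times> {..<N}. cmod (\<phi>s (stolz_path (b i) (block j (u i))) (z $ i)))"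
    unfolding sum_distrib_left [symmetric] by (subst prod_sum_PiE) auto
  also have "\<dots> \<le> A * (\<Prod>i\<in>\<Lambda>. B1)"
    using z u A by (intro mult_left_mono prod_mono conjI sum_nonneg sum_\<phi>s_le) (auto simp: torus_def)
  finally show "cmod (\<Sum>\<kappa>\<in>?K. a \<kappa> * (\<Prod>i\<in>\<Lambda>. \<phi>s (?l \<kappa> i) (z $ i))) \<le> A * B1 ^ card \<Lambda>" by simp
qed

text \<open>One factor \<open>\<phi>\<close> of each variable is moved to the right of the resolvents, and the
  coefficients stay with the left one; then signs are inserted.\<close>

lemma discrete_estimate:
  fixes \<Lambda> :: "'n set"
  assumes u: "\<And>i. i \<in> \<Lambda> \<Longrightarrow> u i \<in> {0<..<1}"
    and a: "\<And>\<kappa>. \<kappa> \<in> PiE \<Lambda> (\<lambda>_. UNIV \<times> {..<N}) \<Longrightarrow> cmod (a \<kappa>) \<le> A" and A: "A \<ge> 0"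
  defines "l \<equiv> \<lambda>\<kappa> i. stolz_path (b i) (block (\<kappa> i) (u i))"
  shows "norm (\<Sum>\<kappa>\<in>PiE \<Lambda> (\<lambda>_. UNIV \<times> {..<N}). a \<kappa> *\<^sub>C
      op_prod (\<lambda>i. \<phi> i (l \<kappa> i) o\<^sub>L (\<phi> i (l \<kappa> i) o\<^sub>L ((l \<kappa> i - 1) *\<^sub>C R i (l \<kappa> i)))) \<Lambda>)
    \<le> C * (A * B1 ^ card \<Lambda>) * D ^ card \<Lambda> * (C * (1 * B1 ^ card \<Lambda>))"
proof -
  let ?K = "PiE \<Lambda> (\<lambda>_. UNIV \<times> {..<N}) :: ('n \<Rightarrow> bool \<times> nat) set"
  let ?S = "\<lambda>\<kappa> i. (l \<kappa> i - 1) *\<^sub>C R i (l \<kappa> i)"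
  let ?\<Phi> = "\<lambda>\<kappa>. op_prod (\<lambda>i. \<phi> i (l \<kappa> i)) \<Lambda>"
  have fin: "finite ?K" by (intro finite_PiE) auto
  have B1: "B1 \<ge> 0" by (simp add: B1_def)
  have t: "block (\<kappa> i) (u i) \<in> {0<..<1}" if "i \<in> \<Lambda>" for \<kappa> i
    by (rule block_in_unit(1) [OF u [OF that]])
  have \<phi>A: "\<phi> i (l \<kappa> i) \<in> \<A>" if "i \<in> \<Lambda>" for \<kappa> i
    unfolding l_def by (rule kernel_A(3) [OF path_point(1) [OF t [OF that]]])
  have SA: "?S \<kappa> i \<in> \<A>" if "i \<in> \<Lambda>" for \<kappa> i
    unfolding l_def by (rule bicommutant_scaleC [OF R_in_A [OF t [OF that]]])
  have prod: "op_prod (\<lambda>i. \<phi> i (l \<kappa> i) o\<^sub>L (\<phi> i (l \<kappa> i) o\<^sub>L ?S \<kappa> i)) \<Lambda> = ?\<Phi> \<kappa> o\<^sub>L (op_prod (?S \<kappa>) \<Lambda> o\<^sub>L ?\<Phi> \<kappa>)" for \<kappa>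
  proof -
    have "op_prod (\<lambda>i. \<phi> i (l \<kappa> i) o\<^sub>L (\<phi> i (l \<kappa> i) o\<^sub>L ?S \<kappa> i)) \<Lambda> = ?\<Phi> \<kappa> o\<^sub>L op_prod (\<lambda>i. \<phi> i (l \<kappa> i) o\<^sub>L ?S \<kappa> i) \<Lambda>"
      by (rule op_prod_comp) (auto intro!: bicommutant_comp \<phi>A SA)
    also have "op_prod (\<lambda>i. \<phi> i (l \<kappa> i) o\<^sub>L ?S \<kappa> i) \<Lambda> = ?\<Phi> \<kappa> o\<^sub>L op_prod (?S \<kappa>) \<Lambda>"
      by (rule op_prod_comp) (auto intro!: \<phi>A SA)
    also have "\<dots> = op_prod (?S \<kappa>) \<Lambda> o\<^sub>L ?\<Phi> \<kappa>"
      by (intro commute_A op_prod_A \<phi>A SA)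
    finally show ?thesis .
  qed
  have "norm (\<Sum>\<kappa>\<in>?K. (a \<kappa> *\<^sub>C ?\<Phi> \<kappa>) o\<^sub>L (op_prod (?S \<kappa>) \<Lambda> o\<^sub>L ?\<Phi> \<kappa>))
      \<le> C * (A * B1 ^ card \<Lambda>) * D ^ card \<Lambda> * (C * (1 * B1 ^ card \<Lambda>))"
  proof (rule norm_sum_randomized [OF fin rad_bounded_op_prods [of \<Lambda>]])
    show "op_prod (?S \<kappa>) \<Lambda> \<in> op_prods \<Lambda>" for \<kappa>
      unfolding op_prods_def using SA path_point(7) [OF t] by (auto simp: l_def)
    fix \<epsilon> assume e: "\<epsilon> \<in> signs ?K"
    have eq: "\<epsilon> \<kappa> *\<^sub>R x *\<^sub>C V = (of_real (\<epsilon> \<kappa>) * x) *\<^sub>C V" for \<kappa> x and V :: "'x \<Rightarrow>\<^sub>L 'x"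
      by (simp add: scaleC_of_real [symmetric] scaleC_scaleC)
    have eq1: "\<epsilon> \<kappa> *\<^sub>R V = of_real (\<epsilon> \<kappa>) *\<^sub>C V" for \<kappa> and V :: "'x \<Rightarrow>\<^sub>L 'x"
      by (simp add: scaleC_of_real)
    show "norm (\<Sum>\<kappa>\<in>?K. \<epsilon> \<kappa> *\<^sub>R ?\<Phi> \<kappa>) \<le> C * (1 * B1 ^ card \<Lambda>)"
      unfolding eq1 l_def using e u by (intro signed_sum_le) (auto simp: abs_signs)
    show "norm (\<Sum>\<kappa>\<in>?K. \<epsilon> \<kappa> *\<^sub>R a \<kappa> *\<^sub>C ?\<Phi> \<kappa>) \<le> C * (A * B1 ^ card \<Lambda>)"
      unfolding eq l_def using e u A a by (intro signed_sum_le) (auto simp: abs_signs norm_mult)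
  qed (use C A B1 in auto)
  then show ?thesis by (simp only: prod scaleC_opcomp)
qed

end

section \<open>Lebesgue measure on the coordinate space\<close>

lemma prod_Basis_cart: "(\<Prod>j\<in>Basis. h j) = (\<Prod>i\<in>UNIV. h (axis i (1::real) :: real ^ 'n))"
proof -
  have inj: "inj (\<lambda>i. axis i (1::real) :: real ^ 'n)" by (auto simp: inj_on_def axis_eq_axis)
  have "(Basis :: (real ^ 'n) set) = range (\<lambda>i. axis i 1)" by (auto simp: Basis_vec_def)
  then show ?thesis using prod.reindex [OF inj, of h] by (simp only: o_def)
qed

lemma sum_Basis_cart: "(\<Sum>j\<in>Basis. h j) = (\<Sum>i\<in>UNIV. h (axis i (1::real) :: real ^ 'n))"
proof -
  have inj: "inj (\<lambda>i. axis i (1::real) :: real ^ 'n)" by (auto simp: inj_on_def axis_eq_axis)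
  have "(Basis :: (real ^ 'n) set) = range (\<lambda>i. axis i 1)" by (auto simp: Basis_vec_def)
  then show ?thesis using sum.reindex [OF inj, of h] by (simp only: o_def)
qed

lemma measurable_vec_lambda [measurable]:
  "(\<lambda>x. \<chi> i. x i) \<in> measurable (Pi\<^sub>M UNIV (\<lambda>_::'n::finite. lborel :: real measure)) (borel :: (real ^ 'n) measure)"
  by (rule borel_measurable_euclidean_space [THEN iffD2])
     (auto simp: Basis_vec_def inner_axis)

text \<open>This identification gives access to Fubini's theorem for a single coordinate.\<close>

lemma lborel_vec_eq_PiM:
  "lborel = distr (Pi\<^sub>M UNIV (\<lambda>_::'n::finite. lborel :: real measure)) (borel :: (real ^ 'n) measure) (\<lambda>x. \<chi> i. x i)"
proof (rule lborel_eqI)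
  interpret finite_product_sigma_finite "\<lambda>_::'n. lborel :: real measure" UNIV by standard simp
  fix l u :: "real ^ 'n" assume le: "\<And>b. b \<in> Basis \<Longrightarrow> l \<bullet> b \<le> u \<bullet> b"
  have lei: "l $ i \<le> u $ i" for i
    using le [of "axis i 1"] by (simp add: inner_axis)
  let ?M = "Pi\<^sub>M UNIV (\<lambda>_::'n::finite. lborel :: real measure)"
  have pre: "(\<lambda>x. \<chi> i. x i) -` box l u \<inter> space ?M = PiE UNIV (\<lambda>i. {l $ i<..<u $ i})"
    by (auto simp: mem_box_cart space_PiM PiE_iff)
  have "emeasure (distr ?M borel (\<lambda>x. \<chi> i. x i)) (box l u) = emeasure ?M (PiE UNIV (\<lambda>i. {l $ i<..<u $ i}))"
    by (subst emeasure_distr) (auto simp: pre)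
  also have "\<dots> = (\<Prod>i\<in>UNIV. emeasure lborel {l $ i<..<u $ i})"
    by (rule measure_times) auto
  also have "\<dots> = ennreal (\<Prod>i\<in>UNIV. u $ i - l $ i)"
    using lei by (simp add: prod_ennreal)
  also have "(\<Prod>i\<in>UNIV. u $ i - l $ i) = (\<Prod>b\<in>Basis. (u - l) \<bullet> b)"
    by (simp add: prod_Basis_cart inner_axis)
  finally show "emeasure (distr ?M borel (\<lambda>x. \<chi> i. x i)) (box l u) = ennreal (\<Prod>b\<in>Basis. (u - l) \<bullet> b)" .
qed simp

lemma integrable_vec_iff:
  fixes g :: "real ^ 'n::finite \<Rightarrow> 'b::{banach, second_countable_topology}"
  assumes "g \<in> borel_measurable borel"
  shows "integrable lborel g \<longleftrightarrow> integrable (Pi\<^sub>M UNIV (\<lambda>_. lborel)) (\<lambda>x. g (\<chi> i. x i))"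
  by (subst lborel_vec_eq_PiM) (rule integrable_distr_eq [OF measurable_vec_lambda assms])

lemma integral_coordinate_zero:
  fixes g :: "real ^ 'n::finite \<Rightarrow> 'b::{banach, second_countable_topology}"
  assumes g: "integrable lborel g"
    and zero: "\<And>x. (LINT y|lborel. g (\<chi> i. if i = j then y else x $ i)) = 0"
  shows "(LINT t|lborel. g t) = 0"
proof -
  interpret product_sigma_finite "\<lambda>_::'n. lborel :: real measure" by standard
  have gm: "g \<in> borel_measurable borel" using borel_measurable_integrable [OF g] by simp
  have ins: "UNIV = insert j (UNIV - {j})" by auto
  have "(LINT t|lborel. g t) = (LINT x|Pi\<^sub>M UNIV (\<lambda>_. lborel). g (\<chi> i. x i))"
    by (subst lborel_vec_eq_PiM) (rule integral_distr [OF measurable_vec_lambda gm])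
  also have "\<dots> = (LINT x|Pi\<^sub>M (insert j (UNIV - {j})) (\<lambda>_. lborel). g (\<chi> i. x i))"
    by (simp only: ins [symmetric])
  also have "\<dots> = (LINT x|Pi\<^sub>M (UNIV - {j}) (\<lambda>_. lborel). LINT y|lborel. g (\<chi> i. (x(j := y)) i))"
  proof (rule product_integral_insert)
    show "integrable (Pi\<^sub>M (insert j (UNIV - {j})) (\<lambda>_. lborel)) (\<lambda>x. g (\<chi> i. x i))"
      using g unfolding ins [symmetric] by (simp only: integrable_vec_iff [OF gm])
  qed simp_all
  also have "\<dots> = (LINT x|Pi\<^sub>M (UNIV - {j}) (\<lambda>_. lborel :: real measure). 0)"
  proof (rule Bochner_Integration.integral_cong [OF refl])
    fix x :: "'n \<Rightarrow> real"
    have "(\<chi> i. (x(j := y)) i) = (\<chi> i. if i = j then y else (\<chi> i. x i) $ i)" for y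
      by (simp add: vec_eq_iff)
    then show "(LINT y|lborel. g (\<chi> i. (x(j := y)) i)) = 0"
      using zero [of "\<chi> i. x i"] by simp
  qed
  finally show ?thesis by simp
qed

lemma integrable_prod_vec:
  fixes h :: "'n::finite \<Rightarrow> real \<Rightarrow> real"
  assumes h: "\<And>i. integrable lborel (h i)"
  shows "integrable lborel (\<lambda>t :: real ^ 'n. \<Prod>i\<in>UNIV. h i (t $ i))"
proof -
  interpret product_sigma_finite "\<lambda>_::'n. lborel :: real measure" by standard
  have [measurable]: "h i \<in> borel_measurable borel" for i
    using borel_measurable_integrable [OF h] by simp
  have "(\<lambda>t :: real ^ 'n. \<Prod>i\<in>UNIV. h i (t $ i)) \<in> borel_measurable borel" by measurable
  from integrable_vec_iff [OF this] show ?thesis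
    using product_integrable_prod [of UNIV h] h by simp
qed

lemma AE_coordinates_notin:
  assumes Z: "countable Z"
  shows "AE t :: real ^ 'n::finite in lborel. \<forall>i. t $ i \<notin> Z"
proof -
  have "AE t :: real ^ 'n in lborel. t $ i \<noteq> z" for i z
  proof -
    have neg: "negligible {t :: real ^ 'n. t $ i = z}" 
      using negligible_standard_hyperplane [of "axis i (1::real)" z] by (simp add: inner_axis)
    have "closed {t :: real ^ 'n. t $ i = z}" by (intro closed_Collect_eq continuous_intros)
    then have "{t :: real ^ 'n. t $ i = z} \<in> sets lborel" by simp
    with neg have "{t :: real ^ 'n. t $ i = z} \<in> null_sets lborel"
      by (simp add: negligible_iff_null_sets null_sets_completion_iff)
    then show ?thesis by (rule AE_I') auto
  qed
  then have "AE t :: real ^ 'n in lborel. \<forall>z\<in>Z. t $ i \<noteq> z" for i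
    using Z by (simp add: AE_ball_countable)
  then have "AE t :: real ^ 'n in lborel. \<forall>i. \<forall>z\<in>Z. t $ i \<noteq> z"
    by (simp add: AE_all_countable)
  then show ?thesis by (rule AE_mp) (intro AE_I2, auto)
qed

section \<open>Integration over dyadic blocks\<close>

definition block_set :: "bool \<times> nat \<Rightarrow> real set"
  where "block_set k = (if fst k then {weight k<..<2 * weight k} else {1 - 2 * weight k<..<1 - weight k})"

lemma block_mem_iff: "block k u \<in> block_set k \<longleftrightarrow> u \<in> {0<..<1}"
proof -
  have w: "weight k > 0" by (rule weight_pos)
  have "block k u = (if fst k then weight k * (1 + u) else 1 - weight k * (1 + u))"
    by (simp add: block_def weight_def)
  moreover have "weight k < weight k * (1 + u) \<longleftrightarrow> 0 < u"
    using mult_less_cancel_left_pos [OF w, of 1 "1 + u"] by simp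
  moreover have "weight k * (1 + u) < 2 * weight k \<longleftrightarrow> u < 1"
    using mult_less_cancel_left_pos [OF w, of "1 + u" 2] by (simp add: mult.commute)
  ultimately show ?thesis by (auto simp: block_set_def)
qed

lemma weight_le: "weight k \<le> 1 / 4"
  unfolding weight_eq using power_le_one [of "1/2::real" "snd k"] by simp

lemma block_set_min:
  assumes "t \<in> block_set k"
  shows "t \<in> {0<..<1}" "fst k \<longleftrightarrow> t < 1 / 2" "weight k < min t (1 - t)" "min t (1 - t) < 2 * weight k"
  using assms weight_le [of k] weight_pos [of k] by (auto simp: block_set_def min_def split: if_splits)

lemma block_set_unique:
  assumes "t \<in> block_set k" "t \<in> block_set k'" shows "k = k'"
proof -
  have False if less: "snd k < snd k'" and m: "m < 2 * weight k'" "weight k < m" for k k' and m :: real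
  proof -
    have "(1/2::real) ^ snd k' \<le> (1/2) ^ Suc (snd k)" using less by (intro power_decreasing) auto
    then have "2 * weight k' \<le> weight k" by (simp add: weight_eq)
    then show False using m by simp
  qed
  from this [of k k' "min t (1 - t)"] this [of k' k "min t (1 - t)"]
  have "snd k = snd k'"
    using block_set_min(3,4) [OF assms(1)] block_set_min(3,4) [OF assms(2)] by (meson linorder_neqE_nat)
  moreover have "fst k = fst k'" using block_set_min(2) [OF assms(1)] block_set_min(2) [OF assms(2)] by blast
  ultimately show ?thesis by (simp add: prod_eq_iff)
qed

definition dyadic_points :: "real set"
  where "dyadic_points = range (\<lambda>n::nat. (1/2) ^ n) \<union> range (\<lambda>n::nat. 1 - (1/2) ^ n)"

lemma countable_dyadic_points: "countable dyadic_points"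
  by (simp add: dyadic_points_def)

text \<open>The blocks cover the unit interval up to their countably many end points.\<close>

lemma block_set_exists:
  assumes t: "t \<in> {0<..<1}" "t \<notin> dyadic_points"
  shows "\<exists>k. t \<in> block_set k"
proof -
  define m where "m = min t (1 - t)"
  have m: "m > 0" "m \<le> 1 / 2" using t by (auto simp: m_def min_def)
  have nd: "m \<noteq> (1/2) ^ n" for n :: nat
    using t(2) unfolding m_def min_def dyadic_points_def by (auto simp: algebra_simps)
  obtain n0 :: nat where "(1/2) ^ n0 < m" using real_arch_pow_inv [of m "1/2"] m by auto
  then have ex: "(1/2::real) ^ (n0 + 2) < m"
    by (rule le_less_trans [rotated]) (intro power_decreasing, auto)
  define n where "n = (LEAST n::nat. (1/2::real) ^ (n + 2) < m)"
  have n: "(1/2::real) ^ (n + 2) < m" unfolding n_def by (rule LeastI [where P = "\<lambda>n. (1/2::real) ^ (n + 2) < m", OF ex])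
  have "m < 2 * (1/2::real) ^ (n + 2)"
  proof (cases n)
    case 0
    then show ?thesis using m nd [of 1] by (simp add: power2_eq_square)
  next
    case (Suc k)
    have "\<not> (1/2::real) ^ (k + 2) < m" using not_less_Least [of k "\<lambda>n. (1/2::real) ^ (n + 2) < m"] Suc by (simp add: n_def)
    then have "m < (1/2::real) ^ (k + 2)" using nd [of "k + 2"] by linarith
    then show ?thesis using Suc by simp
  qed
  then have "t \<in> block_set (t < 1 / 2, n)"
    using n t by (auto simp: block_set_def weight_def m_def min_def split: if_splits)
  then show ?thesis ..
qed

lemma sum_block_indicator:
  fixes t :: real
  assumes K: "finite K"
  shows "(\<Sum>k\<in>K. indicator (block_set k) t :: real) \<le> 1"
    and "k \<in> K \<Longrightarrow> t \<in> block_set k \<Longrightarrow> (\<Sum>k\<in>K. indicator (block_set k) t :: real) = 1"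
proof -
  show 1: "(\<Sum>k\<in>K. indicator (block_set k) t :: real) = 1" if "k \<in> K" "t \<in> block_set k" for k
  proof -
    have "(\<Sum>j\<in>K. indicator (block_set j) t :: real) = (\<Sum>j\<in>K. if j = k then 1 else 0)"
    proof (rule sum.cong [OF refl])
      show "(indicator (block_set j) t :: real) = (if j = k then 1 else 0)" for j
        using that(2) block_set_unique [of t j k] by (cases "j = k") (auto simp: indicator_def)
    qed
    then show ?thesis using K that by simp
  qed
  show "(\<Sum>k\<in>K. indicator (block_set k) t :: real) \<le> 1"
  proof (cases "\<exists>k\<in>K. t \<in> block_set k")
    case True then show ?thesis using 1 by fastforce
  next
    case False
    then have "(\<Sum>k\<in>K. indicator (block_set k) t :: real) = 0" by (intro sum.neutral) auto
    then show ?thesis by simp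
  qed
qed

definition cube :: "(real ^ 'n::finite) set"
  where "cube = {t. \<forall>i. t $ i \<in> {0<..<1}}"

lemma cube_box: "cube = box 0 (\<chi> i. 1)"
  by (auto simp: cube_def mem_box_cart)

lemma measure_cube: "measure lborel (cube :: (real ^ 'n::finite) set) = 1" "emeasure lborel (cube :: (real ^ 'n) set) = 1"
proof -
  have "emeasure lborel (cube :: (real ^ 'n) set) = ennreal (\<Prod>b\<in>Basis. ((\<chi> i. 1) - 0 :: real ^ 'n) \<bullet> b)"
    unfolding cube_box by (rule emeasure_lborel_box) (auto simp: Basis_vec_def inner_axis)
  then show 1: "emeasure lborel (cube :: (real ^ 'n) set) = 1" by (simp add: prod_Basis_cart inner_axis)
  then show "measure lborel (cube :: (real ^ 'n) set) = 1" by (simp add: measure_def)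
qed

definition block_map :: "'n set \<Rightarrow> ('n \<Rightarrow> bool \<times> nat) \<Rightarrow> real ^ 'n \<Rightarrow> real ^ 'n::finite"
  where "block_map \<Lambda> \<kappa> u = (\<chi> i. if i \<in> \<Lambda> then block (\<kappa> i) (u $ i) else u $ i)"

definition block_box :: "'n set \<Rightarrow> ('n \<Rightarrow> bool \<times> nat) \<Rightarrow> (real ^ 'n::finite) set"
  where "block_box \<Lambda> \<kappa> = {t. \<forall>i. t $ i \<in> (if i \<in> \<Lambda> then block_set (\<kappa> i) else {0<..<1})}"

lemma block_map_in_box: "block_map \<Lambda> \<kappa> u \<in> block_box \<Lambda> \<kappa> \<longleftrightarrow> u \<in> cube"
  unfolding block_map_def block_box_def cube_def by (auto simp: block_mem_iff)

lemma sets_block_box [measurable]: "block_box \<Lambda> \<kappa> \<in> sets borel"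
proof -
  have "block_box \<Lambda> \<kappa> =
      box (\<chi> i. if i \<in> \<Lambda> then (if fst (\<kappa> i) then weight (\<kappa> i) else 1 - 2 * weight (\<kappa> i)) else 0)
          (\<chi> i. if i \<in> \<Lambda> then (if fst (\<kappa> i) then 2 * weight (\<kappa> i) else 1 - weight (\<kappa> i)) else 1)"
    unfolding block_box_def set_eq_iff mem_Collect_eq mem_box_cart
    by (intro allI iff_allI) (simp add: block_set_def)
  then show ?thesis by simp
qed

lemma sets_cube [measurable]: "cube \<in> sets borel"
  by (simp add: cube_box)

lemma block_map_affine:
  fixes \<kappa> :: "'n::finite \<Rightarrow> bool \<times> nat" and \<Lambda> :: "'n set"
  defines "c \<equiv> \<lambda>i. if i \<in> \<Lambda> then (if fst (\<kappa> i) then weight (\<kappa> i) else - weight (\<kappa> i)) else 1"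
    and "\<tau> \<equiv> (\<chi> i. if i \<in> \<Lambda> then (if fst (\<kappa> i) then weight (\<kappa> i) else 1 - weight (\<kappa> i)) else 0)"
  shows "block_map \<Lambda> \<kappa> u = \<tau> + (\<Sum>j\<in>Basis. ((\<Sum>i\<in>UNIV. c i * (j $ i)) * (u \<bullet> j)) *\<^sub>R j)"
proof -
  have "(\<Sum>j\<in>Basis. ((\<Sum>i\<in>UNIV. c i * (j $ i)) * (u \<bullet> j)) *\<^sub>R j) = (\<chi> i. c i * u $ i)"
    unfolding sum_Basis_cart
    by (simp add: vec_eq_iff inner_axis)
       (simp add: axis_def if_distrib [where f = "\<lambda>x. _ * x"] cong: if_cong)
  then show ?thesis
    by (auto simp: vec_eq_iff block_map_def c_def \<tau>_def block_def weight_def algebra_simps)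
qed

text \<open>The map onto a product of blocks is affine with a diagonal linear part.\<close>

lemma lborel_block_map:
  fixes \<kappa> :: "'n::finite \<Rightarrow> bool \<times> nat"
  shows "lborel = density (distr lborel borel (block_map \<Lambda> \<kappa>)) (\<lambda>_. ennreal (\<Prod>i\<in>\<Lambda>. weight (\<kappa> i)))"
proof -
  define c where "c i = (if i \<in> \<Lambda> then (if fst (\<kappa> i) then weight (\<kappa> i) else - weight (\<kappa> i)) else 1)" for i
  define C where "C j = (\<Sum>i\<in>UNIV. c i * (j $ i))" for j :: "real ^ 'n"
  have Ca: "C (axis i 1) = c i" for i
    by (simp add: C_def axis_def if_distrib [where f = "\<lambda>x. _ * x"] cong: if_cong)
  have c0: "c i \<noteq> 0" for i using weight_pos [of "\<kappa> i"] by (auto simp: c_def)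
  have "(\<Prod>j\<in>Basis. \<bar>C j\<bar>) = (\<Prod>i\<in>UNIV. \<bar>c i\<bar>)" by (simp add: prod_Basis_cart Ca)
  also have "\<dots> = (\<Prod>i\<in>\<Lambda>. \<bar>c i\<bar>)" by (rule prod.mono_neutral_right) (auto simp: c_def)
  also have "\<dots> = (\<Prod>i\<in>\<Lambda>. weight (\<kappa> i))"
    using weight_pos by (intro prod.cong) (auto simp: c_def less_imp_le)
  finally have p: "(\<Prod>j\<in>Basis. \<bar>C j\<bar>) = (\<Prod>i\<in>\<Lambda>. weight (\<kappa> i))" .
  have Cj: "C j \<noteq> 0" if "j \<in> Basis" for j using that c0 Ca by (auto simp: Basis_vec_def)
  define \<tau> :: "real ^ 'n" where
    "\<tau> = (\<chi> i. if i \<in> \<Lambda> then (if fst (\<kappa> i) then weight (\<kappa> i) else 1 - weight (\<kappa> i)) else 0)"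
  have "(\<lambda>u. \<tau> + (\<Sum>j\<in>Basis. (C j * (u \<bullet> j)) *\<^sub>R j)) = block_map \<Lambda> \<kappa>"
    unfolding \<tau>_def C_def c_def by (rule ext) (rule block_map_affine [symmetric])
  then show ?thesis using lborel_affine_euclidean [of C \<tau>, OF Cj] unfolding p by simp
qed

lemma borel_measurable_block_map [measurable]: "block_map \<Lambda> \<kappa> \<in> borel_measurable borel"
proof -
  have "continuous_on UNIV (block_map \<Lambda> \<kappa>)"
    unfolding block_map_def
  proof (rule continuous_on_vec_lambda)
    show "continuous_on UNIV (\<lambda>u. if i \<in> \<Lambda> then block (\<kappa> i) (u $ i) else u $ i)" for i
      by (cases "i \<in> \<Lambda>"; cases "fst (\<kappa> i)") (auto simp: block_def intro!: continuous_intros)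
  qed
  then show ?thesis by (rule borel_measurable_continuous_onI)
qed

lemma block_map_integral:
  fixes g :: "real ^ 'n::finite \<Rightarrow> complex"
  assumes g: "integrable lborel g"
  shows "(LINT t|lborel. g t) = of_real (\<Prod>i\<in>\<Lambda>. weight (\<kappa> i)) * (LINT u|lborel. g (block_map \<Lambda> \<kappa> u))"
    and "integrable lborel (\<lambda>u. g (block_map \<Lambda> \<kappa> u))"
proof -
  define p where "p = (\<Prod>i\<in>\<Lambda>. weight (\<kappa> i))"
  have p: "p > 0" unfolding p_def by (intro prod_pos) (auto simp: weight_pos)
  have [measurable]: "g \<in> borel_measurable borel" using borel_measurable_integrable [OF g] by simp
  have "(LINT t|lborel. g t) = (LINT t|density (distr lborel borel (block_map \<Lambda> \<kappa>)) (\<lambda>_. ennreal p). g t)"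
    unfolding p_def using lborel_block_map [of \<Lambda> \<kappa>] by metis
  also have "\<dots> = (LINT t|distr lborel borel (block_map \<Lambda> \<kappa>). p *\<^sub>R g t)"
    using p by (intro integral_density) auto
  also have "\<dots> = (LINT u|lborel. p *\<^sub>R g (block_map \<Lambda> \<kappa> u))"
    by (intro integral_distr) auto
  also have "\<dots> = of_real p * (LINT u|lborel. g (block_map \<Lambda> \<kappa> u))"
    by (simp add: scaleR_conv_of_real)
  finally show "(LINT t|lborel. g t) = of_real (\<Prod>i\<in>\<Lambda>. weight (\<kappa> i)) * (LINT u|lborel. g (block_map \<Lambda> \<kappa> u))"
    by (simp add: p_def)
  have "integrable (density (distr lborel borel (block_map \<Lambda> \<kappa>)) (\<lambda>_. ennreal p)) g"
    using g unfolding p_def using lborel_block_map [of \<Lambda> \<kappa>] by metis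
  then have "integrable (distr lborel borel (block_map \<Lambda> \<kappa>)) (\<lambda>t. p *\<^sub>R g t)"
    using p by (subst (asm) integrable_density) auto
  from integrable_scaleR_right [OF this, of "1 / p"]
  have "integrable (distr lborel borel (block_map \<Lambda> \<kappa>)) g"
    using p by simp
  then show "integrable lborel (\<lambda>u. g (block_map \<Lambda> \<kappa> u))"
    by (subst (asm) integrable_distr_eq) auto
qed

text \<open>The integral over each product of blocks is pulled back to one and the same cube, and the
  finite sum over the products is taken under the integral. Thus a bound for the sum at fixed
  parameters \<open>u\<close> bounds the integral over finitely many products, and dominated convergence
  exhausts the cube.\<close>

lemma norm_integral_blocks_le:
  fixes g :: "real ^ 'n::finite \<Rightarrow> complex"
  assumes g: "integrable lborel g" and g0: "\<And>t. t \<notin> cube \<Longrightarrow> g t = 0"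
    and B: "\<And>N u. u \<in> cube \<Longrightarrow> cmod (\<Sum>\<kappa>\<in>PiE \<Lambda> (\<lambda>_. UNIV \<times> {..<N}).
      of_real (\<Prod>i\<in>\<Lambda>. weight (\<kappa> i)) * g (block_map \<Lambda> \<kappa> u)) \<le> B"
  shows "cmod (LINT t|lborel. g t) \<le> B"
proof -
  let ?K = "\<lambda>N. PiE \<Lambda> (\<lambda>_. UNIV \<times> {..<N}) :: ('n \<Rightarrow> bool \<times> nat) set"
  have finK: "finite (?K N)" for N by (intro finite_PiE) auto
  have [measurable]: "g \<in> borel_measurable borel" using borel_measurable_integrable [OF g] by simp
  define \<chi>N where "\<chi>N N t = (\<Sum>\<kappa>\<in>?K N. indicator (block_box \<Lambda> \<kappa>) t :: real)" for N :: nat and t :: "real ^ 'n"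
  define s where "s N t = \<chi>N N t *\<^sub>R g t" for N t
  have \<chi>N: "\<chi>N N t = (\<Prod>i\<in>\<Lambda>. \<Sum>k\<in>UNIV \<times> {..<N}. indicator (block_set k) (t $ i))" if "t \<in> cube" for N t
  proof -
    have "\<chi>N N t = (\<Sum>\<kappa>\<in>?K N. \<Prod>i\<in>\<Lambda>. indicator (block_set (\<kappa> i)) (t $ i))"
      unfolding \<chi>N_def
    proof (rule sum.cong [OF refl])
      fix \<kappa>
      show "(indicator (block_box \<Lambda> \<kappa>) t :: real) = (\<Prod>i\<in>\<Lambda>. indicator (block_set (\<kappa> i)) (t $ i))"
        using that by (cases "\<forall>i\<in>\<Lambda>. t $ i \<in> block_set (\<kappa> i)") (auto simp: block_box_def cube_def indicator_def)
    qed
    also have "\<dots> = (\<Prod>i\<in>\<Lambda>. \<Sum>k\<in>UNIV \<times> {..<N}. indicator (block_set k) (t $ i))"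
      by (subst prod_sum_PiE) auto
    finally show ?thesis .
  qed
  have \<chi>01: "0 \<le> \<chi>N N t" "\<chi>N N t \<le> 1" if "t \<in> cube" for N t
    unfolding \<chi>N [OF that]
    by (auto intro!: prod_nonneg prod_le_1 sum_nonneg sum_block_indicator(1))
  have s_le: "norm (s N t) \<le> norm (g t)" for N t
  proof (cases "t \<in> cube")
    case True
    then show ?thesis using \<chi>01 [of t N] mult_right_mono [of "\<chi>N N t" 1 "norm (g t)"] by (simp add: s_def)
  qed (simp add: s_def g0)
  have lim: "AE t in lborel. (\<lambda>N. s N t) \<longlonglongrightarrow> g t"
    using AE_coordinates_notin [OF countable_dyadic_points]
  proof (rule AE_mp, intro AE_I2 impI)
    fix t :: "real ^ 'n" assume nd: "\<forall>i. t $ i \<notin> dyadic_points"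
    show "(\<lambda>N. s N t) \<longlonglongrightarrow> g t"
    proof (cases "t \<in> cube")
      case True
      have "\<exists>k. t $ i \<in> block_set k" for i
        using True nd by (intro block_set_exists) (auto simp: cube_def)
      then obtain k where k: "\<And>i. t $ i \<in> block_set (k i)" by metis
      define N0 where "N0 = Suc (Max (range (\<lambda>i. snd (k i))))"
      have "s N t = g t" if "N \<ge> N0" for N
      proof -
        have "k i \<in> UNIV \<times> {..<N}" for i
        proof -
          have "snd (k i) \<le> Max (range (\<lambda>i. snd (k i)))" by (intro Max_ge) auto
          then have "snd (k i) < N" using that unfolding N0_def by linarith
          then show ?thesis by (simp add: mem_Times_iff)
        qed
        then have "(\<Sum>j\<in>UNIV \<times> {..<N}. indicator (block_set j) (t $ i) :: real) = 1" for i
          by (intro sum_block_indicator(2) [OF _ _ k]) auto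
        then show ?thesis by (simp add: s_def \<chi>N [OF True])
      qed
      then show ?thesis by (intro tendsto_eventually) (auto simp: eventually_sequentially)
    qed (simp add: s_def g0)
  qed
  have sm: "s N \<in> borel_measurable lborel" for N
    unfolding s_def \<chi>N_def by measurable
  have "(\<lambda>N. LINT t|lborel. s N t) \<longlonglongrightarrow> (LINT t|lborel. g t)"
    by (rule integral_dominated_convergence [where w = "\<lambda>t. norm (g t)"])
       (use g sm lim s_le in auto)
  moreover have "cmod (LINT t|lborel. s N t) \<le> B" for N
  proof -
    let ?p = "\<lambda>\<kappa>. \<Prod>i\<in>\<Lambda>. weight (\<kappa> i)"
    have int1: "integrable lborel (\<lambda>t. indicator (block_box \<Lambda> \<kappa>) t *\<^sub>R g t)" for \<kappa>
      by (rule integrable_mult_indicator [OF _ g]) auto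
    have ind: "indicator (block_box \<Lambda> \<kappa>) (block_map \<Lambda> \<kappa> u) = indicator cube u" for \<kappa> and u :: "real ^ 'n"
      by (simp add: indicator_def block_map_in_box)
    have int2: "integrable lborel (\<lambda>u. indicator cube u *\<^sub>R g (block_map \<Lambda> \<kappa> u))" for \<kappa>
      using block_map_integral(2) [OF int1 [of \<kappa>], where \<Lambda> = \<Lambda> and \<kappa> = \<kappa>] unfolding ind .
    have "(LINT t|lborel. s N t) = (LINT t|lborel. (\<Sum>\<kappa>\<in>?K N. indicator (block_box \<Lambda> \<kappa>) t *\<^sub>R g t))"
      by (simp add: s_def \<chi>N_def scaleR_sum_left)
    also have "\<dots> = (\<Sum>\<kappa>\<in>?K N. LINT t|lborel. indicator (block_box \<Lambda> \<kappa>) t *\<^sub>R g t)"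
      by (rule Bochner_Integration.integral_sum) (rule int1)
    also have "\<dots> = (\<Sum>\<kappa>\<in>?K N. of_real (?p \<kappa>) * (LINT u|lborel. indicator cube u *\<^sub>R g (block_map \<Lambda> \<kappa> u)))"
    proof (rule sum.cong [OF refl])
      fix \<kappa>
      show "(LINT t|lborel. indicator (block_box \<Lambda> \<kappa>) t *\<^sub>R g t)
          = of_real (?p \<kappa>) * (LINT u|lborel. indicator cube u *\<^sub>R g (block_map \<Lambda> \<kappa> u))"
        using block_map_integral(1) [OF int1 [of \<kappa>], where \<Lambda> = \<Lambda> and \<kappa> = \<kappa>] unfolding ind .
    qed
    also have "\<dots> = (\<Sum>\<kappa>\<in>?K N. (LINT u|lborel. of_real (?p \<kappa>) * (indicator cube u *\<^sub>R g (block_map \<Lambda> \<kappa> u))))"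
      by (simp only: integral_mult_right_zero)
    also have "\<dots> = (LINT u|lborel. (\<Sum>\<kappa>\<in>?K N. of_real (?p \<kappa>) * (indicator cube u *\<^sub>R g (block_map \<Lambda> \<kappa> u))))"
      by (intro Bochner_Integration.integral_sum [symmetric] integrable_mult_right int2)
    finally have eq: "(LINT t|lborel. s N t)
      = (LINT u|lborel. (\<Sum>\<kappa>\<in>?K N. of_real (?p \<kappa>) * (indicator cube u *\<^sub>R g (block_map \<Lambda> \<kappa> u))))" .
    have "cmod (LINT t|lborel. s N t) \<le> (LINT u|lborel. cmod (\<Sum>\<kappa>\<in>?K N. of_real (?p \<kappa>) * (indicator cube u *\<^sub>R g (block_map \<Lambda> \<kappa> u))))"
      unfolding eq by (rule integral_norm_bound)
    also have "\<dots> \<le> (LINT u|lborel. indicator (cube :: (real ^ 'n) set) u *\<^sub>R B)"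
    proof (rule integral_mono)
      show "integrable lborel (\<lambda>u. cmod (\<Sum>\<kappa>\<in>?K N. of_real (?p \<kappa>) * (indicator cube u *\<^sub>R g (block_map \<Lambda> \<kappa> u))))"
        by (intro integrable_norm Bochner_Integration.integrable_sum integrable_mult_right int2)
      show "integrable lborel (\<lambda>u. indicator (cube :: (real ^ 'n) set) u *\<^sub>R B)"
        by (intro integrable_scaleR_left integrable_real_indicator) (auto simp: measure_cube)
      show "cmod (\<Sum>\<kappa>\<in>?K N. of_real (?p \<kappa>) * (indicator cube u *\<^sub>R g (block_map \<Lambda> \<kappa> u))) \<le> indicator cube u *\<^sub>R B" for u
        using B [of u N] by (cases "u \<in> cube") auto
    qed
    also have "\<dots> = B" by (simp add: measure_cube)
    finally show ?thesis .
  qed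
  ultimately show ?thesis
    by (intro tendsto_upperbound [OF tendsto_norm]) (auto intro!: always_eventually)
qed

section \<open>Norming functionals\<close>

text \<open>Hahn-Banach: a maximal partial linear functional, given by its graph, that is dominated by
  the norm is defined everywhere. A dominated subspace of the product is automatically a graph.\<close>

lemma norming_functional_real:
  fixes v :: "'a::real_normed_vector"
  shows "\<exists>u. linear u \<and> (\<forall>x. u x \<le> norm x) \<and> u v = norm v"
proof -
  define \<G> where "\<G> = {G :: ('a \<times> real) set. subspace G \<and> (\<forall>p\<in>G. snd p \<le> norm (fst p)) \<and> (v, norm v) \<in> G}"
  have start: "span {(v, norm v)} \<in> \<G>"
    unfolding \<G>_def
  proof (intro CollectI conjI ballI subspace_span)
    show "(v, norm v) \<in> span {(v, norm v)}" by (rule span_base) simp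
    show "snd p \<le> norm (fst p)" if "p \<in> span {(v, norm v)}" for p
      using that by (auto simp: span_singleton intro!: mult_right_mono)
  qed
  have "\<exists>U\<in>\<G>. \<forall>X\<in>Ch. X \<subseteq> U" if ch: "subset.chain \<G> Ch" for Ch
  proof (cases "Ch = {}")
    case True
    then show ?thesis using start by auto
  next
    case False
    have Ch: "Ch \<subseteq> \<G>" "\<And>X Y. X \<in> Ch \<Longrightarrow> Y \<in> Ch \<Longrightarrow> X \<subseteq> Y \<or> Y \<subseteq> X"
      using ch by (auto simp: subset_chain_def)
    have sub: "subspace X" if "X \<in> Ch" for X using Ch(1) that by (auto simp: \<G>_def)
    have "\<Union>Ch \<in> \<G>"
      unfolding \<G>_def
    proof (intro CollectI conjI ballI)
      show "subspace (\<Union>Ch)"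
      proof (rule subspaceI)
        show "0 \<in> \<Union>Ch" using False sub subspace_0 by blast
        show "x + y \<in> \<Union>Ch" if "x \<in> \<Union>Ch" "y \<in> \<Union>Ch" for x y
        proof -
          from that obtain X Y where XY: "X \<in> Ch" "Y \<in> Ch" "x \<in> X" "y \<in> Y" by blast
          then have "(x \<in> Y \<or> y \<in> X)" using Ch(2) [of X Y] by blast
          then show ?thesis using XY sub subspace_add by blast
        qed
        show "r *\<^sub>R x \<in> \<Union>Ch" if "x \<in> \<Union>Ch" for r x
          using that sub subspace_scale by blast
      qed
      show "snd p \<le> norm (fst p)" if "p \<in> \<Union>Ch" for p using that Ch(1) by (auto simp: \<G>_def)
      show "(v, norm v) \<in> \<Union>Ch" using False Ch(1) by (auto simp: \<G>_def)
    qed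
    then show ?thesis by blast
  qed
  then obtain G where G: "G \<in> \<G>" and max: "\<And>X. X \<in> \<G> \<Longrightarrow> G \<subseteq> X \<Longrightarrow> X = G"
    using subset_Zorn [of \<G>] by metis
  have sG: "subspace G" and dom: "\<And>x y. (x, y) \<in> G \<Longrightarrow> y \<le> norm x" and vG: "(v, norm v) \<in> G"
    using G by (auto simp: \<G>_def)
  have ext: "\<exists>y. (w, y) \<in> G" for w
  proof (rule ccontr)
    assume no: "\<nexists>y. (w, y) \<in> G"
    define L where "L = (\<lambda>p. snd p - norm (fst p - w)) ` G"
    have bd: "y1 - norm (x1 - w) \<le> norm (x2 + w) - y2" if "(x1, y1) \<in> G" "(x2, y2) \<in> G" for x1 y1 x2 y2
    proof -
      have "(x1 + x2, y1 + y2) \<in> G" using subspace_add [OF sG that] by simp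
      then have "y1 + y2 \<le> norm ((x1 - w) + (x2 + w))" using dom by force
      also have "\<dots> \<le> norm (x1 - w) + norm (x2 + w)" by (rule norm_triangle_ineq)
      finally show ?thesis by simp
    qed
    define r where "r = Sup L"
    have L0: "L \<noteq> {}" using vG by (auto simp: L_def)
    have upper: "r \<le> norm (x2 + w) - y2" if "(x2, y2) \<in> G" for x2 y2
      unfolding r_def using bd that by (intro cSup_least L0) (auto simp: L_def)
    have "bdd_above L" 
      unfolding L_def by (rule bdd_aboveI2 [where M = "norm (v + w) - norm v"]) (use bd vG in force)
    then have lower: "y1 - norm (x1 - w) \<le> r" if "(x1, y1) \<in> G" for x1 y1
      unfolding r_def using that by (intro cSup_upper) (auto simp: L_def intro: rev_image_eqI)
    define G' where "G' = {p + q |p q. p \<in> G \<and> q \<in> span {(w, r)}}"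
    have "G' \<in> \<G>"
      unfolding \<G>_def
    proof (intro CollectI conjI ballI)
      show "subspace G'" unfolding G'_def by (intro subspace_sums sG subspace_span)
      have "(v, norm v) + 0 \<in> G'" unfolding G'_def using vG span_zero by blast
      then show "(v, norm v) \<in> G'" by simp
      fix p assume "p \<in> G'"
      then obtain x y t where xy: "(x, y) \<in> G" and p: "p = (x + t *\<^sub>R w, y + t * r)"
        by (auto simp: G'_def span_singleton)
      have "y + t * r \<le> norm (x + t *\<^sub>R w)"
      proof -
        have sc: "(inverse \<bar>t\<bar> *\<^sub>R x, inverse \<bar>t\<bar> * y) \<in> G" if "t \<noteq> 0"
          using subspace_scale [OF sG xy, of "inverse \<bar>t\<bar>"] by simp
        consider "t = 0" | "t > 0" | "t < 0" by linarith
        then show ?thesis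
        proof cases
          case 1 then show ?thesis using dom [OF xy] by simp
        next
          case 2
          have "r \<le> norm (inverse t *\<^sub>R x + w) - inverse t * y" using upper sc 2 by simp
          then have "t * r \<le> t * (norm (inverse t *\<^sub>R x + w) - inverse t * y)" using 2 by (intro mult_left_mono) auto
          also have "\<dots> = norm (t *\<^sub>R (inverse t *\<^sub>R x + w)) - y"
            using 2 unfolding norm_scaleR right_diff_distrib by simp
          finally show ?thesis using 2 by (simp add: scaleR_add_right)
        next
          case 3
          define s where "s = - t"
          have s: "s > 0" using 3 by (simp add: s_def)
          have "inverse s * y - norm (inverse s *\<^sub>R x - w) \<le> r" using lower sc 3 by (simp add: s_def)
          then have "s * (inverse s * y - norm (inverse s *\<^sub>R x - w)) \<le> s * r" using s by (intro mult_left_mono) auto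
          moreover have "s * (inverse s * y - norm (inverse s *\<^sub>R x - w)) = y - norm (s *\<^sub>R (inverse s *\<^sub>R x - w))"
            using s unfolding norm_scaleR right_diff_distrib by simp
          moreover have "s *\<^sub>R (inverse s *\<^sub>R x - w) = x + t *\<^sub>R w" using s by (simp add: scaleR_diff_right s_def)
          ultimately have "y - norm (x + t *\<^sub>R w) \<le> s * r" by (simp only:)
          then show ?thesis by (simp add: s_def)
        qed
      qed
      then show "snd p \<le> norm (fst p)" by (simp add: p)
    qed
    moreover have "G \<subseteq> G'"
    proof
      fix p assume "p \<in> G"
      then have "p + 0 \<in> G'" unfolding G'_def using span_zero by blast
      then show "p \<in> G'" by simp
    qed
    ultimately have "G' = G" by (rule max)
    moreover have "0 + (w, r) \<in> G'" unfolding G'_def using subspace_0 [OF sG] span_base by blast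
    ultimately show False using no by auto
  qed
  have uniq: "y = y'" if "(x, y) \<in> G" "(x, y') \<in> G" for x y y'
    using dom [of 0 "y - y'"] dom [of 0 "y' - y"] subspace_diff [OF sG that] subspace_diff [OF sG that(2,1)] by simp
  define u where "u x = (THE y. (x, y) \<in> G)" for x
  have uG: "(x, u x) \<in> G" for x
    unfolding u_def using ext [of x] uniq by (metis theI)
  have "linear u"
  proof (rule linearI)
    show "u (x + y) = u x + u y" for x y
      using subspace_add [OF sG uG uG, of x y] by (intro uniq [OF uG]) simp
    show "u (r *\<^sub>R x) = r *\<^sub>R u x" for r x
      using subspace_scale [OF sG uG, of r x] by (intro uniq [OF uG]) simp
  qed
  moreover have "u v = norm v" by (rule uniq [OF uG vG])
  ultimately show ?thesis using dom [OF uG] by blast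
qed

text \<open>A real functional \<open>u\<close> is completed to the complex functional \<open>x \<mapsto> u x - \<i> u (\<i> x)\<close>.
  Estimating real and imaginary part separately costs a factor \<open>2\<close>.\<close>

lemma norming_functional:
  fixes v :: "'a::complex_normed_vector"
  shows "\<exists>l. complex_functional l \<and> (\<forall>x. cmod (l x) \<le> 2 * norm x) \<and> norm v \<le> cmod (l v)"
proof -
  obtain u where u: "linear u" "\<And>x. u x \<le> norm x" "u v = norm v" using norming_functional_real [of v] by blast
  have abs: "\<bar>u x\<bar> \<le> norm x" for x
    using u(2) [of x] u(2) [of "- x"] linear_neg [OF u(1), of x] by simp
  define l where "l x = Complex (u x) (- u (\<i> *\<^sub>C x))" for x
  have two: "cmod (l x) \<le> 2 * norm x" for x
    using cmod_le [of "l x"] abs [of x] abs [of "\<i> *\<^sub>C x"] by (simp add: l_def norm_scaleC)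
  have lin: "linear l"
    by (rule linearI) (simp_all add: l_def complex_eq_iff scaleC_add_right linear_add [OF u(1)] linear_scale [OF u(1)]
        scaleC.scaleR_right)
  have "bounded_linear l"
    unfolding bounded_linear_def bounded_linear_axioms_def
    using lin two by (auto simp: linear_conv_bounded_linear linear_def mult.commute intro!: exI [of _ 2])
  moreover have "l (c *\<^sub>C x) = c * l x" for c x
  proof -
    have re: "u (complex_of_real r *\<^sub>C y) = r * u y" for r y by (simp add: scaleC_of_real linear_scale [OF u(1)])
    have dec: "u (c *\<^sub>C y) = Re c * u y + Im c * u (\<i> *\<^sub>C y)" for c y
    proof -
      have "c *\<^sub>C y = complex_of_real (Re c) *\<^sub>C y + complex_of_real (Im c) *\<^sub>C \<i> *\<^sub>C y"
      proof -
        have "c = complex_of_real (Re c) + complex_of_real (Im c) * \<i>" by (simp add: complex_eq_iff)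
        then show ?thesis unfolding scaleC_scaleC scaleC_add_left [symmetric] by (rule arg_cong)
      qed
      then show ?thesis by (simp add: linear_add [OF u(1)] re)
    qed
    have "u (\<i> *\<^sub>C c *\<^sub>C x) = Re c * u (\<i> *\<^sub>C x) - Im c * u x"
      using dec [of "\<i> * c" x] by (simp add: scaleC_scaleC)
    then show ?thesis by (simp add: l_def complex_eq_iff dec [of c x])
  qed
  moreover have "norm v \<le> cmod (l v)" using abs_Re_le_cmod [of "l v"] u(3) by (simp add: l_def)
  ultimately show ?thesis using two unfolding complex_functional_def by blast
qed

section \<open>Cauchy integrals over products of Stolz boundaries\<close>

lemma integrable_powr_endpoints:
  assumes a: "a > -1" "a \<le> (0::real)" and c: "c > 0"
  shows "integrable lborel (\<lambda>y. indicator {0<..<1} y * (c * min y (1 - y)) powr a :: real)"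
proof -
  have 1: "integrable lborel (\<lambda>y. indicator {0<..1} y * y powr a :: real)"
  proof -
    have "(\<lambda>y. y powr a) absolutely_integrable_on {0<..1}"
      using integrable_on_powr_from_0' [of a 1] a by (intro nonnegative_absolutely_integrable_1) auto
    then show ?thesis
      unfolding set_integrable_def by (subst (asm) integrable_completion) auto
  qed
  have 2: "integrable lborel (\<lambda>y. indicator {0<..1} (1 - y) * (1 - y) powr a :: real)"
    using lborel_integrable_real_affine [OF 1, of "-1" 1] by simp
  have "integrable lborel (\<lambda>y. c powr a * (indicator {0<..1} y * y powr a + indicator {0<..1} (1 - y) * (1 - y) powr a))"
    using 1 2 by (intro integrable_mult_right Bochner_Integration.integrable_add)
  then show ?thesis
  proof (rule Bochner_Integration.integrable_bound)
    show "AE y in lborel. norm (indicator {0<..<1} y * (c * min y (1 - y)) powr a :: real)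
        \<le> norm (c powr a * (indicator {0<..1} y * y powr a + indicator {0<..1} (1 - y) * (1 - y) powr a))"
    proof (intro AE_I2)
      fix y :: real
      show "norm (indicator {0<..<1} y * (c * min y (1 - y)) powr a :: real)
        \<le> norm (c powr a * (indicator {0<..1} y * y powr a + indicator {0<..1} (1 - y) * (1 - y) powr a))"
      proof (cases "y \<in> {0<..<1}")
        case True
        have "(c * min y (1 - y)) powr a = c powr a * (min y (1 - y)) powr a"
          by (rule powr_mult)
        also have "\<dots> \<le> c powr a * (y powr a + (1 - y) powr a)"
          by (intro mult_left_mono) (auto simp: min_def)
        finally show ?thesis using True by (simp add: abs_mult)
      qed simp
    qed
  qed measurable
qed

context commuting_family
begin

lemma continuous_on_op_prod:
  fixes \<Lambda> :: "'n set"
  assumes "\<And>i. i \<in> \<Lambda> \<Longrightarrow> continuous_on S (F i)" "\<And>i x. i \<in> \<Lambda> \<Longrightarrow> x \<in> S \<Longrightarrow> F i x \<in> \<A>"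
  shows "continuous_on S (\<lambda>x. op_prod (\<lambda>i. F i x) \<Lambda>)"
  using finite [of \<Lambda>] assms
proof (induction \<Lambda> rule: finite_induct)
  case (insert j J)
  have "continuous_on S (\<lambda>x. F j x o\<^sub>L op_prod (\<lambda>i. F i x) J)"
    using insert by (intro opcomp.continuous_on) auto
  moreover have "op_prod (\<lambda>i. F i x) (insert j J) = F j x o\<^sub>L op_prod (\<lambda>i. F i x) J" if "x \<in> S" for x
    using insert that by (intro op_prod_insert) auto
  ultimately show ?case by (simp cong: continuous_on_cong)
qed auto

lemma op_prod_remove:
  fixes \<Lambda> :: "'n set"
  assumes "\<And>i. i \<in> \<Lambda> \<Longrightarrow> S i \<in> \<A>" "j \<in> \<Lambda>"
  shows "op_prod S \<Lambda> = S j o\<^sub>L op_prod S (\<Lambda> - {j})"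
  using op_prod_insert [of j "\<Lambda> - {j}" S] assms by (simp add: insert_absorb)

end

lemma op_holomorphic_continuous_on: "op_holomorphic F S \<Longrightarrow> continuous_on S F"
  unfolding op_holomorphic_def
  by (intro continuous_at_imp_continuous_on) (auto intro: has_derivative_continuous)

lemma holomorphic_several_coordinate:
  fixes f :: "complex ^ 'n::finite \<Rightarrow> complex"
  assumes f: "holomorphic_several f U" and S: "open S"
    and U: "\<And>w. w \<in> S \<Longrightarrow> (\<chi> i. if i = j then w else z $ i) \<in> U"
  shows "(\<lambda>w. f (\<chi> i. if i = j then w else z $ i)) holomorphic_on S"
  unfolding holomorphic_on_def
proof
  fix w assume w: "w \<in> S"
  let ?z = "\<lambda>w. (\<chi> i. if i = j then w else z $ i)"
  obtain d where d: "(f has_derivative d) (at (?z w))" "\<And>c v. d (c *s v) = c * d v"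
    using f U [OF w] unfolding holomorphic_several_def by blast
  let ?e = "\<lambda>h::complex. (\<chi> i. if i = j then h else 0) :: complex ^ 'n"
  have "linear ?e" by (rule linearI) (auto simp: vec_eq_iff)
  then have "(?e has_derivative ?e) (at w)"
    by (intro bounded_linear_imp_has_derivative) (simp add: linear_conv_bounded_linear)
  then have "((\<lambda>w. ?e w + (\<chi> i. if i = j then 0 else z $ i)) has_derivative ?e) (at w)"
    by (rule has_derivative_add_const)
  moreover have "(\<lambda>w. ?e w + (\<chi> i. if i = j then 0 else z $ i)) = ?z"
    by (auto simp: fun_eq_iff vec_eq_iff)
  ultimately have "(?z has_derivative ?e) (at w)" by simp
  then have "((\<lambda>w. f (?z w)) has_derivative (\<lambda>h. d (\<chi> i. if i = j then h else 0))) (at w)"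
    by (rule has_derivative_compose [where g = f and f = ?z, OF _ d(1)])
  moreover have "(\<lambda>h. d (\<chi> i. if i = j then h else 0)) = (*) (d (\<chi> i. if i = j then 1 else 0))"
  proof
    fix h :: complex
    have "(\<chi> i. if i = j then h else 0) = h *s (\<chi> i. if i = j then 1 else 0)" by (simp add: vec_eq_iff)
    then show "d (\<chi> i. if i = j then h else 0) = d (\<chi> i. if i = j then 1 else 0) * h"
      by (simp only: d(2) mult.commute)
  qed
  ultimately have "((\<lambda>w. f (?z w)) has_field_derivative d (\<chi> i. if i = j then 1 else 0)) (at w)"
    by (simp only: has_field_derivative_def)
  then show "(\<lambda>w. f (?z w)) field_differentiable at w within S"
    by (meson field_differentiable_at_within field_differentiable_def)
qed

lemma holomorphic_several_continuous_on: "holomorphic_several f U \<Longrightarrow> continuous_on U f"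
  unfolding holomorphic_several_def
  by (intro continuous_at_imp_continuous_on ballI) (metis has_derivative_continuous)

lemma (in stolz_calculus) zero_in_domain: "0 \<in> stolz (\<gamma> i)"
  using angles [of i] pi_gt_zero by (intro zero_in_stolz) linarith+

text \<open>The Cauchy integral of \<open>f\<close> tested with a functional \<open>l\<close>, so that scalar Lebesgue integrals
  suffice. The decay of \<open>f\<close> gives convergence and Cauchy's theorem, the estimate is in terms of
  the bound \<open>F\<close>.\<close>

locale H0_integral = stolz_calculus T C D c E \<gamma> b
  for T :: "'n::finite \<Rightarrow> 'x::complex_banach \<Rightarrow>\<^sub>L 'x" and C D c E \<gamma> b +
  fixes \<Lambda> :: "'n set" and f :: "complex ^ 'n \<Rightarrow> complex" and c0 F :: real and s :: "'n \<Rightarrow> real"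
    and l :: "('x \<Rightarrow>\<^sub>L 'x) \<Rightarrow> complex"
  assumes f_hol: "holomorphic_several f (stolz_prod \<gamma>)"
    and f_bound: "z \<in> stolz_prod \<gamma> \<Longrightarrow> cmod (f z) \<le> F"
    and f_decay: "z \<in> stolz_prod \<gamma> \<Longrightarrow> cmod (f z) \<le> c0 * (\<Prod>i\<in>\<Lambda>. cmod (1 - z $ i) powr s i)"
    and c0: "c0 > 0" and s: "i \<in> \<Lambda> \<Longrightarrow> 0 < s i \<and> s i \<le> 1"
    and l: "complex_functional l" and l_bound: "cmod (l W) \<le> 2 * norm W"
begin

definition pt :: "real ^ 'n \<Rightarrow> complex ^ 'n"
  where "pt t = (\<chi> i. if i \<in> \<Lambda> then stolz_path (b i) (t $ i) else 0)"

text \<open>The parameters at which the boundary path is differentiable in all coordinates.\<close>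

definition params :: "(real ^ 'n) set"
  where "params = {t. \<forall>i. t $ i \<in> stolz_params}"

text \<open>The Cauchy integrand with kernels \<open>V\<^sub>i\<close> in place of the resolvents.\<close>

definition integrand :: "('n \<Rightarrow> complex \<Rightarrow> 'x \<Rightarrow>\<^sub>L 'x) \<Rightarrow> real ^ 'n \<Rightarrow> complex"
  where "integrand V t = f (pt t) * (\<Prod>i\<in>\<Lambda>. stolz_deriv (b i) (t $ i)) *
    l (op_prod (\<lambda>i. V i (stolz_path (b i) (t $ i))) \<Lambda>)"

definition G :: "('n \<Rightarrow> complex \<Rightarrow> 'x \<Rightarrow>\<^sub>L 'x) \<Rightarrow> real ^ 'n \<Rightarrow> complex"
  where "G V t = indicator params t *\<^sub>R integrand V t"

definition H_const :: "real \<Rightarrow> real"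
  where "H_const q = (2 * (1 + 2 * C / q) + (1 + 2 * C / q) ^ 3) * C / q"

definition M :: real where "M = D + H_const (c\<^sup>2 / 4)"

text \<open>Kernels that satisfy the estimate of the resolvent, with a common constant. The integrals of
  such kernels converge absolutely.\<close>

definition controlled :: "('n \<Rightarrow> complex \<Rightarrow> 'x \<Rightarrow>\<^sub>L 'x) \<Rightarrow> bool"
  where "controlled V \<longleftrightarrow> (\<forall>i\<in>\<Lambda>. continuous_on {0<..<1} (\<lambda>t. V i (stolz_path (b i) t)) \<and>
    (\<forall>t\<in>{0<..<1}. V i (stolz_path (b i) t) \<in> \<A> \<and>
       norm (V i (stolz_path (b i) t)) \<le> M / cmod (1 - stolz_path (b i) t)))"

lemma H_const_nonneg: "q > 0 \<Longrightarrow> H_const q \<ge> 0"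
  using C by (simp add: H_const_def)

lemma M_nonneg: "M \<ge> 0"
  using D_nonneg H_const_nonneg [of "c\<^sup>2 / 4"] c by (simp add: M_def)

lemma stolz_params_unit: "t \<in> stolz_params \<Longrightarrow> t \<in> {0<..<1}"
  by (simp add: stolz_params_def)

lemma one_minus_path_pos: "t \<in> {0<..<1} \<Longrightarrow> cmod (1 - stolz_path (b k) t) > 0"
  using path_point(1) [of t k] by auto

lemma continuous_on_stolz_path: "continuous_on {0<..<1} (stolz_path a)"
  by (rule continuous_on_subset [OF path_stolz_path [unfolded path_def]]) auto

lemma norm_R_le: assumes "t \<in> {0<..<1}"
  shows "norm (R k (stolz_path (b k) t)) \<le> D / cmod (1 - stolz_path (b k) t)"
proof -
  have "norm ((stolz_path (b k) t - 1) *\<^sub>C R k (stolz_path (b k) t)) \<le> D"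
    by (rule rad_bounded_norm_le [OF rad_E path_point(7) [OF assms]])
  then show ?thesis
    using one_minus_path_pos [OF assms, of k]
    by (simp add: norm_scaleC norm_minus_commute pos_le_divide_eq mult.commute)
qed

lemma continuous_on_R_path: "continuous_on {0<..<1} (\<lambda>t. R k (stolz_path (b k) t))"
proof -
  let ?S = "stolz_path (b k) ` {0<..<1}"
  have "continuous_on ?S (R k)"
  proof (rule continuous_on_op_inverse [OF _ T_ops])
    show "is_op_inverse (z *\<^sub>C id_blinfun - T k) (R k z)" if "z \<in> ?S" for z
      using that path_point(6) by auto
    fix z assume "z \<in> ?S"
    then obtain t where t: "t \<in> {0<..<1}" "z = stolz_path (b k) t" by auto
    have z: "cmod (1 - z) > 0" using one_minus_path_pos [OF t(1)] t(2) by simp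
    show "\<exists>e>0. \<exists>B. \<forall>w\<in>?S. dist w z < e \<longrightarrow> norm (R k w) \<le> B"
    proof (intro exI conjI ballI impI)
      show "cmod (1 - z) / 2 > 0" using z by simp
      fix w assume w: "w \<in> ?S" "dist w z < cmod (1 - z) / 2"
      then obtain u where u: "u \<in> {0<..<1}" "w = stolz_path (b k) u" by auto
      have "cmod (1 - z) \<le> cmod (1 - w) + cmod (w - z)" using norm_triangle_ineq [of "1 - w" "w - z"] by simp
      then have "cmod (1 - w) \<ge> cmod (1 - z) / 2" using w by (simp add: dist_norm)
      then have "D / cmod (1 - w) \<le> D / (cmod (1 - z) / 2)"
        using z D_nonneg by (intro divide_left_mono mult_pos_pos) auto
      then show "norm (R k w) \<le> D / (cmod (1 - z) / 2)" using norm_R_le [OF u(1), of k] u(2) by simp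
    qed
  qed
  then show ?thesis using continuous_on_stolz_path by (rule continuous_on_compose2) auto
qed

lemma continuous_on_H_path: "continuous_on {0<..<1} (\<lambda>t. H k (stolz_path (b k) t))"
  by (rule continuous_on_compose2 [OF op_holomorphic_continuous_on [OF op_holomorphic_H] continuous_on_stolz_path])
     (auto intro: path_point(1))

lemma norm_H_path_le: assumes "t \<in> {0<..<1}"
  shows "norm (H k (stolz_path (b k) t)) \<le> H_const (c\<^sup>2 / 4) / cmod (1 - stolz_path (b k) t)"
  unfolding H_const_def
  by (rule norm_H_le) (use path_point [OF assms] c in auto)

text \<open>The mixed choices that occur when the resolvents \<open>R\<^sub>i\<close> are replaced by \<open>R\<^sub>i - H\<^sub>i\<close> one variable
  after the other.\<close>

lemma kernels_controlled:
  "controlled (\<lambda>i. if i \<in> K1 then R i else if i \<in> K2 then H i else (\<lambda>z. R i z - H i z))"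
proof -
  have RA: "R i (stolz_path (b i) t) \<in> \<A>" and HA: "H i (stolz_path (b i) t) \<in> \<A>" if "t \<in> {0<..<1}" for i t
    using that R_in_A kernel_A(4) path_point(1) by auto
  have K: "H_const (c\<^sup>2 / 4) \<ge> 0" using c by (intro H_const_nonneg) auto
  have R: "norm (R i (stolz_path (b i) t)) \<le> M / cmod (1 - stolz_path (b i) t)" if "t \<in> {0<..<1}" for i t
    by (rule order_trans [OF norm_R_le [OF that]]) (use K in \<open>auto simp: M_def intro!: divide_right_mono\<close>)
  have H: "norm (H i (stolz_path (b i) t)) \<le> M / cmod (1 - stolz_path (b i) t)" if "t \<in> {0<..<1}" for i t
    by (rule order_trans [OF norm_H_path_le [OF that]]) (use D_nonneg in \<open>auto simp: M_def intro!: divide_right_mono\<close>)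
  have RH: "norm (R i (stolz_path (b i) t) - H i (stolz_path (b i) t)) \<le> M / cmod (1 - stolz_path (b i) t)" if "t \<in> {0<..<1}" for i t
    using norm_triangle_ineq4 [of "R i (stolz_path (b i) t)" "H i (stolz_path (b i) t)"]
      norm_R_le [OF that, of i] norm_H_path_le [OF that, of i]
    by (simp add: M_def add_divide_distrib)
  show ?thesis unfolding controlled_def
  proof
    fix i
    consider "i \<in> K1" | "i \<notin> K1" "i \<in> K2" | "i \<notin> K1" "i \<notin> K2" by blast
    then show "continuous_on {0<..<1} (\<lambda>t. (if i \<in> K1 then R i else if i \<in> K2 then H i else (\<lambda>z. R i z - H i z)) (stolz_path (b i) t)) \<and>
      (\<forall>t\<in>{0<..<1}. (if i \<in> K1 then R i else if i \<in> K2 then H i else (\<lambda>z. R i z - H i z)) (stolz_path (b i) t) \<in> \<A> \<and>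
        norm ((if i \<in> K1 then R i else if i \<in> K2 then H i else (\<lambda>z. R i z - H i z)) (stolz_path (b i) t)) \<le> M / cmod (1 - stolz_path (b i) t))"
    proof cases
      case 1 then show ?thesis using continuous_on_R_path RA R by auto
    next
      case 2 then show ?thesis using continuous_on_H_path HA H by auto
    next
      case 3
      have "R i (stolz_path (b i) t) - H i (stolz_path (b i) t) \<in> \<A>" if "t \<in> {0<..<1}" for t
        by (rule bicommutant_diff [OF RA [OF that] HA [OF that]])
      then show ?thesis
        using 3 continuous_on_diff [OF continuous_on_R_path [of i] continuous_on_H_path [of i]] RH by auto
    qed
  qed
qed

lemma pt_in: "t \<in> params \<Longrightarrow> pt t \<in> stolz_prod \<gamma>"
  using path_point(5) stolz_params_unit zero_in_domain
  by (auto simp: pt_def stolz_prod_def params_def)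

lemma open_params: "open params"
proof -
  have eq: "params = (\<Inter>i. (\<lambda>t. t $ i) -` stolz_params)" by (auto simp: params_def)
  show ?thesis unfolding eq by (intro open_INT ballI open_vimage open_stolz_params continuous_intros) simp
qed

lemma G_measurable:
  assumes V: "controlled V" shows "G V \<in> borel_measurable borel"
proof -
  have im: "(\<lambda>t. t $ i) ` params \<subseteq> {0<..<1}" "(\<lambda>t. t $ i) ` params \<subseteq> stolz_params" for i
    by (auto simp: params_def stolz_params_def)
  have ci: "continuous_on params (\<lambda>t. t $ i)" for i by (intro continuous_intros)
  have "continuous_on params pt"
    unfolding pt_def
  proof (rule continuous_on_vec_lambda)
    show "continuous_on params (\<lambda>t. if i \<in> \<Lambda> then stolz_path (b i) (t $ i) else 0)" for i
      using continuous_on_compose2 [OF continuous_on_stolz_path ci im(1)] by (cases "i \<in> \<Lambda>") auto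
  qed
  then have "continuous_on params (\<lambda>t. f (pt t))"
    by (rule continuous_on_compose2 [OF holomorphic_several_continuous_on [OF f_hol]]) (auto intro: pt_in)
  moreover have "continuous_on params (\<lambda>t. \<Prod>i\<in>\<Lambda>. stolz_deriv (b i) (t $ i))"
    by (intro continuous_on_prod continuous_on_compose2 [OF continuous_stolz_deriv ci im(2)])
  moreover have "continuous_on params (\<lambda>t. l (op_prod (\<lambda>i. V i (stolz_path (b i) (t $ i))) \<Lambda>))"
  proof (rule bounded_linear.continuous_on [where f = l])
    show "bounded_linear l" using l by (simp add: complex_functional_def)
    show "continuous_on params (\<lambda>t. op_prod (\<lambda>i. V i (stolz_path (b i) (t $ i))) \<Lambda>)"
    proof (rule continuous_on_op_prod)
      fix i assume i: "i \<in> \<Lambda>"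
      have "continuous_on {0<..<1} (\<lambda>t. V i (stolz_path (b i) t))" using V i by (auto simp: controlled_def)
      then show "continuous_on params (\<lambda>t. V i (stolz_path (b i) (t $ i)))"
        using ci im(1) by (rule continuous_on_compose2)
      show "V i (stolz_path (b i) (t $ i)) \<in> \<A>" if "t \<in> params" for t
        using V i im(1) that unfolding controlled_def by blast
    qed
  qed
  ultimately have "continuous_on params (integrand V)"
    unfolding integrand_def [abs_def] by (intro continuous_on_mult)
  moreover have "params \<in> sets borel" using open_params by simp
  ultimately show ?thesis
    unfolding G_def [abs_def] by (intro borel_measurable_continuous_on_indicator)
qed

lemma G_integrable:
  assumes V: "controlled V" shows "integrable lborel (G V)"
proof -
  define h where "h i y = indicator {0<..<1} y * (c * min y (1 - y)) powr (if i \<in> \<Lambda> then s i - 1 else 0)" for i :: 'n and y :: real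
  define K where "K = c0 * (8 * pi) ^ card \<Lambda> * (2 * M ^ card \<Lambda>)"
  have hint: "integrable lborel (h i)" for i
    unfolding h_def using s c by (intro integrable_powr_endpoints) auto
  have "integrable lborel (\<lambda>t :: real ^ 'n. K * (\<Prod>i\<in>UNIV. h i (t $ i)))"
    by (intro integrable_mult_right integrable_prod_vec hint)
  then show ?thesis
  proof (rule Bochner_Integration.integrable_bound)
    show "G V \<in> borel_measurable lborel" using G_measurable [OF V] by simp
    show "AE t in lborel. norm (G V t) \<le> norm (K * (\<Prod>i\<in>UNIV. h i (t $ i)))"
    proof (intro AE_I2)
      fix t :: "real ^ 'n"
      show "norm (G V t) \<le> norm (K * (\<Prod>i\<in>UNIV. h i (t $ i)))"
      proof (cases "t \<in> params")
        case False then show ?thesis by (simp add: G_def)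
      next
        case True
        have ti: "t $ i \<in> {0<..<1}" for i using True stolz_params_unit by (auto simp: params_def)
        let ?m = "\<lambda>i. cmod (1 - stolz_path (b i) (t $ i))"
        have mpos: "?m i > 0" for i by (rule one_minus_path_pos [OF ti])
        have fle: "cmod (f (pt t)) \<le> c0 * (\<Prod>i\<in>\<Lambda>. ?m i powr s i)"
          using f_decay [OF pt_in [OF True]] by (simp add: pt_def)
        have dle: "cmod (\<Prod>i\<in>\<Lambda>. stolz_deriv (b i) (t $ i)) \<le> (8 * pi) ^ card \<Lambda>"
        proof -
          have "(\<Prod>i\<in>\<Lambda>. cmod (stolz_deriv (b i) (t $ i))) \<le> (\<Prod>i\<in>\<Lambda>. 8 * pi)"
            by (intro prod_mono) (simp add: norm_stolz_deriv [OF angles(1) b_less])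
          then show ?thesis by (simp add: prod_norm)
        qed
        have "norm (op_prod (\<lambda>i. V i (stolz_path (b i) (t $ i))) \<Lambda>) \<le> (\<Prod>i\<in>\<Lambda>. M / ?m i)"
          using V ti by (intro norm_op_prod_le) (auto simp: controlled_def)
        then have lle: "cmod (l (op_prod (\<lambda>i. V i (stolz_path (b i) (t $ i))) \<Lambda>)) \<le> 2 * (\<Prod>i\<in>\<Lambda>. M / ?m i)"
          using l_bound [of "op_prod (\<lambda>i. V i (stolz_path (b i) (t $ i))) \<Lambda>"] by linarith
        have "cmod (integrand V t) \<le> (c0 * (\<Prod>i\<in>\<Lambda>. ?m i powr s i)) * (8 * pi) ^ card \<Lambda> * (2 * (\<Prod>i\<in>\<Lambda>. M / ?m i))"
          unfolding integrand_def norm_mult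
          using c0 by (intro mult_mono fle dle lle mult_nonneg_nonneg prod_nonneg) auto
        also have "\<dots> = K * (\<Prod>i\<in>\<Lambda>. ?m i powr (s i - 1))"
          using mpos by (simp add: K_def prod.distrib prod_dividef powr_diff)
        also have "\<dots> \<le> K * (\<Prod>i\<in>UNIV. h i (t $ i))"
        proof (rule mult_left_mono)
          have "(\<Prod>i\<in>\<Lambda>. ?m i powr (s i - 1)) \<le> (\<Prod>i\<in>\<Lambda>. h i (t $ i))"
          proof (intro prod_mono conjI)
            fix i assume i: "i \<in> \<Lambda>"
            have "min (t $ i) (1 - t $ i) > 0" using ti [of i] by auto
            then have "?m i powr (s i - 1) \<le> (c * min (t $ i) (1 - t $ i)) powr (s i - 1)"
              using path_point(2) [OF ti, of i i] s [OF i] c by (intro powr_mono2') auto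
            then show "?m i powr (s i - 1) \<le> h i (t $ i)" using i ti [of i] by (simp add: h_def)
          qed simp
          also have "(\<Prod>i\<in>\<Lambda>. h i (t $ i)) = (\<Prod>i\<in>UNIV. h i (t $ i))"
          proof (rule prod.mono_neutral_left)
            show "\<forall>i\<in>UNIV - \<Lambda>. h i (t $ i) = 1"
            proof
              fix i assume "i \<in> UNIV - \<Lambda>"
              moreover have "c * min (t $ i) (1 - t $ i) \<noteq> 0" using ti [of i] c by (auto simp: min_def)
              ultimately show "h i (t $ i) = 1" using ti [of i] by (simp add: h_def)
            qed
          qed auto
          finally show "(\<Prod>i\<in>\<Lambda>. ?m i powr (s i - 1)) \<le> (\<Prod>i\<in>UNIV. h i (t $ i))" .
          show "K \<ge> 0" using c0 M_nonneg by (simp add: K_def)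
        qed
        finally show ?thesis using True by (simp add: G_def)
      qed
    qed
  qed
qed

text \<open>Freezing all variables but \<open>j\<close>, the integrand with \<open>H\<close> in place of the resolvent is the
  restriction to the path of a function that is holomorphic in the whole Stolz domain.\<close>

lemma G_regular_zero:
  assumes V: "controlled V" and j: "j \<in> \<Lambda>" "V j = H j"
  shows "(LINT t|lborel. G V t) = 0"
proof (rule integral_coordinate_zero [OF G_integrable [OF V], where j = j])
  fix x :: "real ^ 'n"
  let ?x = "\<lambda>y. (\<chi> i. if i = j then y else x $ i)"
  show "(LINT y|lborel. G V (?x y)) = 0"
  proof (cases "\<forall>i. i \<noteq> j \<longrightarrow> x $ i \<in> stolz_params")
    case False
    then have "?x y \<notin> params" for y by (auto simp: params_def)
    then have "G V (?x y) = 0" for y by (simp add: G_def)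
    then show ?thesis by simp
  next
    case True
    define W where "W = op_prod (\<lambda>i. V i (stolz_path (b i) (x $ i))) (\<Lambda> - {j})"
    define K where "K = (\<Prod>i\<in>\<Lambda> - {j}. stolz_deriv (b i) (x $ i))"
    define z0 :: "complex ^ 'n" where "z0 = (\<chi> i. if i \<in> \<Lambda> then stolz_path (b i) (x $ i) else 0)"
    define g where "g w = K * f (\<chi> i. if i = j then w else z0 $ i) * l (H j w o\<^sub>L W)" for w
    have xi: "x $ i \<in> {0<..<1}" if "i \<noteq> j" for i using True that stolz_params_unit by blast
    have VA: "V i (stolz_path (b i) (x $ i)) \<in> \<A>" if "i \<in> \<Lambda> - {j}" for i
      using V xi that by (auto simp: controlled_def)
    have WA: "W \<in> \<A>" unfolding W_def by (intro op_prod_A VA)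
    have z: "(\<chi> i. if i = j then w else z0 $ i) \<in> stolz_prod \<gamma>" if "w \<in> stolz (\<gamma> j)" for w
    proof -
      show ?thesis using that path_point(5) [OF xi] zero_in_domain by (auto simp: stolz_prod_def z0_def)
    qed
    have eq: "G V (?x y) = indicator stolz_params y *\<^sub>R (g (stolz_path (b j) y) * stolz_deriv (b j) y)" for y
    proof (cases "y \<in> stolz_params")
      case False
      then have "?x y \<notin> params" by (auto simp: params_def)
      then show ?thesis using False by (simp add: G_def)
    next
      case y: True
      then have "?x y \<in> params" using True by (simp add: params_def)
      moreover have "pt (?x y) = (\<chi> i. if i = j then stolz_path (b j) y else z0 $ i)"
        using j by (auto simp: pt_def z0_def vec_eq_iff)
      moreover have "(\<Prod>i\<in>\<Lambda>. stolz_deriv (b i) (?x y $ i)) = stolz_deriv (b j) y * K"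
        unfolding K_def using j(1) by (subst prod.remove [of _ j]) (auto intro!: prod.cong)
      moreover have "op_prod (\<lambda>i. V i (stolz_path (b i) (?x y $ i))) \<Lambda> = H j (stolz_path (b j) y) o\<^sub>L W"
      proof -
        have Vi: "V i (stolz_path (b i) (?x y $ i)) \<in> \<A>" if "i \<in> \<Lambda>" for i
          using V that xi [of i] stolz_params_unit [OF y] by (cases "i = j") (auto simp: controlled_def)
        have "op_prod (\<lambda>i. V i (stolz_path (b i) (?x y $ i))) (\<Lambda> - {j}) = W"
          unfolding W_def by (rule op_prod_cong) (use VA in auto)
        then show ?thesis
          using op_prod_remove [of \<Lambda> "\<lambda>i. V i (stolz_path (b i) (?x y $ i))", OF Vi j(1)] j(2) by simp
      qed
      ultimately show ?thesis using y by (simp add: G_def integrand_def g_def)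
    qed
    have "(LINT y:stolz_params|lborel. g (stolz_path (b j) y) * stolz_deriv (b j) y) = 0"
    proof (rule cauchy_stolz [OF angles, where s = "s j"])
      have sub: "stolz (\<gamma> j) \<subseteq> {z. Re z < 1}" using stolz_Re_less by auto
      have "op_holomorphic (\<lambda>w. H j w o\<^sub>L W) {z. Re z < 1}"
        using op_holomorphic_H bicommutant_bounded_ops [OF WA]
        by (intro op_holomorphic_comp op_holomorphic_const)
      then have "(\<lambda>w. l (H j w o\<^sub>L W)) holomorphic_on {z. Re z < 1}"
        by (rule op_holomorphic_functional [OF l]) (rule open_halfspace_Re_lt)
      then have "(\<lambda>w. l (H j w o\<^sub>L W)) holomorphic_on stolz (\<gamma> j)"
        by (rule holomorphic_on_subset [OF _ sub])
      moreover have "(\<lambda>w. f (\<chi> i. if i = j then w else z0 $ i)) holomorphic_on stolz (\<gamma> j)"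
        by (rule holomorphic_several_coordinate [OF f_hol open_stolz z])
      ultimately show "g holomorphic_on stolz (\<gamma> j)"
        unfolding g_def by (intro holomorphic_intros)
      show "0 < s j" "s j \<le> 1" using s [OF j(1)] by auto
      define q where "q = (1 - sin (\<gamma> j)) / 2"
      define P0 where "P0 = (\<Prod>i\<in>\<Lambda> - {j}. cmod (1 - z0 $ i) powr s i)"
      have P0: "P0 \<ge> 0" unfolding P0_def by (intro prod_nonneg) auto
      have q: "q > 0"
      proof -
        have "sin (\<gamma> j) < sin (pi / 2)" using angles [of j] by (intro sin_monotone_2pi) auto
        then show ?thesis by (simp add: q_def)
      qed
      fix w assume w: "w \<in> stolz (\<gamma> j)"
      have w0: "cmod (1 - w) > 0" using stolz_Re_less [OF w] by auto
      have "cmod (f (\<chi> i. if i = j then w else z0 $ i)) \<le> c0 * (cmod (1 - w) powr s j * P0)"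
        using f_decay [OF z [OF w]] unfolding P0_def
        by (subst (asm) prod.remove [of _ j]) (use j in \<open>auto cong: prod.cong_simp\<close>)
      moreover have "cmod (l (H j w o\<^sub>L W)) \<le> 2 * (H_const q / cmod (1 - w) * norm W)"
      proof -
        have "norm (H j w) \<le> H_const q / cmod (1 - w)"
          unfolding H_const_def
          by (rule norm_H_le [OF stolz_Re_less [OF w] q]) (use stolz_nontangential [OF w] in \<open>simp add: q_def\<close>)
        then have "norm (H j w o\<^sub>L W) \<le> H_const q / cmod (1 - w) * norm W" by (intro norm_opcomp_le) auto
        then show ?thesis using l_bound [of "H j w o\<^sub>L W"] by linarith
      qed
      ultimately have "cmod (g w) \<le> cmod K * (c0 * (cmod (1 - w) powr s j * P0)) * (2 * (H_const q / cmod (1 - w) * norm W))"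
        unfolding g_def norm_mult using c0 P0 by (intro mult_mono mult_nonneg_nonneg) auto
      also have "\<dots> = (cmod K * c0 * P0 * 2 * H_const q * norm W) * cmod (1 - w) powr (s j - 1)"
        using w0 by (simp add: powr_diff)
      finally show "cmod (g w) \<le> (cmod K * c0 * P0 * 2 * H_const q * norm W) * cmod (1 - w) powr (s j - 1)" .
    qed
    then show ?thesis by (simp add: eq set_lebesgue_integral_def)
  qed
qed

lemma G_split:
  assumes V: "controlled V" "controlled V1" "controlled V2" and j: "j \<in> \<Lambda>"
    and eq: "\<And>i. i \<noteq> j \<Longrightarrow> V i = V1 i \<and> V i = V2 i" and sum: "\<And>z. V j z = V1 j z + V2 j z"
  shows "G V t = G V1 t + G V2 t"
proof (cases "t \<in> params")
  case True
  have ti: "t $ i \<in> {0<..<1}" for i using True stolz_params_unit by (auto simp: params_def)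
  have VA: "X i (stolz_path (b i) (t $ i)) \<in> \<A>" if "controlled X" "i \<in> \<Lambda>" for X i
    using that ti [of i] unfolding controlled_def by blast
  have rem: "op_prod (\<lambda>i. X i (stolz_path (b i) (t $ i))) \<Lambda>
      = X j (stolz_path (b j) (t $ j)) o\<^sub>L op_prod (\<lambda>i. V i (stolz_path (b i) (t $ i))) (\<Lambda> - {j})"
    if X: "controlled X" and XV: "\<And>i. i \<noteq> j \<Longrightarrow> X i = V i" for X
  proof -
    have "op_prod (\<lambda>i. X i (stolz_path (b i) (t $ i))) (\<Lambda> - {j}) = op_prod (\<lambda>i. V i (stolz_path (b i) (t $ i))) (\<Lambda> - {j})"
      by (rule op_prod_cong) (use VA [OF V(1)] XV in auto)
    then show ?thesis
      using op_prod_remove [of \<Lambda> "\<lambda>i. X i (stolz_path (b i) (t $ i))", OF VA [OF X] j] by simp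
  qed
  have e1: "V1 i = V i" and e2: "V2 i = V i" if "i \<noteq> j" for i using eq [OF that] by metis+
  have "l (A + B) = l A + l B" for A B
    using l by (simp add: complex_functional_def bounded_linear.linear linear_add)
  then show ?thesis
    by (simp add: G_def integrand_def rem [OF V(1) refl] rem [OF V(2) e1] rem [OF V(3) e2]
        sum opcomp.add_left distrib_left True)
qed (simp add: G_def)

text \<open>By multilinearity the two integrals differ by integrals in which some variable carries the
  kernel \<open>H\<close>, and those vanish.\<close>

lemma G_insertion:
  assumes "K \<subseteq> \<Lambda>"
  shows "(LINT t|lborel. G R t) = (LINT t|lborel. G (\<lambda>i. if i \<in> K then (\<lambda>z. R i z - H i z) else R i) t)"
  using finite [of K] assms
proof (induction K rule: finite_induct)
  case (insert j K)
  let ?V = "\<lambda>i. if i \<in> K then (\<lambda>z. R i z - H i z) else R i"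
  let ?V1 = "\<lambda>i. if i \<in> insert j K then (\<lambda>z. R i z - H i z) else R i"
  let ?V2 = "\<lambda>i. if i = j then H i else ?V i"
  have 0: "?V = (\<lambda>i. if i \<in> - K then R i else if i \<in> {} then H i else (\<lambda>z. R i z - H i z))" by auto
  have 1: "?V1 = (\<lambda>i. if i \<in> - insert j K then R i else if i \<in> {} then H i else (\<lambda>z. R i z - H i z))" by auto
  have 2: "?V2 = (\<lambda>i. if i \<in> - insert j K then R i else if i \<in> {j} then H i else (\<lambda>z. R i z - H i z))" by auto
  have gV: "controlled ?V" unfolding 0 by (rule kernels_controlled)
  have gV1: "controlled ?V1" unfolding 1 by (rule kernels_controlled)
  have gV2: "controlled ?V2" unfolding 2 by (rule kernels_controlled)
  have "G ?V t = G ?V1 t + G ?V2 t" for t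
    by (rule G_split [where j = j, OF gV gV1 gV2]) (use insert in auto)
  then have "(LINT t|lborel. G ?V t) = (LINT t|lborel. G ?V1 t) + (LINT t|lborel. G ?V2 t)"
    using G_integrable [OF gV1] G_integrable [OF gV2] by simp
  also have "(LINT t|lborel. G ?V2 t) = 0"
    by (rule G_regular_zero [OF gV2, where j = j]) (use insert in auto)
  finally show ?case using insert by simp
qed simp

end

section \<open>The estimate for a single Cauchy integral\<close>

text \<open>The summand \<open>1\<close> takes care of constant functions. The factor \<open>8 \<pi> / c\<close> compares the length
  element of the contour with \<open>\<bar>1 - l\<bar>\<close>, and \<open>64 (36 / c\<^sup>3)\<^sup>2\<close> is the bound for the sums of \<open>\<bar>\<phi>\<bar>\<close>.\<close>

definition calculus_bound :: "real \<Rightarrow> real \<Rightarrow> real \<Rightarrow> nat \<Rightarrow> real"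
  where "calculus_bound C D c m =
    1 + 2 * (C * ((8 * pi / c) ^ m * (64 * (36 / c ^ 3)\<^sup>2) ^ m) * D ^ m * (C * (64 * (36 / c ^ 3)\<^sup>2) ^ m))"

context H0_integral
begin

lemma F_nonneg: "F \<ge> 0"
proof -
  have "0 \<in> stolz_prod \<gamma>" using zero_in_domain by (simp add: stolz_prod_def)
  then show ?thesis using f_bound [of 0] norm_ge_zero order_trans by blast
qed

text \<open>After \<open>R - H = \<phi>\<^sup>2 R\<close> has been inserted, the sum over the blocks at fixed parameters is the
  functional \<open>l\<close> of the operator of \<open>discrete_estimate\<close>. The coefficients are bounded since the
  length of a block, the weight, is comparable to the distance \<open>\<bar>1 - l\<bar>\<close> by which the resolvent is
  normalized.\<close>

lemma integral_G_bound:
  "cmod (LINT t|lborel. G R t)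
    \<le> 2 * (C * (((8 * pi / c) ^ card \<Lambda> * F) * B1 ^ card \<Lambda>) * D ^ card \<Lambda> * (C * (1 * B1 ^ card \<Lambda>)))"
  (is "_ \<le> ?B")
proof -
  define A where "A = (8 * pi / c) ^ card \<Lambda> * F"
  have A: "A \<ge> 0" using c F_nonneg by (simp add: A_def)
  have B0: "?B \<ge> 0" using C A D_nonneg by (simp add: A_def [symmetric] B1_def)
  let ?V = "\<lambda>i. if i \<in> \<Lambda> then (\<lambda>z. R i z - H i z) else R i"
  have Veq: "?V = (\<lambda>i. if i \<in> - \<Lambda> then R i else if i \<in> {} then H i else (\<lambda>z. R i z - H i z))" by auto
  have gV: "controlled ?V" unfolding Veq by (rule kernels_controlled)
  have "cmod (LINT t|lborel. G ?V t) \<le> ?B"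
  proof (rule norm_integral_blocks_le [OF G_integrable [OF gV]])
    show "G ?V t = 0" if "t \<notin> cube" for t
    proof -
      have "t \<notin> params" using that stolz_params_unit by (auto simp: params_def cube_def)
      then show ?thesis by (simp add: G_def)
    qed
    fix N and u :: "real ^ 'n" assume u: "u \<in> cube"
    let ?K = "PiE \<Lambda> (\<lambda>_. UNIV \<times> {..<N}) :: ('n \<Rightarrow> bool \<times> nat) set"
    let ?t = "\<lambda>\<kappa>. block_map \<Lambda> \<kappa> u"
    have ui: "u $ i \<in> {0<..<1}" for i using u by (simp add: cube_def)
    show "cmod (\<Sum>\<kappa>\<in>?K. of_real (\<Prod>i\<in>\<Lambda>. weight (\<kappa> i)) * G ?V (?t \<kappa>)) \<le> ?B"
    proof (cases "\<forall>i. i \<notin> \<Lambda> \<longrightarrow> u $ i \<in> stolz_params")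
      case False
      then have "?t \<kappa> \<notin> params" for \<kappa> by (auto simp: params_def block_map_def)
      then have "G ?V (?t \<kappa>) = 0" for \<kappa> by (simp add: G_def)
      then show ?thesis using B0 by simp
    next
      case True
      define p where "p \<kappa> i = stolz_path (b i) (block (\<kappa> i) (u $ i))" for \<kappa> i
      define a where "a \<kappa> = of_real (\<Prod>i\<in>\<Lambda>. weight (\<kappa> i)) * f (pt (?t \<kappa>))
        * (\<Prod>i\<in>\<Lambda>. stolz_deriv (b i) (block (\<kappa> i) (u $ i))) * (\<Prod>i\<in>\<Lambda>. inverse (p \<kappa> i - 1))" for \<kappa>
      let ?W = "\<lambda>\<kappa>. op_prod (\<lambda>i. \<phi> i (p \<kappa> i) o\<^sub>L (\<phi> i (p \<kappa> i) o\<^sub>L ((p \<kappa> i - 1) *\<^sub>C R i (p \<kappa> i)))) \<Lambda>"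
      have tp: "?t \<kappa> \<in> params" for \<kappa>
        using True block_in_params [OF ui] by (auto simp: params_def block_map_def)
      have bu: "block (\<kappa> i) (u $ i) \<in> {0<..<1}" for \<kappa> i by (rule block_in_unit(1) [OF ui])
      have p1: "cmod (p \<kappa> i - 1) \<ge> c * weight (\<kappa> i)" for \<kappa> i
      proof -
        have "c * (weight (\<kappa> i) * (1 + u $ i)) \<le> cmod (1 - p \<kappa> i)"
          using path_point(2) [where k = i and t = "block (\<kappa> i) (u $ i)", OF bu [of \<kappa> i]] by (simp only: p_def block_in_unit(2) [OF ui])
        moreover have "c * (weight (\<kappa> i) * 1) \<le> c * (weight (\<kappa> i) * (1 + u $ i))"
          using c weight_pos [of "\<kappa> i"] ui [of i] by (intro mult_left_mono) auto
        ultimately show ?thesis by (simp add: norm_minus_commute)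
      qed
      have p0: "p \<kappa> i \<noteq> 1" for \<kappa> i
      proof -
        have "0 < c * weight (\<kappa> i)" using c weight_pos by (intro mult_pos_pos) auto
        then have "cmod (p \<kappa> i - 1) > 0" using p1 [of \<kappa> i] by linarith
        then show ?thesis by auto
      qed
      have am: "cmod (a \<kappa>) \<le> A" for \<kappa>
      proof -
        have "cmod (a \<kappa>) = cmod (f (pt (?t \<kappa>))) * (\<Prod>i\<in>\<Lambda>. weight (\<kappa> i) * cmod (stolz_deriv (b i) (block (\<kappa> i) (u $ i))) * inverse (cmod (p \<kappa> i - 1)))"
          unfolding a_def norm_mult prod_norm [symmetric] norm_inverse prod.distrib of_real_prod
          using weight_pos by (simp add: abs_of_pos)
        also have "\<dots> \<le> F * (\<Prod>i\<in>\<Lambda>. 8 * pi / c)"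
        proof (intro mult_mono f_bound pt_in tp prod_mono conjI)
          fix i
          have w: "weight (\<kappa> i) > 0" by (rule weight_pos)
          have "inverse (cmod (p \<kappa> i - 1)) \<le> inverse (c * weight (\<kappa> i))"
            using p1 c w by (intro le_imp_inverse_le) auto
          then have "weight (\<kappa> i) * cmod (stolz_deriv (b i) (block (\<kappa> i) (u $ i))) * inverse (cmod (p \<kappa> i - 1))
              \<le> weight (\<kappa> i) * (8 * pi) * inverse (c * weight (\<kappa> i))"
            using w norm_stolz_deriv [OF angles(1) b_less] by (intro mult_mono) auto
          then show "weight (\<kappa> i) * cmod (stolz_deriv (b i) (block (\<kappa> i) (u $ i))) * inverse (cmod (p \<kappa> i - 1)) \<le> 8 * pi / c"
            using w c by (simp add: field_simps)
          show "0 \<le> weight (\<kappa> i) * cmod (stolz_deriv (b i) (block (\<kappa> i) (u $ i))) * inverse (cmod (p \<kappa> i - 1))"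
            using w by simp
        qed (auto intro!: prod_nonneg mult_nonneg_nonneg F_nonneg less_imp_le [OF weight_pos])
        finally show ?thesis by (simp add: A_def mult.commute)
      qed
      have summand: "of_real (\<Prod>i\<in>\<Lambda>. weight (\<kappa> i)) * G ?V (?t \<kappa>) = l (a \<kappa> *\<^sub>C ?W \<kappa>)" for \<kappa>
      proof -
        have RA: "R i (p \<kappa> i) \<in> \<A>" and \<phi>A: "\<phi> i (p \<kappa> i) \<in> \<A>" and HA: "H i (p \<kappa> i) \<in> \<A>" for i
          unfolding p_def using R_in_A [OF bu] kernel_A [OF path_point(1) [OF bu]] by auto
        have WA: "\<phi> i (p \<kappa> i) o\<^sub>L (\<phi> i (p \<kappa> i) o\<^sub>L ((p \<kappa> i - 1) *\<^sub>C R i (p \<kappa> i))) \<in> \<A>" for i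
          by (intro bicommutant_comp bicommutant_scaleC RA \<phi>A)
        have RH: "R i (p \<kappa> i) - H i (p \<kappa> i) = inverse (p \<kappa> i - 1) *\<^sub>C (\<phi> i (p \<kappa> i) o\<^sub>L (\<phi> i (p \<kappa> i) o\<^sub>L ((p \<kappa> i - 1) *\<^sub>C R i (p \<kappa> i))))" for i
        proof -
          have "R i (p \<kappa> i) = (\<phi> i (p \<kappa> i) o\<^sub>L (\<phi> i (p \<kappa> i) o\<^sub>L R i (p \<kappa> i))) + H i (p \<kappa> i)"
            unfolding p_def by (rule resolvent_decomposition [OF path_point(1) [OF bu] path_point(6) [OF bu]])
          then have "R i (p \<kappa> i) - H i (p \<kappa> i) = \<phi> i (p \<kappa> i) o\<^sub>L (\<phi> i (p \<kappa> i) o\<^sub>L R i (p \<kappa> i))"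
            by (metis add_diff_cancel_right')
          then show ?thesis
            using p0 [of \<kappa> i] by (simp add: opcomp_scaleC bicommutant_bounded_ops [OF \<phi>A] scaleC_scaleC)
        qed
        have pe: "stolz_path (b i) (?t \<kappa> $ i) = p \<kappa> i" if "i \<in> \<Lambda>" for i
          using that by (simp add: p_def block_map_def)
        have "op_prod (\<lambda>i. ?V i (stolz_path (b i) (?t \<kappa> $ i))) \<Lambda>
            = op_prod (\<lambda>i. inverse (p \<kappa> i - 1) *\<^sub>C (\<phi> i (p \<kappa> i) o\<^sub>L (\<phi> i (p \<kappa> i) o\<^sub>L ((p \<kappa> i - 1) *\<^sub>C R i (p \<kappa> i))))) \<Lambda>"
        proof (rule op_prod_cong)
          fix i assume i: "i \<in> \<Lambda>"
          have "R i (p \<kappa> i) - H i (p \<kappa> i) \<in> \<A>" by (rule bicommutant_diff [OF RA HA])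
          then show "?V i (stolz_path (b i) (?t \<kappa> $ i)) \<in> \<A>" using i by (simp only: pe if_True)
          show "?V i (stolz_path (b i) (?t \<kappa> $ i))
              = inverse (p \<kappa> i - 1) *\<^sub>C (\<phi> i (p \<kappa> i) o\<^sub>L (\<phi> i (p \<kappa> i) o\<^sub>L ((p \<kappa> i - 1) *\<^sub>C R i (p \<kappa> i))))"
            using i RH [of i] by (simp only: pe if_True)
        qed
        also have "\<dots> = (\<Prod>i\<in>\<Lambda>. inverse (p \<kappa> i - 1)) *\<^sub>C ?W \<kappa>"
          by (rule op_prod_scaleC [OF WA])
        finally have "op_prod (\<lambda>i. ?V i (stolz_path (b i) (?t \<kappa> $ i))) \<Lambda> = (\<Prod>i\<in>\<Lambda>. inverse (p \<kappa> i - 1)) *\<^sub>C ?W \<kappa>" .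
        moreover have "(\<Prod>i\<in>\<Lambda>. stolz_deriv (b i) (?t \<kappa> $ i)) = (\<Prod>i\<in>\<Lambda>. stolz_deriv (b i) (block (\<kappa> i) (u $ i)))"
          by (intro prod.cong) (auto simp: block_map_def)
        moreover have "l (x *\<^sub>C W) = x * l W" for x W using l by (simp add: complex_functional_def)
        ultimately show ?thesis by (simp add: G_def tp integrand_def a_def)
      qed
      have lin: "linear l" using l by (simp add: complex_functional_def bounded_linear.linear)
      have eqS: "(\<Sum>\<kappa>\<in>?K. of_real (\<Prod>i\<in>\<Lambda>. weight (\<kappa> i)) * G ?V (?t \<kappa>)) = l (\<Sum>\<kappa>\<in>?K. a \<kappa> *\<^sub>C ?W \<kappa>)"
        by (simp only: summand linear_sum [OF lin])
      have nle: "norm (\<Sum>\<kappa>\<in>?K. a \<kappa> *\<^sub>C ?W \<kappa>) \<le> C * (A * B1 ^ card \<Lambda>) * D ^ card \<Lambda> * (C * (1 * B1 ^ card \<Lambda>))"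
        unfolding p_def by (rule discrete_estimate) (use ui am A in auto)
      show ?thesis
        unfolding eqS A_def [symmetric]
        by (rule order_trans [OF l_bound]) (intro mult_left_mono nle, simp)
    qed
  qed
  then show ?thesis by (simp only: G_insertion [OF order_refl])
qed

end

context stolz_calculus
begin

text \<open>Exponents above \<open>1\<close> may be lowered to \<open>1\<close> because \<open>\<bar>1 - z\<^sub>i\<bar> \<le> 2\<close>.\<close>

lemma H0_inf_decay:
  assumes "f \<in> H0_inf \<gamma> \<Lambda>"
  obtains c0 s where "c0 > 0" "\<And>i. i \<in> \<Lambda> \<Longrightarrow> 0 < s i \<and> s i \<le> 1"
    "\<And>z. z \<in> stolz_prod \<gamma> \<Longrightarrow> cmod (f z) \<le> c0 * (\<Prod>i\<in>\<Lambda>. cmod (1 - z $ i) powr s i)"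
proof -
  obtain c1 s where c1: "c1 > 0" and s: "\<And>i. i \<in> \<Lambda> \<Longrightarrow> 0 < s i"
    and bd: "\<And>z. z \<in> stolz_prod \<gamma> \<Longrightarrow> cmod (f z) \<le> c1 * (\<Prod>i\<in>\<Lambda>. cmod (1 - z $ i) powr s i)"
    using assms unfolding H0_inf_def by blast
  show ?thesis
  proof (rule that [of "c1 * (\<Prod>i\<in>\<Lambda>. 2 powr (s i - min (s i) 1))" "\<lambda>i. min (s i) 1"])
    show "c1 * (\<Prod>i\<in>\<Lambda>. 2 powr (s i - min (s i) 1)) > 0" using c1 by (intro mult_pos_pos prod_pos) auto
    show "0 < min (s i) 1 \<and> min (s i) 1 \<le> 1" if "i \<in> \<Lambda>" for i using s [OF that] by auto
    fix z assume z: "z \<in> stolz_prod \<gamma>"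
    have zi: "cmod (1 - z $ i) \<le> 2" for i
    proof -
      have "cmod (z $ i) < 1" using z stolz_norm_less by (auto simp: stolz_prod_def)
      then show ?thesis using norm_triangle_ineq4 [of 1 "z $ i"] by simp
    qed
    have "(\<Prod>i\<in>\<Lambda>. cmod (1 - z $ i) powr s i) \<le> (\<Prod>i\<in>\<Lambda>. 2 powr (s i - min (s i) 1) * cmod (1 - z $ i) powr min (s i) 1)"
    proof (intro prod_mono conjI)
      fix i
      have "cmod (1 - z $ i) powr s i = cmod (1 - z $ i) powr (s i - min (s i) 1) * cmod (1 - z $ i) powr min (s i) 1"
        by (simp add: powr_add [symmetric])
      also have "\<dots> \<le> 2 powr (s i - min (s i) 1) * cmod (1 - z $ i) powr min (s i) 1"
        using zi by (intro mult_right_mono powr_mono2) auto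
      finally show "cmod (1 - z $ i) powr s i \<le> 2 powr (s i - min (s i) 1) * cmod (1 - z $ i) powr min (s i) 1" .
    qed auto
    then have "c1 * (\<Prod>i\<in>\<Lambda>. cmod (1 - z $ i) powr s i)
        \<le> c1 * (\<Prod>i\<in>\<Lambda>. 2 powr (s i - min (s i) 1) * cmod (1 - z $ i) powr min (s i) 1)"
      using c1 by (intro mult_left_mono) auto
    with bd [OF z] show "cmod (f z) \<le> c1 * (\<Prod>i\<in>\<Lambda>. 2 powr (s i - min (s i) 1)) * (\<Prod>i\<in>\<Lambda>. cmod (1 - z $ i) powr min (s i) 1)"
      by (simp add: prod.distrib mult.assoc)
  qed
qed

text \<open>A norming functional turns the operator-valued integral into a scalar one, which is
  estimated without reference to the functional.\<close>

lemma norm_H0_op_le: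
  assumes f: "f \<in> H0_inf \<gamma> \<Lambda>" and F: "\<And>z. z \<in> stolz_prod \<gamma> \<Longrightarrow> cmod (f z) \<le> F"
  shows "norm (H0_op b T \<Lambda> f) \<le> calculus_bound C D c (card \<Lambda>) * F"
proof -
  have "(0::complex ^ 'n) \<in> stolz_prod \<gamma>"
    using zero_in_domain by (simp add: stolz_prod_def)
  then have f0: "cmod (f 0) \<le> F" by (rule F)
  then have F0: "F \<ge> 0" using norm_ge_zero order_trans by blast
  define K where "K = C * ((8 * pi / c) ^ card \<Lambda> * B1 ^ card \<Lambda>) * D ^ card \<Lambda> * (C * B1 ^ card \<Lambda>)"
  have K0: "K \<ge> 0" using C c D_nonneg by (simp add: K_def B1_def)
  have cb: "calculus_bound C D c (card \<Lambda>) = 1 + 2 * K" by (simp add: calculus_bound_def K_def B1_def)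
  show ?thesis
  proof (cases "\<Lambda> = {}")
    case True
    have "norm (f 0 *\<^sub>C (id_blinfun :: 'x \<Rightarrow>\<^sub>L 'x)) \<le> F * 1"
      unfolding norm_scaleC using f0 F0 by (intro mult_mono) (auto simp: norm_blinfun_id_le)
    also have "\<dots> \<le> (1 + 2 * K) * F" using K0 F0 by (simp add: algebra_simps)
    finally show ?thesis unfolding cb using True by (simp add: H0_op_def)
  next
    case False
    define S where "S = {t :: real ^ 'n. \<forall>i. t $ i \<in> {0..1}}"
    define Op where "Op t = (f (\<chi> i. if i \<in> \<Lambda> then stolz_path (b i) (t $ i) else 0) *
          (\<Prod>i\<in>\<Lambda>. vector_derivative (stolz_path (b i)) (at (t $ i) within {0..1}))) *\<^sub>C
         op_prod (\<lambda>i. R i (stolz_path (b i) (t $ i))) \<Lambda>" for t :: "real ^ 'n"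
    have "norm (integral S Op) \<le> 2 * K * F"
    \<comment> \<open>a function that is not integrable has integral \<open>0\<close> by convention\<close>
    proof (cases "Op integrable_on S")
      case False
      then show ?thesis using K0 F0 by (simp add: not_integrable_integral)
    next
      case int: True
      obtain l where l: "complex_functional l" "\<And>x. cmod (l x) \<le> 2 * norm x"
        and ln: "norm (integral S Op) \<le> cmod (l (integral S Op))"
        using norming_functional [of "integral S Op"] by blast
      obtain c0 s where c0: "c0 > 0" and s: "\<And>i. i \<in> \<Lambda> \<Longrightarrow> 0 < s i \<and> s i \<le> 1"
        and decay: "\<And>z. z \<in> stolz_prod \<gamma> \<Longrightarrow> cmod (f z) \<le> c0 * (\<Prod>i\<in>\<Lambda>. cmod (1 - z $ i) powr s i)"
        using H0_inf_decay [OF f] by metis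
      interpret H0_integral T C D c E \<gamma> b \<Lambda> f c0 F s l
      proof
        show "holomorphic_several f (stolz_prod \<gamma>)" using f by (simp add: H0_inf_def)
      qed (use F decay c0 s l in auto)
      have bl: "bounded_linear l" using l by (simp add: complex_functional_def)
      have sub: "params \<subseteq> S" by (auto simp: params_def S_def stolz_params_def less_imp_le)
      have neg: "negligible (S - params)"
      proof (rule negligible_subset)
        have hp: "negligible {t :: real ^ 'n. t $ i = x}" for i x
          using negligible_standard_hyperplane [of "axis i (1::real)" x] by (simp add: inner_axis)
        have "negligible (\<Union>x\<in>{0, 1/2, 3/4, 1}. {t :: real ^ 'n. t $ i = x})" for i
          unfolding UN_insert UN_empty Un_empty_right by (intro negligible_Un hp)
        then show "negligible (\<Union>i. \<Union>x\<in>{0, 1/2, 3/4, 1}. {t :: real ^ 'n. t $ i = x})"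
          by (intro negligible_Union finite_imageI finite) blast
        show "S - params \<subseteq> (\<Union>i. \<Union>x\<in>{0, 1/2, 3/4, 1}. {t :: real ^ 'n. t $ i = x})"
        proof
          fix t assume "t \<in> S - params"
          then obtain i where "t $ i \<in> {0..1}" "t $ i \<notin> stolz_params"
            by (auto simp: S_def params_def)
          then have "t $ i \<in> {0, 1/2, 3/4, 1}" by (auto simp: stolz_params_def)
          then show "t \<in> (\<Union>i. \<Union>x\<in>{0, 1/2, 3/4, 1}. {t :: real ^ 'n. t $ i = x})" by blast
        qed
      qed
      have eq: "l (Op t) = integrand R t" if "t \<in> params" for t
      proof -
        have "(\<Prod>i\<in>\<Lambda>. vector_derivative (stolz_path (b i)) (at (t $ i) within {0..1})) = (\<Prod>i\<in>\<Lambda>. stolz_deriv (b i) (t $ i))"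
          using that by (intro prod.cong) (auto simp: params_def intro!: stolz_path_vector_derivative)
        then show ?thesis
          using l(1) by (simp add: Op_def integrand_def pt_def complex_functional_def)
      qed
      have gR: "controlled R" using kernels_controlled [of UNIV "{}"] by simp
      have si: "set_integrable lborel params (integrand R)"
        using G_integrable [OF gR] by (simp add: set_integrable_def G_def [abs_def])
      have "l (integral S Op) = integral S (l \<circ> Op)" by (rule integral_linear [OF int bl, symmetric])
      also have "\<dots> = integral params (l \<circ> Op)"
        by (rule integral_spike_set) (use sub neg in \<open>auto intro: negligible_subset\<close>)
      also have "\<dots> = integral params (integrand R)" using eq by (intro Henstock_Kurzweil_Integration.integral_cong) simp
      also have "\<dots> = (LINT t|lborel. G R t)"
        using set_borel_integral_eq_integral(2) [OF si] by (simp add: set_lebesgue_integral_def G_def [abs_def])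
      finally have "norm (integral S Op) \<le> cmod (LINT t|lborel. G R t)" using ln by simp
      also note integral_G_bound
      finally show ?thesis by (simp add: K_def mult_ac)
    qed
    moreover have "norm (H0_op b T \<Lambda> f) = cmod ((1 / (2 * of_real pi * \<i>)) ^ card \<Lambda>) * norm (integral S Op)"
      using False by (simp add: H0_op_def norm_scaleC Op_def [abs_def] S_def)
    moreover have "cmod ((1 / (2 * of_real pi * \<i>)) ^ card \<Lambda>) \<le> 1"
      unfolding norm_power using pi_gt3 by (intro power_le_one) (auto simp: norm_divide norm_mult)
    ultimately have "norm (H0_op b T \<Lambda> f) \<le> 1 * (2 * K * F)" by (metis mult_mono norm_ge_zero zero_le_one)
    then show ?thesis unfolding cb using F0 by (simp add: distrib_right)
  qed
qed

end

section \<open>Bounds for the components of a function\<close>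

text \<open>Let the variables outside \<open>\<Lambda>\<close> tend to \<open>1\<close>. The components that depend on one of them tend to
  \<open>0\<close>, the others do not change.\<close>

lemma H01_partial_sum_bound:
  fixes \<gamma> :: "'n::finite \<Rightarrow> real"
  assumes \<gamma>: "\<And>i. 0 < \<gamma> i \<and> \<gamma> i < pi / 2" and F: "F \<in> H01_inf \<gamma>"
    and M: "\<And>z. z \<in> stolz_prod \<gamma> \<Longrightarrow> cmod (H01_fun F z) \<le> M" and z: "z \<in> stolz_prod \<gamma>"
  shows "cmod (\<Sum>\<Lambda>'\<in>Pow \<Lambda>. F \<Lambda>' z) \<le> M"
proof -
  define \<tau> where "\<tau> n = 1 / (real n + 1)" for n :: nat
  have \<tau>: "0 < \<tau> n" "\<tau> n \<le> 1" for n by (auto simp: \<tau>_def)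
  have \<tau>0: "\<tau> \<longlonglongrightarrow> 0" unfolding \<tau>_def by real_asymp
  define w :: "nat \<Rightarrow> complex ^ 'n" where "w n = (\<chi> i. if i \<in> \<Lambda> then z $ i else of_real (1 - \<tau> n))" for n
  have w: "w n \<in> stolz_prod \<gamma>" for n
  proof -
    have "of_real (1 - \<tau> n) \<in> stolz (\<gamma> i)" for i
      using \<gamma> [of i] pi_gt_zero \<tau> by (intro radius_in_stolz) auto
    then show ?thesis using z by (simp add: stolz_prod_def w_def)
  qed
  have le2: "cmod (1 - v $ i) \<le> 2" if "v \<in> stolz_prod \<gamma>" for v :: "complex ^ 'n" and i
  proof -
    have "cmod (v $ i) < 1" using that stolz_norm_less by (auto simp: stolz_prod_def)
    then show ?thesis using norm_triangle_ineq4 [of 1 "v $ i"] by simp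
  qed
  have lim: "(\<lambda>n. F \<Lambda>' (w n)) \<longlonglongrightarrow> (if \<Lambda>' \<subseteq> \<Lambda> then F \<Lambda>' z else 0)" for \<Lambda>'
  proof (cases "\<Lambda>' \<subseteq> \<Lambda>")
    case True
    have dep: "F \<Lambda>' u = F \<Lambda>' v" if "u \<in> stolz_prod \<gamma>" "v \<in> stolz_prod \<gamma>" "\<forall>i\<in>\<Lambda>'. u $ i = v $ i" for u v
      using F that unfolding H01_inf_def H0_inf_def by blast
    have "F \<Lambda>' (w n) = F \<Lambda>' z" for n
      by (rule dep [OF w z]) (use True in \<open>auto simp: w_def\<close>)
    then show ?thesis using True by simp
  next
    case False
    then obtain j where j: "j \<in> \<Lambda>'" "j \<notin> \<Lambda>" by auto
    obtain c0 s where c0: "c0 > 0" and s: "\<And>i. i \<in> \<Lambda>' \<Longrightarrow> 0 < s i"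
      and bd: "\<And>z. z \<in> stolz_prod \<gamma> \<Longrightarrow> cmod (F \<Lambda>' z) \<le> c0 * (\<Prod>i\<in>\<Lambda>'. cmod (1 - z $ i) powr s i)"
    proof -
      have "F \<Lambda>' \<in> H0_inf \<gamma> \<Lambda>'" using F by (simp add: H01_inf_def)
      then show ?thesis using that unfolding H0_inf_def by blast
    qed
    define K where "K = c0 * (\<Prod>i\<in>\<Lambda>' - {j}. 2 powr s i)"
    have "cmod (F \<Lambda>' (w n)) \<le> K * \<tau> n powr s j" for n
    proof -
      have "(\<Prod>i\<in>\<Lambda>'. cmod (1 - w n $ i) powr s i) = cmod (1 - w n $ j) powr s j * (\<Prod>i\<in>\<Lambda>' - {j}. cmod (1 - w n $ i) powr s i)"
        using j by (subst prod.remove [of _ j]) auto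
      also have "cmod (1 - w n $ j) = \<tau> n" using j \<tau> [of n] by (simp add: w_def less_imp_le)
      also have "\<tau> n powr s j * (\<Prod>i\<in>\<Lambda>' - {j}. cmod (1 - w n $ i) powr s i) \<le> \<tau> n powr s j * (\<Prod>i\<in>\<Lambda>' - {j}. 2 powr s i)"
        using le2 [OF w] s by (intro mult_left_mono prod_mono conjI powr_mono2) (auto simp: less_imp_le)
      finally have "c0 * (\<Prod>i\<in>\<Lambda>'. cmod (1 - w n $ i) powr s i) \<le> c0 * (\<tau> n powr s j * (\<Prod>i\<in>\<Lambda>' - {j}. 2 powr s i))"
        using c0 by (intro mult_left_mono) auto
      then show ?thesis using bd [OF w [of n]] by (simp add: K_def mult_ac)
    qed
    then have ev: "\<forall>\<^sub>F n in sequentially. norm (F \<Lambda>' (w n)) \<le> K * \<tau> n powr s j" by (intro always_eventually) auto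
    have "(\<lambda>n. \<tau> n powr s j) \<longlonglongrightarrow> 0"
      using s [OF j(1)] \<tau> by (intro tendsto_zero_powrI [OF \<tau>0 tendsto_const]) (auto intro!: always_eventually simp: less_imp_le)
    then have "(\<lambda>n. K * \<tau> n powr s j) \<longlonglongrightarrow> K * 0" by (intro tendsto_intros)
    then have "(\<lambda>n. K * \<tau> n powr s j) \<longlonglongrightarrow> 0" by simp
    then have "(\<lambda>n. F \<Lambda>' (w n)) \<longlonglongrightarrow> 0" by (rule Lim_null_comparison [OF ev])
    then show ?thesis using False by simp
  qed
  have "(\<lambda>n. H01_fun F (w n)) \<longlonglongrightarrow> (\<Sum>\<Lambda>'\<in>UNIV. if \<Lambda>' \<subseteq> \<Lambda> then F \<Lambda>' z else 0)"
    unfolding H01_fun_def by (intro tendsto_sum lim)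
  moreover have "(\<Sum>\<Lambda>'\<in>UNIV. if \<Lambda>' \<subseteq> \<Lambda> then F \<Lambda>' z else 0) = (\<Sum>\<Lambda>'\<in>Pow \<Lambda>. F \<Lambda>' z)"
    by (rule sum.mono_neutral_cong_right) auto
  ultimately have "(\<lambda>n. H01_fun F (w n)) \<longlonglongrightarrow> (\<Sum>\<Lambda>'\<in>Pow \<Lambda>. F \<Lambda>' z)" by simp
  from tendsto_norm [OF this] show ?thesis
    by (rule tendsto_upperbound) (auto intro!: always_eventually M w)
qed

text \<open>The component \<open>f\<^sub>\<Lambda>\<close> is the partial sum over the subsets of \<open>\<Lambda>\<close> minus the components of the
  proper subsets, which are bounded by induction. The exponent \<open>card \<Lambda> * card \<Lambda>\<close> is a crude choice
  for which this recursion closes.\<close>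

lemma H01_component_bound:
  fixes \<gamma> :: "'n::finite \<Rightarrow> real"
  assumes \<gamma>: "\<And>i. 0 < \<gamma> i \<and> \<gamma> i < pi / 2" and F: "F \<in> H01_inf \<gamma>"
    and M: "\<And>z. z \<in> stolz_prod \<gamma> \<Longrightarrow> cmod (H01_fun F z) \<le> M" and z: "z \<in> stolz_prod \<gamma>"
  shows "cmod (F \<Lambda> z) \<le> 2 ^ (card \<Lambda> * card \<Lambda>) * M"
  using finite [of \<Lambda>]
proof (induction \<Lambda> rule: finite_psubset_induct)
  case (psubset \<Lambda>)
  have M0: "M \<ge> 0" using M [OF z] norm_ge_zero order_trans by blast
  have fin: "finite (Pow \<Lambda> - {\<Lambda>})" by simp
  have split: "(\<Sum>\<Lambda>'\<in>Pow \<Lambda>. F \<Lambda>' z) = F \<Lambda> z + (\<Sum>\<Lambda>'\<in>Pow \<Lambda> - {\<Lambda>}. F \<Lambda>' z)"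
    by (rule sum.remove) auto
  have "cmod (F \<Lambda> z) \<le> cmod (\<Sum>\<Lambda>'\<in>Pow \<Lambda>. F \<Lambda>' z) + cmod (\<Sum>\<Lambda>'\<in>Pow \<Lambda> - {\<Lambda>}. F \<Lambda>' z)"
    unfolding split using norm_triangle_ineq4 [of "F \<Lambda> z + (\<Sum>\<Lambda>'\<in>Pow \<Lambda> - {\<Lambda>}. F \<Lambda>' z)" "\<Sum>\<Lambda>'\<in>Pow \<Lambda> - {\<Lambda>}. F \<Lambda>' z"]
    by simp
  also have "\<dots> \<le> M + (\<Sum>\<Lambda>'\<in>Pow \<Lambda> - {\<Lambda>}. 2 ^ ((card \<Lambda> - 1) * (card \<Lambda> - 1)) * M)"
  proof (intro add_mono H01_partial_sum_bound [OF \<gamma> F M z] sum_norm_le)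
    fix \<Lambda>' assume L: "\<Lambda>' \<in> Pow \<Lambda> - {\<Lambda>}"
    then have sub: "\<Lambda>' \<subset> \<Lambda>" by auto
    have cd: "card \<Lambda>' \<le> card \<Lambda> - 1" using psubset_card_mono [OF finite sub] by simp
    have "cmod (F \<Lambda>' z) \<le> 2 ^ (card \<Lambda>' * card \<Lambda>') * M" by (rule psubset.IH [OF sub])
    also have "\<dots> \<le> 2 ^ ((card \<Lambda> - 1) * (card \<Lambda> - 1)) * M"
      using cd M0 by (intro mult_right_mono power_increasing mult_le_mono) auto
    finally show "cmod (F \<Lambda>' z) \<le> 2 ^ ((card \<Lambda> - 1) * (card \<Lambda> - 1)) * M" .
  qed
  also have "\<dots> = M + (2 ^ card \<Lambda> - 1) * (2 ^ ((card \<Lambda> - 1) * (card \<Lambda> - 1)) * M)"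
    by (simp add: card_Pow of_nat_diff)
  also have "\<dots> \<le> 2 ^ (card \<Lambda> * card \<Lambda>) * M"
  proof (cases "card \<Lambda>")
    case (Suc k)
    have "(1::real) + (2 ^ Suc k - 1) * 2 ^ (k * k) \<le> 2 ^ Suc k * 2 ^ (k * k)"
      by (simp add: left_diff_distrib)
    also have "\<dots> = 2 ^ (Suc k + k * k)" by (simp add: power_add)
    also have "\<dots> \<le> 2 ^ (Suc k * Suc k)" by (intro power_increasing) auto
    finally have "(1 + (2 ^ Suc k - 1) * 2 ^ (k * k)) * M \<le> 2 ^ (Suc k * Suc k) * M"
      using M0 by (rule mult_right_mono)
    then show ?thesis unfolding Suc by (simp only: diff_Suc_1 distrib_right mult_1 mult.assoc)
  qed simp
  finally show ?case .
qed

section \<open>The joint functional calculus\<close>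

lemma Ritt_bounded_ops: "Ritt S \<Longrightarrow> S \<in> bounded_ops"
  by (simp add: Ritt_def)

text \<open>If \<open>2 cos a \<le> e\<close>, the complement of the Stolz domain of angle \<open>a\<close> lies in the region where
  the resolvent is known to be bounded.\<close>

lemma Ritt_of_typeI:
  fixes S :: "'x::complex_banach \<Rightarrow>\<^sub>L 'x"
  assumes S: "Ritt S" and a: "0 < a" "a < pi / 2" "2 * cos a \<le> e"
    and rad: "rad_bounded D E"
    and res: "\<And>\<mu>. \<mu> \<noteq> 1 \<Longrightarrow> 1 - cmod \<mu> \<le> e * cmod (1 - \<mu>) \<Longrightarrow>
      is_op_inverse (\<mu> *\<^sub>C id_blinfun - S) (resolvent \<mu> S) \<and> (\<mu> - 1) *\<^sub>C resolvent \<mu> S \<in> E"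
  shows "Ritt_of_type a S"
proof -
  have region: "\<mu> \<noteq> 1 \<and> 1 - cmod \<mu> \<le> e * cmod (1 - \<mu>)"
    if b: "a \<le> b" "b < pi / 2" and \<mu>: "\<mu> \<notin> closure (stolz b)" for b \<mu>
  proof -
    have "0 < b" using a(1) b(1) by linarith
    note out = outside_stolz [OF this b(2) \<mu>]
    have "cos b \<le> cos a" using a b by (intro cos_monotone_0_pi_le) auto
    then have "2 * cos b * cmod (1 - \<mu>) \<le> e * cmod (1 - \<mu>)" using a(3) by (intro mult_right_mono) auto
    then show ?thesis using out by linarith
  qed
  have "spectrum S \<subseteq> closure (stolz a)"
  proof
    fix \<mu> assume "\<mu> \<in> spectrum S"
    then have "\<not> is_op_inverse (\<mu> *\<^sub>C id_blinfun - S) (resolvent \<mu> S)" by (auto simp: spectrum_def)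
    then show "\<mu> \<in> closure (stolz a)" using region [OF order_refl a(2)] res by blast
  qed
  moreover have "\<exists>K>0. \<forall>\<mu>. \<mu> \<notin> closure (stolz b) \<longrightarrow> norm ((\<mu> - 1) *\<^sub>C resolvent \<mu> S) \<le> K"
    if b: "a < b" "b < pi / 2" for b
  proof (intro exI conjI allI impI)
    show "D + 1 > 0" using rad by (simp add: rad_bounded_def)
    fix \<mu> assume "\<mu> \<notin> closure (stolz b)"
    then have "(\<mu> - 1) *\<^sub>C resolvent \<mu> S \<in> E" using region [of b \<mu>] b res by simp
    then show "norm ((\<mu> - 1) *\<^sub>C resolvent \<mu> S) \<le> D + 1"
      using rad_bounded_norm_le [OF rad] by fastforce
  qed
  ultimately show ?thesis using S a unfolding Ritt_of_type_def by blast
qed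

lemma R_Ritt_rad_bounded:
  fixes S :: "'x::complex_banach \<Rightarrow>\<^sub>L 'x"
  assumes r: "Rademacher_sequence \<Omega> r" and S: "R_Ritt \<Omega> r S"
  shows "\<exists>C\<ge>1. rad_bounded C {op_power S n |n. True} \<and>
    rad_bounded C {real n *\<^sub>R (op_power S n - op_power S (n - 1)) |n. n \<ge> 1}"
proof -
  obtain C1 C2 where "rad_bounded C1 {op_power S n |n. True}"
    "rad_bounded C2 {real n *\<^sub>R (op_power S n - op_power S (n - 1)) |n. n \<ge> 1}"
    using R_bounded_imp_rad_bounded [OF r] S unfolding R_Ritt_def by blast
  then show ?thesis
    by (intro exI [of _ "max 1 (max C1 C2)"]) (auto elim!: rad_bounded_mono)
qed

theorem theorem1p3:
  fixes T :: "'n::finite \<Rightarrow> 'x::complex_banach \<Rightarrow>\<^sub>L 'x"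
    and \<Omega>\<^sub>0 :: "'w measure" and r :: "nat \<Rightarrow> 'w \<Rightarrow> real"
  assumes rademacher: "Rademacher_sequence \<Omega>\<^sub>0 r"
    and commuting: "\<And>j k. T j o\<^sub>L T k = T k o\<^sub>L T j"
    and R_Ritt: "\<And>k. R_Ritt \<Omega>\<^sub>0 r (T k)"
    and poly_bounded: "polynomially_bounded T"
  shows "\<exists>\<gamma> :: 'n \<Rightarrow> real. (\<forall>k. 0 < \<gamma> k \<and> \<gamma> k < pi / 2) \<and> joint_Hinf_calculus \<gamma> T"
proof -
  have ritt: "Ritt (T k)" for k using R_Ritt by (simp add: R_Ritt_def)
  have ops: "T k \<in> bounded_ops" for k by (rule Ritt_bounded_ops [OF ritt])
  interpret commuting_family T by standard (use ops commuting in auto)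
  define resolvent_region where "resolvent_region k e D E \<longleftrightarrow> rad_bounded D E \<and>
      (\<forall>\<mu>. \<mu> \<noteq> 1 \<longrightarrow> 1 - cmod \<mu> \<le> e * cmod (1 - \<mu>) \<longrightarrow>
        is_op_inverse (\<mu> *\<^sub>C id_blinfun - T k) (resolvent \<mu> (T k)) \<and> (\<mu> - 1) *\<^sub>C resolvent \<mu> (T k) \<in> E)"
    for k :: 'n and e D :: real and E :: "('x \<Rightarrow>\<^sub>L 'x) set"
  have "\<exists>p :: real \<times> real \<times> real \<times> ('x \<Rightarrow>\<^sub>L 'x) set.
      rad_bounded (fst p) {op_power (T k) n |n. True} \<and> fst (snd p) > 0 \<and>
      resolvent_region k (fst (snd p)) (fst (snd (snd p))) (snd (snd (snd p)))" for k
  proof -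
    obtain C1 where C1: "C1 \<ge> 1" "rad_bounded C1 {op_power (T k) n |n. True}"
      "rad_bounded C1 {real n *\<^sub>R (op_power (T k) n - op_power (T k) (n - 1)) |n. n \<ge> 1}"
      using R_Ritt_rad_bounded [OF rademacher R_Ritt [of k]] by blast
    obtain e D E where "e > 0" "resolvent_region k e D E"
      using rad_bounded_resolvent_region [OF ops C1] unfolding resolvent_region_def by blast
    with C1(2) show ?thesis by (intro exI [of _ "(C1, e, D, E)"]) simp
  qed
  then obtain p :: "'n \<Rightarrow> real \<times> real \<times> real \<times> ('x \<Rightarrow>\<^sub>L 'x) set" where
    p: "\<And>k. rad_bounded (fst (p k)) {op_power (T k) n |n. True} \<and> fst (snd (p k)) > 0 \<and>
      resolvent_region k (fst (snd (p k))) (fst (snd (snd (p k)))) (snd (snd (snd (p k))))"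
    using choice [OF allI, of "\<lambda>k p. rad_bounded (fst p) {op_power (T k) n |n. True} \<and> fst (snd p) > 0 \<and> resolvent_region k (fst (snd p)) (fst (snd (snd p))) (snd (snd (snd p)))"] by blast
  define C0 e D0 E where "C0 k = fst (p k)" and "e k = fst (snd (p k))"
    and "D0 k = fst (snd (snd (p k)))" and "E k = snd (snd (snd (p k)))" for k
  have C0: "rad_bounded (C0 k) {op_power (T k) n |n. True}" and e0: "e k > 0"
    and region: "resolvent_region k (e k) (D0 k) (E k)" for k
    using p [of k] by (simp_all add: C0_def e_def D0_def E_def)
  have D0: "rad_bounded (D0 k) (E k)" for k
    using region [of k] by (simp add: resolvent_region_def)
  have res0: "is_op_inverse (\<mu> *\<^sub>C id_blinfun - T k) (resolvent \<mu> (T k)) \<and> (\<mu> - 1) *\<^sub>C resolvent \<mu> (T k) \<in> E k"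
    if "\<mu> \<noteq> 1" "1 - cmod \<mu> \<le> e k * cmod (1 - \<mu>)" for k \<mu>
    using region [of k] that unfolding resolvent_region_def by blast
  obtain Cp where Cp: "Cp \<ge> 1" "\<And>h. norm (poly_op h T) \<le> Cp * (SUP z\<in>torus. cmod (poly_eval h z))"
    using poly_bounded unfolding polynomially_bounded_def torus_def by blast
  \<comment> \<open>the worst constants of the finitely many operators\<close>
  define \<epsilon> where "\<epsilon> = Min (range e)"
  have \<epsilon>: "\<epsilon> > 0" "\<And>k. \<epsilon> \<le> e k" using e0 by (auto simp: \<epsilon>_def)
  define D where "D = Max (range D0)"
  have D: "rad_bounded D (E k)" for k by (rule rad_bounded_mono [OF D0]) (simp add: D_def)
  define C where "C = max Cp (Max (range C0))"
  have C: "C \<ge> 1" "C \<ge> Cp" "C \<ge> C0 k" for k using Cp by (auto simp: C_def le_max_iff_disj)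
  \<comment> \<open>Every contour angle \<open>b\<close> will lie between \<open>a\<close> and \<open>g\<close>. Then \<open>2 cos b \<le> 2 x \<le> \<epsilon>\<close> puts the contour into
    the region where the resolvents are R-bounded, and \<open>c \<le> cos b\<close> makes the estimate uniform.\<close>
  define x where "x = min (\<epsilon> / 2) (1 / 2)"
  have x: "0 < x" "x < 1" "2 * x \<le> \<epsilon>" using \<epsilon> by (auto simp: x_def)
  define a where "a = arccos x"
  have cosa: "cos a = x" using x by (simp add: a_def)
  have a: "0 < a" "a < pi / 2"
    using arccos_less_arccos [of x 1] arccos_less_arccos [of 0 x] x by (auto simp: a_def)
  define g where "g = (a + pi / 2) / 2"
  have g: "a < g" "g < pi / 2" using a by (auto simp: g_def)
  define c where "c = cos g"
  have c: "c > 0" unfolding c_def using a g by (intro cos_gt_zero) auto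
  have res: "is_op_inverse (\<mu> *\<^sub>C id_blinfun - T k) (resolvent \<mu> (T k)) \<and> (\<mu> - 1) *\<^sub>C resolvent \<mu> (T k) \<in> E k"
    if "\<mu> \<noteq> 1" "1 - cmod \<mu> \<le> \<epsilon> * cmod (1 - \<mu>)" for \<mu> k
  proof (rule res0 [OF that(1)])
    have "\<epsilon> * cmod (1 - \<mu>) \<le> e k * cmod (1 - \<mu>)" using \<epsilon>(2) by (intro mult_right_mono) auto
    then show "1 - cmod \<mu> \<le> e k * cmod (1 - \<mu>)" using that(2) by linarith
  qed
  have type: "Ritt_of_type a (T k)" for k
    by (rule Ritt_of_typeI [OF ritt a _ D res]) (use x in \<open>auto simp: cosa\<close>)
  define K where "K = (\<Sum>\<Lambda>\<in>(UNIV :: 'n set set). calculus_bound C D c (card \<Lambda>) * 2 ^ (card \<Lambda> * card \<Lambda>))"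
  have D0': "D \<ge> 0" using D by (simp add: rad_bounded_def)
  have cb: "calculus_bound C D c m \<ge> 1" for m
    using C(1) D0' c by (simp add: calculus_bound_def)
  have K: "K > 0"
    unfolding K_def using cb by (intro sum_pos mult_pos_pos) (auto intro: less_le_trans [OF zero_less_one])
  have "norm (H01_op b T F) \<le> K * (SUP z\<in>stolz_prod (\<lambda>_. g). cmod (H01_fun F z))"
    if b: "\<forall>k. a < b k \<and> b k < g" and F: "F \<in> H01_inf (\<lambda>_. g)" for b :: "'n \<Rightarrow> real" and F
  proof -
    interpret stolz_calculus T C D c E "\<lambda>_. g" b
    proof
      show "norm (op_power (T k) n) \<le> C" for k n
        using rad_bounded_norm_le [OF C0, of "op_power (T k) n" k] C(3) [of k] by fastforce
      show "norm (poly_op h T) \<le> C * (SUP z\<in>torus. cmod (poly_eval h z))" for h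
      proof (rule order_trans [OF Cp(2)])
        have mem: "(\<chi> i. 1) \<in> torus" by (simp add: torus_def)
        have bdd: "bdd_above ((\<lambda>z. cmod (poly_eval h z)) ` torus)"
          using bounded_poly_eval [of h] by (auto simp: bounded_iff bdd_above_def)
        have "0 \<le> (SUP z\<in>torus. cmod (poly_eval h z))"
          by (rule cSUP_upper2 [OF bdd mem]) simp
        then show "Cp * (SUP z\<in>torus. cmod (poly_eval h z)) \<le> C * (SUP z\<in>torus. cmod (poly_eval h z))"
          using C(2) by (intro mult_right_mono)
      qed
      have ab: "a < b k" "b k < g" for k using b by auto
      have b0: "0 < b k" for k using ab(1) [of k] a(1) by linarith
      show "0 < b k" "b k < g" "g < pi / 2" for k using ab b0 g by auto
      show "c \<le> cos (b k)" for k
        unfolding c_def using ab(2) [of k] b0 [of k] g by (intro cos_monotone_0_pi_le) linarith+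
      fix t :: real and k assume t: "t \<in> {0<..<1}"
      have bk: "0 < b k" "b k < pi / 2" "a < b k" using ab [of k] b0 [of k] g by linarith+
      note bd = stolz_path_bounds [OF t bk(1,2)]
      have "cos (b k) > 0" using bk by (intro cos_gt_zero) auto
      then have "cos (b k) * min t (1 - t) > 0" using t by auto
      then have "cmod (1 - stolz_path (b k) t) > 0" using bd(1) by linarith
      then have "stolz_path (b k) t \<noteq> 1" by auto
      moreover have "1 - cmod (stolz_path (b k) t) \<le> \<epsilon> * cmod (1 - stolz_path (b k) t)"
      proof (rule order_trans [OF bd(4)], rule mult_right_mono)
        have "cos (b k) \<le> cos a" using bk a by (intro cos_monotone_0_pi_le) auto
        then show "2 * cos (b k) \<le> \<epsilon>" using x by (simp add: cosa)
      qed simp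
      ultimately show "is_op_inverse (stolz_path (b k) t *\<^sub>C id_blinfun - T k) (resolvent (stolz_path (b k) t) (T k)) \<and>
          (stolz_path (b k) t - 1) *\<^sub>C resolvent (stolz_path (b k) t) (T k) \<in> E k"
        by (rule res)
    qed (use C D c in auto)
    define M where "M = (SUP z\<in>stolz_prod (\<lambda>_::'n. g). cmod (H01_fun F z))"
    have FL: "F \<Lambda> \<in> H0_inf (\<lambda>_. g) \<Lambda>" for \<Lambda> using F by (simp add: H01_inf_def)
    have "bdd_above ((\<lambda>z. cmod (H01_fun F z)) ` stolz_prod (\<lambda>_. g))"
    proof -
      have "\<exists>B. \<forall>z\<in>stolz_prod (\<lambda>_. g). cmod (F \<Lambda> z) \<le> B" for \<Lambda>
      proof -
        have "bounded (F \<Lambda> ` stolz_prod (\<lambda>_. g))" using FL [of \<Lambda>] unfolding H0_inf_def by blast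
        then show ?thesis unfolding bounded_iff by blast
      qed
      then obtain B where B: "\<forall>\<Lambda>. \<forall>z\<in>stolz_prod (\<lambda>_. g). cmod (F \<Lambda> z) \<le> B \<Lambda>"
        using choice [of "\<lambda>\<Lambda> B. \<forall>z\<in>stolz_prod (\<lambda>_. g). cmod (F \<Lambda> z) \<le> B"] by blast
      show ?thesis
        by (rule bdd_aboveI2 [where M = "\<Sum>\<Lambda>\<in>UNIV. B \<Lambda>"]) (use B in \<open>auto simp: H01_fun_def intro!: sum_norm_le\<close>)
    qed
    then have M: "cmod (H01_fun F z) \<le> M" if "z \<in> stolz_prod (\<lambda>_. g)" for z
      unfolding M_def using cSUP_upper [OF that] by blast
    have comp: "cmod (F \<Lambda> z) \<le> 2 ^ (card \<Lambda> * card \<Lambda>) * M" if "z \<in> stolz_prod (\<lambda>_. g)" for z \<Lambda>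
      by (rule H01_component_bound [OF _ F M that]) (use a g in linarith)
    have bound: "norm (H0_op b T \<Lambda> (F \<Lambda>)) \<le> calculus_bound C D c (card \<Lambda>) * (2 ^ (card \<Lambda> * card \<Lambda>) * M)" for \<Lambda>
      by (rule norm_H0_op_le [OF FL comp])
    have "norm (H01_op b T F) \<le> (\<Sum>\<Lambda>\<in>(UNIV :: 'n set set).
        calculus_bound C D c (card \<Lambda>) * (2 ^ (card \<Lambda> * card \<Lambda>) * M))"
      unfolding H01_op_def by (rule sum_norm_le) (rule bound)
    also have "\<dots> = K * M" unfolding K_def sum_distrib_right by (simp only: mult.assoc)
    finally show ?thesis unfolding M_def .
  qed
  then have "joint_Hinf_calculus (\<lambda>_. g) T"
    unfolding joint_Hinf_calculus_def
    by (intro exI [of _ "\<lambda>_. a"] conjI exI [of _ K] allI impI ballI) (use type g K in blast)+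
  moreover have "0 < g" using a g by simp
  ultimately show ?thesis using g by (intro exI [of _ "\<lambda>_. g"]) auto
qed

end
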